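(* Let $b$ be a rational function which is a non-extreme point of $H^\infty_1$, let $a$ be its Pythagorean mate, and let $\mu\in M_+(\mathbb D^-)$. Then the following assertions are equivalent: (1) The measure $\mu$ is a Carleson measure for $\mathscr H(b)$. (2) The measure $|a|^2\,d\mu$ is a Carleson measure for $H^2$.
   Context: $\mathbb D$ is the open unit disk, $\mathbb D^-$ its closure, $\mathbb T=\partial\mathbb D$, $m$ normalized Lebesgue measure on $\mathbb T$. $H^\infty_1$ is the closed unit ball of $H^\infty$ (bounded analytic functions on $\mathbb D$ with sup norm). A function $b\in H^\infty_1$ is a non-extreme point of $H^\infty_1$ iff $\int_{\mathbb T}\log(1-|b|)\,dm>-\infty$. In that case its Pythagorean mate $a$ is the unique outer function with $a(0)>0$ and $|a|^2+|b|^2=1$ $m$-a.e. on $\mathbb T$. When $b$ is rational and non-extreme, $a$ is also rational (a known fact), with no poles in $\mathbb D^-$, so $|a|^2\,d\mu$ makes sense on all of $\mathbb D^-$. For $b\in H^\infty_1$, the de Branges–Rovnyak space $\mathscr H(b)$ is the reproducing kernel Hilbert space of analytic functions on $\mathbb D$ with reproducing kernel $k^b_\lambda(z)=\frac{1-\overline{b(\lambda)}b(z)}{1-\overline\lambda z}$ ($\lambda,z\in\mathbb D$); its norm is denoted $\|\cdot\|_b$. $M_+(\mathbb D^-)$ is the set of positive finite Borel measures on $\mathbb D^-$. For $\mu\in M_+(\mathbb D^-)$, an analytic function $f$ on $\mathbb D$ is $\mu$-admissible if its non-tangential limits exist $\mu$-almost everywhere on $\mathbb T$; such an $f$ is extended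 $\mu$-a.e. to $\mathbb T$ by its non-tangential limits, and $\|f\|_\mu$ denotes its $L^2(\mu)$ norm. The measure $\mu$ is a Carleson measure for $\mathscr H(b)$ (respectively for the Hardy space $H^2$ with norm $\|\cdot\|_2$) if every function in the space is $\mu$-admissible and there is a constant $C>0$ with $\|f\|_\mu\le C\|f\|_b$ for all $f\in\mathscr H(b)$ (respectively $\|f\|_\mu\le C\|f\|_2$ for all $f\in H^2$). *)

theory Defs
  imports "HOL-Probability.Probability" "HOL-Complex_Analysis.Complex_Analysis"
begin

text \<open>Functions on the open unit disk are functions on \<^typ>\<open>complex\<close> of which only the values on
  the disk matter; boundary values on the circle are always non-tangential limits.\<close>

abbreviation unit_disk :: "complex set" (\<open>\<DD>\<close>)
  where "\<DD> \<equiv> ball 0 1"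

abbreviation unit_circle :: "complex set" (\<open>\<TT>\<close>)
  where "\<TT> \<equiv> sphere 0 1"

text \<open>Normalised Lebesgue measure, with the circle itself as underlying space, so that
  measurability of an integrand does not depend on its values off the circle.\<close>

definition circle_measure :: "complex measure"
  where "circle_measure =
    distr (uniform_measure lborel {0..<2*pi}) (restrict_space borel \<TT>) cis"

lemma prob_space_circle_measure: "prob_space circle_measure"
proof -
  have "prob_space (uniform_measure lborel {0..<2*pi})"
    by (rule prob_space_uniform_measure) auto
  moreover have "cis \<in> borel_measurable borel"
    by (intro borel_measurable_continuous_onI continuous_intros)
  then have "cis \<in> measurable (uniform_measure lborel {0..<2*pi}) (restrict_space borel \<TT>)"
    by (auto simp: measurable_restrict_space2_iff)
  ultimately show ?thesis
    unfolding circle_measure_def by (rule prob_space.prob_space_distr)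
qed


subsection \<open>Non-tangential limits\<close>

definition stolz_region :: "real \<Rightarrow> complex \<Rightarrow> complex set"
  where "stolz_region \<alpha> \<zeta> = {z \<in> \<DD>. cmod (z - \<zeta>) < \<alpha> * (1 - cmod z)}"

definition has_nt_limit :: "(complex \<Rightarrow> complex) \<Rightarrow> complex \<Rightarrow> complex \<Rightarrow> bool"
  where "has_nt_limit f \<zeta> L \<longleftrightarrow> (\<forall>\<alpha>>1. (f \<longlongrightarrow> L) (at \<zeta> within stolz_region \<alpha> \<zeta>))"

text \<open>The value 0 at points of the circle without a non-tangential limit is a dummy.\<close>

definition nt_extension :: "(complex \<Rightarrow> complex) \<Rightarrow> complex \<Rightarrow> complex"
  where "nt_extension f z =
    (if z \<in> \<DD> then f z
     else if z \<in> \<TT> \<and> (\<exists>L. has_nt_limit f z L) then (THE L. has_nt_limit f z L)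
     else 0)"

lemma has_nt_limit_unique:
  assumes "\<zeta> \<in> \<TT>" and "has_nt_limit f \<zeta> L" and "has_nt_limit f \<zeta> M"
  shows "L = M"
proof -
  have "\<exists>z\<in>stolz_region 2 \<zeta>. z \<noteq> \<zeta> \<and> dist z \<zeta> < e" if "e > 0" for e
  proof -
    define r where "r = 1 - min (1/2) (e/2)"
    have r: "0 < r" "r < 1" "1 - r < e" using that by (auto simp: r_def min_def)
    have n: "cmod \<zeta> = 1" using assms(1) by simp
    have "of_real r * \<zeta> - \<zeta> = of_real (r - 1) * \<zeta>" by (simp add: algebra_simps)
    then have d: "cmod (of_real r * \<zeta> - \<zeta>) = 1 - r"
      using r n by (simp only: norm_mult norm_of_real) simp
    have "of_real r * \<zeta> \<in> stolz_region 2 \<zeta>"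
      using d r n by (simp add: stolz_region_def norm_mult)
    moreover have "of_real r * \<zeta> \<noteq> \<zeta>" using d r by auto
    moreover have "dist (of_real r * \<zeta>) \<zeta> < e" using d r by (simp add: dist_norm)
    ultimately show ?thesis by blast
  qed
  then have "\<zeta> islimpt stolz_region 2 \<zeta>" by (auto simp: islimpt_approachable)
  then have "at \<zeta> within stolz_region 2 \<zeta> \<noteq> bot" by (simp add: trivial_limit_within)
  moreover have "(f \<longlongrightarrow> L) (at \<zeta> within stolz_region 2 \<zeta>)" "(f \<longlongrightarrow> M) (at \<zeta> within stolz_region 2 \<zeta>)"
    using assms(2,3) by (auto simp: has_nt_limit_def)
  ultimately show ?thesis by (rule tendsto_unique)
qed

lemma nt_extension_eq:
  assumes "\<zeta> \<in> \<TT>" and "has_nt_limit f \<zeta> L"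
  shows "nt_extension f \<zeta> = L"
proof -
  have "(THE L. has_nt_limit f \<zeta> L) = L"
    using assms has_nt_limit_unique by (intro the_equality) auto
  then show ?thesis
    using assms by (auto simp: nt_extension_def)
qed


subsection \<open>The unit ball of \<open>H\<^sup>\<infinity>\<close> and Pythagorean mates\<close>

definition Hinf_unit_ball :: "(complex \<Rightarrow> complex) set"
  where "Hinf_unit_ball = {f. f holomorphic_on \<DD> \<and> (\<forall>z\<in>\<DD>. cmod (f z) \<le> 1)}"

definition nonextreme :: "(complex \<Rightarrow> complex) \<Rightarrow> bool"
  where "nonextreme b \<longleftrightarrow> b \<in> Hinf_unit_ball \<and>
    (\<exists>f\<in>Hinf_unit_ball. \<exists>g\<in>Hinf_unit_ball. \<exists>t::real. 0 < t \<and> t < 1 \<and>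
       (\<forall>z\<in>\<DD>. b z = of_real (1 - t) * f z + of_real t * g z) \<and> (\<exists>z\<in>\<DD>. f z \<noteq> g z))"

definition rational_on_disk :: "(complex \<Rightarrow> complex) \<Rightarrow> bool"
  where "rational_on_disk b \<longleftrightarrow>
    (\<exists>p q :: complex poly. \<forall>z\<in>\<DD>. poly q z \<noteq> 0 \<and> b z = poly p z / poly q z)"

text \<open>The condition that the boundary values are nonzero almost everywhere is needed because
  \<^term>\<open>ln 0 = (0::real)\<close>.\<close>

definition outer_function :: "(complex \<Rightarrow> complex) \<Rightarrow> bool"
  where "outer_function f \<longleftrightarrow> f holomorphic_on \<DD> \<and>
    (AE \<zeta> in circle_measure. \<exists>L. has_nt_limit f \<zeta> L \<and> L \<noteq> 0) \<and>
    integrable circle_measure (\<lambda>\<zeta>. ln (cmod (nt_extension f \<zeta>))) \<and>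
    (\<exists>c. cmod c = 1 \<and> (\<forall>z\<in>\<DD>. f z = c * exp (\<integral>\<zeta>. (\<zeta> + z) / (\<zeta> - z) *
         of_real (ln (cmod (nt_extension f \<zeta>))) \<partial>circle_measure)))"

definition pythagorean_mate :: "(complex \<Rightarrow> complex) \<Rightarrow> (complex \<Rightarrow> complex) \<Rightarrow> bool"
  where "pythagorean_mate b a \<longleftrightarrow> outer_function a \<and> Im (a 0) = 0 \<and> Re (a 0) > 0 \<and>
    (AE \<zeta> in circle_measure. (cmod (nt_extension a \<zeta>))\<^sup>2 + (cmod (nt_extension b \<zeta>))\<^sup>2 = 1)"


subsection \<open>Reproducing kernel Hilbert spaces and de Branges--Rovnyak spaces\<close>

text \<open>A reproducing kernel Hilbert space on \<open>X\<close>: its elements are normalised to vanish off \<open>X\<close>, so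
  that equality in \<open>H\<close> is equality on \<open>X\<close>. The inner product is linear in the first argument, and
  \<open>K x\<close> is the kernel function at \<open>x\<close>.\<close>

locale rkhs =
  fixes X :: "'a set" and K :: "'a \<Rightarrow> 'a \<Rightarrow> complex"
    and H :: "('a \<Rightarrow> complex) set"
    and ip :: "('a \<Rightarrow> complex) \<Rightarrow> ('a \<Rightarrow> complex) \<Rightarrow> complex"
  assumes vanish_off: "\<And>f x. f \<in> H \<Longrightarrow> x \<notin> X \<Longrightarrow> f x = 0"
    and zero_mem: "(\<lambda>x. 0) \<in> H"
    and add_mem: "\<And>f g. f \<in> H \<Longrightarrow> g \<in> H \<Longrightarrow> (\<lambda>x. f x + g x) \<in> H"
    and scale_mem: "\<And>c f. f \<in> H \<Longrightarrow> (\<lambda>x. c * f x) \<in> H"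
    and ip_add: "\<And>f g h. f \<in> H \<Longrightarrow> g \<in> H \<Longrightarrow> h \<in> H \<Longrightarrow> ip (\<lambda>x. f x + g x) h = ip f h + ip g h"
    and ip_scale: "\<And>c f g. f \<in> H \<Longrightarrow> g \<in> H \<Longrightarrow> ip (\<lambda>x. c * f x) g = c * ip f g"
    and ip_cnj: "\<And>f g. f \<in> H \<Longrightarrow> g \<in> H \<Longrightarrow> ip g f = cnj (ip f g)"
    and ip_nonneg: "\<And>f. f \<in> H \<Longrightarrow> Re (ip f f) \<ge> 0"
    and ip_definite: "\<And>f. f \<in> H \<Longrightarrow> ip f f = 0 \<Longrightarrow> f = (\<lambda>x. 0)"
    and complete: "\<And>F :: nat \<Rightarrow> 'a \<Rightarrow> complex. (\<And>n. F n \<in> H) \<Longrightarrow>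
        (\<And>e. e > 0 \<Longrightarrow> \<exists>N. \<forall>m\<ge>N. \<forall>n\<ge>N.
            sqrt (Re (ip (\<lambda>x. F m x - F n x) (\<lambda>x. F m x - F n x))) < e) \<Longrightarrow>
        \<exists>f\<in>H. (\<lambda>n. sqrt (Re (ip (\<lambda>x. F n x - f x) (\<lambda>x. F n x - f x)))) \<longlonglongrightarrow> 0"
    and kernel_mem: "\<And>y. y \<in> X \<Longrightarrow> (\<lambda>x. if x \<in> X then K y x else 0) \<in> H"
    and reproducing: "\<And>f y. f \<in> H \<Longrightarrow> y \<in> X \<Longrightarrow> ip f (\<lambda>x. if x \<in> X then K y x else 0) = f y"

definition ip_norm :: "(('a \<Rightarrow> complex) \<Rightarrow> ('a \<Rightarrow> complex) \<Rightarrow> complex) \<Rightarrow> ('a \<Rightarrow> complex) \<Rightarrow> real"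
  where "ip_norm ip f = sqrt (Re (ip f f))"

definition dBR_kernel :: "(complex \<Rightarrow> complex) \<Rightarrow> complex \<Rightarrow> complex \<Rightarrow> complex"
  where "dBR_kernel b w z = (1 - cnj (b w) * b z) / (1 - cnj w * z)"

text \<open>\<open>H\<close> with the inner product \<open>ip\<close> is the space \<open>\<H>(b)\<close>; this determines \<open>H\<close>, and \<open>ip\<close> on
  \<open>H \<times> H\<close>, uniquely.\<close>

definition is_dBR_space :: "(complex \<Rightarrow> complex) \<Rightarrow> (complex \<Rightarrow> complex) set \<Rightarrow>
    ((complex \<Rightarrow> complex) \<Rightarrow> (complex \<Rightarrow> complex) \<Rightarrow> complex) \<Rightarrow> bool"
  where "is_dBR_space b H ip \<longleftrightarrow>
    rkhs \<DD> (dBR_kernel b) H ip \<and> (\<forall>f\<in>H. f holomorphic_on \<DD>)"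


subsection \<open>The Hardy space \<open>H\<^sup>2\<close>\<close>

definition mean2 :: "(complex \<Rightarrow> complex) \<Rightarrow> real \<Rightarrow> real"
  where "mean2 f r = (\<integral>\<zeta>. (cmod (f (of_real r * \<zeta>)))\<^sup>2 \<partial>circle_measure)"

definition Hardy2 :: "(complex \<Rightarrow> complex) set"
  where "Hardy2 = {f. f holomorphic_on \<DD> \<and> bdd_above (mean2 f ` {0..<1})}"

definition Hardy2_norm :: "(complex \<Rightarrow> complex) \<Rightarrow> real"
  where "Hardy2_norm f = sqrt (SUP r\<in>{0..<1}. mean2 f r)"


subsection \<open>Carleson measures\<close>

definition Mplus :: "complex measure set"
  where "Mplus = {\<mu>. sets \<mu> = sets (restrict_space borel (cball 0 1)) \<and> finite_measure \<mu>}"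

definition admissible :: "complex measure \<Rightarrow> (complex \<Rightarrow> complex) \<Rightarrow> bool"
  where "admissible \<mu> f \<longleftrightarrow> f holomorphic_on \<DD> \<and>
    (AE \<zeta> in \<mu>. \<zeta> \<in> \<TT> \<longrightarrow> (\<exists>L. has_nt_limit f \<zeta> L))"

definition mu_norm :: "complex measure \<Rightarrow> (complex \<Rightarrow> complex) \<Rightarrow> ennreal"
  where "mu_norm \<mu> f =
    (let I = \<integral>\<^sup>+ z. ennreal ((cmod (nt_extension f z))\<^sup>2) \<partial>\<mu>
     in if I = \<infinity> then \<infinity> else ennreal (sqrt (enn2real I)))"

definition Carleson_measure ::
    "complex measure \<Rightarrow> (complex \<Rightarrow> complex) set \<Rightarrow> ((complex \<Rightarrow> complex) \<Rightarrow> real) \<Rightarrow> bool"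
  where "Carleson_measure \<mu> H N \<longleftrightarrow>
    (\<forall>f\<in>H. admissible \<mu> f) \<and> (\<exists>C>0. \<forall>f\<in>H. mu_norm \<mu> f \<le> ennreal (C * N f))"

end

theory Submission
  imports Defs "HOL-Computational_Algebra.Fundamental_Theorem_Algebra"
begin

text \<open>Write \<open>b = p / q\<close> with \<open>q\<close> zero-free on the closed disk. By Fejer--Riesz,
  \<open>|q|\<^sup>2 - |p|\<^sup>2 = |A|\<^sup>2\<close> on the circle with \<open>A\<close> zero-free in the disk, and since \<open>A / q\<close> satisfies
  the same Poisson formula as the outer function \<open>a\<close>, the two agree up to a unimodular factor, which
  is absorbed into \<open>A\<close>. Then
  \<open>1 - b(z) cnj b(w) = a(z) cnj a(w) + (1 - z cnj w) R(z, w) / (q(z) cnj q(w))\<close>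
  with \<open>R\<close> a polynomial of bounded degree in \<open>z\<close>, because the numerator vanishes at \<open>z = 1 / cnj w\<close>.
  Hence \<open>a H\<^sup>2\<close> is contained contractively in \<open>\<H>(b)\<close>, and every \<open>f \<in> \<H>(b)\<close> is \<open>a g + s\<close> with
  \<open>g \<in> H\<^sup>2\<close> and \<open>s\<close> continuous on the closed disk, both controlled by the norm of \<open>f\<close>. The first fact
  gives (1) to (2). For (2) to (1) the term \<open>s\<close> is harmless because \<open>\<mu>\<close> is finite, and at a zero of
  \<open>a\<close> on the circle \<open>a g\<close> tends to 0 non-tangentially, whatever \<open>g\<close> does.\<close>

subsection \<open>Reproducing kernel Hilbert spaces\<close>

text \<open>H(b) is given only through its kernel, so all information about it has to be extracted
  from finite combinations of kernels. Membership is tested by duality: \<open>f\<close> lies in the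
  space with norm at most \<open>C\<close> once its pairing with each combination \<open>s\<close>
  is at most \<open>C\<close> times the norm of \<open>s\<close>. This one inequality serves both
  directions: dually it puts a H^2 into H(b), and it bounds T_a* k, the Hardy part of
  \<open>s\<close>. The rest, s - a T_a* k, lies in a fixed finite-dimensional space, where bounds
  at finitely many points suffice. The Hardy space estimates use no boundary values: Cauchy kernels
  are holomorphic across the circle, and general Hardy functions enter through their dilates. The
  obstacle to (2) implies (1) is that |a|^2 dmu does not see the zeros of \<open>a\<close> on the
  circle, where mu may carry mass.\<close>

context rkhs
begin

definition nrm :: "('a \<Rightarrow> complex) \<Rightarrow> real"
  where "nrm f = ip_norm ip f"

definition kfun :: "'a \<Rightarrow> 'a \<Rightarrow> complex"
  where "kfun y = (\<lambda>x. if x \<in> X then K y x else 0)"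

lemma diff_mem: "f \<in> H \<Longrightarrow> g \<in> H \<Longrightarrow> (\<lambda>x. f x - g x) \<in> H"
  using add_mem[of f "\<lambda>x. (-1) * g x"] scale_mem[of g "-1"] by simp

lemma ip_diff: "f \<in> H \<Longrightarrow> g \<in> H \<Longrightarrow> h \<in> H \<Longrightarrow> ip (\<lambda>x. f x - g x) h = ip f h - ip g h"
  using ip_add[of f "\<lambda>x. (-1) * g x" h] ip_scale[of g h "-1"] scale_mem[of g "-1"] by simp

lemma ip_add_right: "f \<in> H \<Longrightarrow> g \<in> H \<Longrightarrow> h \<in> H \<Longrightarrow> ip h (\<lambda>x. f x + g x) = ip h f + ip h g"
  using ip_cnj[of h "\<lambda>x. f x + g x"] ip_add[of f g h] ip_cnj[of h f] ip_cnj[of h g] add_mem[of f g]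
  by (metis complex_cnj_add complex_cnj_cnj)

lemma ip_diff_right: "f \<in> H \<Longrightarrow> g \<in> H \<Longrightarrow> h \<in> H \<Longrightarrow> ip h (\<lambda>x. f x - g x) = ip h f - ip h g"
  using ip_cnj[of h "\<lambda>x. f x - g x"] ip_diff[of f g h] ip_cnj[of h f] ip_cnj[of h g] diff_mem[of f g]
  by (metis complex_cnj_diff complex_cnj_cnj)

lemma ip_scale_right: "f \<in> H \<Longrightarrow> h \<in> H \<Longrightarrow> ip h (\<lambda>x. c * f x) = cnj c * ip h f"
  using ip_cnj[of h "\<lambda>x. c * f x"] ip_scale[of f h c] ip_cnj[of h f] scale_mem[of f c]
  by (metis complex_cnj_mult complex_cnj_cnj)

lemma ip_self: "f \<in> H \<Longrightarrow> ip f f = of_real ((nrm f)\<^sup>2)"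
  using ip_cnj[of f f] ip_nonneg[of f]
  by (auto simp: nrm_def ip_norm_def complex_eq_iff)

lemma nrm_sq: "f \<in> H \<Longrightarrow> (nrm f)\<^sup>2 = Re (ip f f)"
  by (simp add: ip_self)

lemma nrm_nonneg [simp]: "f \<in> H \<Longrightarrow> nrm f \<ge> 0"
  using ip_nonneg[of f] by (simp add: nrm_def ip_norm_def)

lemma nrm_scale: "f \<in> H \<Longrightarrow> nrm (\<lambda>x. c * f x) = cmod c * nrm f"
proof -
  assume f: "f \<in> H"
  have "ip (\<lambda>x. c * f x) (\<lambda>x. c * f x) = c * (cnj c * ip f f)"
    using f by (simp add: ip_scale ip_scale_right scale_mem)
  also have "\<dots> = of_real ((cmod c)\<^sup>2 * (nrm f)\<^sup>2)"
    by (simp add: ip_self f complex_norm_square mult.assoc[symmetric] del: of_real_power)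
  finally show ?thesis
    using f by (simp add: nrm_def[of "\<lambda>x. c * f x"] ip_norm_def real_sqrt_mult)
qed

lemma nrm_add_sq: "f \<in> H \<Longrightarrow> g \<in> H \<Longrightarrow>
   (nrm (\<lambda>x. f x + g x))\<^sup>2 = (nrm f)\<^sup>2 + 2 * Re (ip f g) + (nrm g)\<^sup>2"
  using ip_cnj[of f g] by (simp add: nrm_sq add_mem ip_add ip_add_right)

lemma nrm_diff_sq: "f \<in> H \<Longrightarrow> g \<in> H \<Longrightarrow>
   (nrm (\<lambda>x. f x - g x))\<^sup>2 = (nrm f)\<^sup>2 - 2 * Re (ip f g) + (nrm g)\<^sup>2"
  using ip_cnj[of f g] by (simp add: nrm_sq diff_mem ip_diff ip_diff_right)

lemma cauchy_schwarz:
  assumes f: "f \<in> H" and g: "g \<in> H"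
  shows "cmod (ip f g) \<le> nrm f * nrm g"
proof (cases "nrm g = 0")
  case True
  then have "g = (\<lambda>x. 0)" using ip_definite[OF g] ip_self[OF g] by simp
  then have "ip f g = 0" using ip_scale_right[OF g f, of 0] by simp
  then show ?thesis using True by simp
next
  case False
  \<comment> \<open>\<open>?t * g\<close> is the orthogonal projection of \<open>f\<close> onto the
    line through \<open>g\<close>, the choice that makes the nonnegative square smallest.\<close>
  let ?t = "ip f g / of_real ((nrm g)\<^sup>2)"
  have tg: "(\<lambda>x. ?t * g x) \<in> H" using g by (rule scale_mem)
  have "0 \<le> (nrm (\<lambda>x. f x - ?t * g x))\<^sup>2" by simp
  also have "\<dots> = (nrm f)\<^sup>2 - 2 * Re (cnj ?t * ip f g) + (cmod ?t * nrm g)\<^sup>2"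
    by (simp only: nrm_diff_sq[OF f tg] nrm_scale[OF g] ip_scale_right[OF g f])
  also have "cnj ?t * ip f g = of_real ((cmod (ip f g))\<^sup>2 / (nrm g)\<^sup>2)"
    by (simp add: complex_norm_square mult.commute flip: complex_norm_square)
  also have "(nrm f)\<^sup>2 - 2 * Re (of_real ((cmod (ip f g))\<^sup>2 / (nrm g)\<^sup>2)) + (cmod ?t * nrm g)\<^sup>2
      = (nrm f)\<^sup>2 - (cmod (ip f g))\<^sup>2 / (nrm g)\<^sup>2"
  proof -
    have "cmod ?t * nrm g = cmod (ip f g) / nrm g"
      using False nrm_nonneg[OF g] by (simp add: norm_divide norm_power power2_eq_square norm_mult)
    then show ?thesis by (simp only: Re_complex_of_real) (simp add: power_divide)
  qed
  finally have "(cmod (ip f g))\<^sup>2 \<le> (nrm f * nrm g)\<^sup>2"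
    using False by (simp add: power_mult_distrib divide_le_eq)
  then show ?thesis by (rule power2_le_imp_le) (use f g in simp)
qed

lemma nrm_diff_commute: "f \<in> H \<Longrightarrow> g \<in> H \<Longrightarrow> nrm (\<lambda>x. f x - g x) = nrm (\<lambda>x. g x - f x)"
  using nrm_scale[of "\<lambda>x. f x - g x" "-1"] diff_mem[of f g] by simp

lemma nrm_triangle:
  assumes f: "f \<in> H" and g: "g \<in> H"
  shows "nrm (\<lambda>x. f x + g x) \<le> nrm f + nrm g"
proof (rule power2_le_imp_le)
  have "Re (ip f g) \<le> nrm f * nrm g"
    using cauchy_schwarz[OF f g] complex_Re_le_cmod order_trans by blast
  then show "(nrm (\<lambda>x. f x + g x))\<^sup>2 \<le> (nrm f + nrm g)\<^sup>2"
    using nrm_add_sq[OF f g] by (simp add: power2_sum)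
qed (use f g in simp)

lemma abs_nrm_diff:
  assumes f: "f \<in> H" and g: "g \<in> H"
  shows "\<bar>nrm f - nrm g\<bar> \<le> nrm (\<lambda>x. f x - g x)"
  using nrm_triangle[OF diff_mem[OF f g] g] nrm_triangle[OF diff_mem[OF g f] f]
    nrm_diff_commute[OF f g] by auto

lemma kfun_mem [simp]: "y \<in> X \<Longrightarrow> kfun y \<in> H"
  unfolding kfun_def by (rule kernel_mem)

lemma ip_kfun: "f \<in> H \<Longrightarrow> y \<in> X \<Longrightarrow> ip f (kfun y) = f y"
  unfolding kfun_def by (rule reproducing)

lemma point_bound: "f \<in> H \<Longrightarrow> y \<in> X \<Longrightarrow> cmod (f y) \<le> nrm (kfun y) * nrm f"
  using cauchy_schwarz[of f "kfun y"] ip_kfun[of f y] by (simp add: mult.commute)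

section \<open>Finite combinations of kernels and the duality test for membership\<close>

definition comb :: "(complex \<times> 'a) list \<Rightarrow> 'a \<Rightarrow> complex"
  where "comb l = (\<lambda>x. \<Sum>(c, w)\<leftarrow>l. c * kfun w x)"

text \<open>This is the inner product of \<open>comb l\<close> with \<open>f\<close>, written so
  that it makes sense before \<open>f\<close> is known to lie in \<open>H\<close>. Working with
  lists instead of functions avoids asking whether it depends only on \<open>comb l\<close>.\<close>

definition pairing :: "('a \<Rightarrow> complex) \<Rightarrow> (complex \<times> 'a) list \<Rightarrow> complex"
  where "pairing f l = (\<Sum>(c, w)\<leftarrow>l. c * cnj (f w))"

lemma comb_Nil: "comb [] = (\<lambda>x. 0)"
  and comb_Cons: "comb ((c, w) # l) = (\<lambda>x. c * kfun w x + comb l x)"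
  and comb_append: "comb (l @ l') = (\<lambda>x. comb l x + comb l' x)"
  by (auto simp: comb_def)

lemma comb_mem: "snd ` set l \<subseteq> X \<Longrightarrow> comb l \<in> H"
proof (induction l)
  case Nil
  then show ?case by (simp add: comb_Nil zero_mem)
next
  case (Cons p l)
  then show ?case by (cases p) (auto simp: comb_Cons intro!: add_mem scale_mem)
qed

lemma pairing_append: "pairing f (l @ l') = pairing f l + pairing f l'"
  by (simp add: pairing_def)

definition lscale :: "complex \<Rightarrow> (complex \<times> 'a) list \<Rightarrow> (complex \<times> 'a) list"
  where "lscale t l = map (\<lambda>(c, w). (t * c, w)) l"

lemma comb_lscale: "comb (lscale t l) = (\<lambda>x. t * comb l x)"
  by (induction l) (auto simp: comb_def lscale_def fun_eq_iff algebra_simps)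

lemma pairing_lscale: "pairing f (lscale t l) = t * pairing f l"
  by (induction l) (auto simp: pairing_def lscale_def algebra_simps)

lemma snd_lscale [simp]: "snd ` set (lscale t l) = snd ` set l"
  by (auto simp: lscale_def image_iff) force+

lemma ip_comb: "f \<in> H \<Longrightarrow> snd ` set l \<subseteq> X \<Longrightarrow> ip (comb l) f = pairing f l"
proof (induction l)
  case Nil
  then show ?case using ip_scale[OF zero_mem, of f 0] by (simp add: comb_Nil pairing_def)
next
  case (Cons p l)
  obtain c w where p: "p = (c, w)" by force
  have w: "w \<in> X" and l: "snd ` set l \<subseteq> X" using Cons.prems p by auto
  have "ip (kfun w) f = cnj (f w)"
    using ip_cnj[OF Cons.prems(1) kfun_mem[OF w]] ip_kfun[OF Cons.prems(1) w] by simp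
  then show ?case
    using Cons.IH[OF Cons.prems(1) l] Cons.prems(1) w l
    by (simp add: p comb_Cons ip_add scale_mem comb_mem ip_scale) (simp add: pairing_def)
qed

text \<open>The representing element is found by minimising \<open>\<parallel>s\<parallel>\<^sup>2 - 2 Re (pairing f s)\<close> over the span of
  the kernels.\<close>

lemma mem_of_pairing_bound:
  assumes off: "\<And>x. x \<notin> X \<Longrightarrow> f x = 0"
    and bound: "\<And>l. snd ` set l \<subseteq> X \<Longrightarrow> cmod (pairing f l) \<le> C * nrm (comb l)"
    and C: "C \<ge> 0"
  obtains L where "f \<in> H" "nrm f \<le> C" "\<And>n. snd ` set (L n) \<subseteq> X"
    "(\<lambda>n. nrm (\<lambda>x. comb (L n) x - f x)) \<longlonglongrightarrow> 0"
proof -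
  define S where "S = {l :: (complex \<times> 'a) list. snd ` set l \<subseteq> X}"
  \<comment> \<open>If \<open>f\<close> were known to lie in \<open>H\<close>, this would be ||comb
    l - f||^2 - ||f||^2, so a minimising sequence ought to converge to \<open>f\<close>.\<close>
  define J where "J l = (nrm (comb l))\<^sup>2 - 2 * Re (pairing f l)" for l
  have cm: "comb l \<in> H" if "l \<in> S" for l using that by (auto simp: S_def intro: comb_mem)
  have J_lower: "J l \<ge> - C\<^sup>2" if "l \<in> S" for l
  proof -
    have "Re (pairing f l) \<le> C * nrm (comb l)"
      using bound[of l] that complex_Re_le_cmod order_trans unfolding S_def by blast
    moreover have "0 \<le> (nrm (comb l) - C)\<^sup>2" by simp
    ultimately show ?thesis by (simp add: J_def power2_diff algebra_simps)
  qed
  define d where "d = Inf (J ` S)"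
  have bdd: "bdd_below (J ` S)" using J_lower by (auto intro!: bdd_belowI2)
  have ne: "J ` S \<noteq> {}" by (auto simp: S_def intro!: exI[of _ "[]"])
  have d_le: "d \<le> J l" if "l \<in> S" for l unfolding d_def by (rule cInf_lower) (use that bdd in auto)
  have "\<exists>l. l \<in> S \<and> J l < d + 1 / (n + 1)" for n :: nat
  proof -
    have "Inf (J ` S) < d + 1 / (n + 1)" by (simp add: d_def)
    then show ?thesis using cInf_less_iff[OF ne bdd] by auto
  qed
  then obtain L where LS: "\<And>n. L n \<in> S" and LJ: "\<And>n. J (L n) < d + 1 / (real n + 1)"
    by (metis of_nat_1 of_nat_add)
  define F where "F n = comb (L n)" for n
  have FH: "F n \<in> H" for n using cm LS by (simp add: F_def)
  \<comment> \<open>Parallelogram law: the midpoint of two combinations is again a combination, so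
    its \<open>J\<close> is at least \<open>d\<close>, and near-minimisers are close to each
    other.\<close>
  have par: "(nrm (\<lambda>x. F m x - F n x))\<^sup>2 \<le> 2 * J (L m) + 2 * J (L n) - 4 * d" for m n
  proof -
    let ?l = "lscale (1/2) (L m @ L n)"
    have lS: "?l \<in> S" using LS[of m] LS[of n] by (auto simp: S_def)
    have "nrm (comb ?l) = nrm (\<lambda>x. F m x + F n x) / 2"
      using nrm_scale[OF add_mem[OF FH FH], of "1/2" m n]
      by (simp add: comb_lscale comb_append F_def)
    then have "4 * (nrm (comb ?l))\<^sup>2 = (nrm (\<lambda>x. F m x + F n x))\<^sup>2" by (simp only: power_divide) simp
    then have "4 * J ?l = (nrm (F m))\<^sup>2 + 2 * Re (ip (F m) (F n)) + (nrm (F n))\<^sup>2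
        - 4 * (Re (pairing f (L m)) + Re (pairing f (L n)))"
      using nrm_add_sq[OF FH FH, of m n]
      unfolding J_def pairing_lscale pairing_append by (simp add: field_simps)
    then show ?thesis
      using d_le[OF lS] nrm_diff_sq[OF FH FH, of m n] by (simp add: J_def F_def)
  qed
  have cauchy: "\<exists>N. \<forall>m\<ge>N. \<forall>n\<ge>N. nrm (\<lambda>x. F m x - F n x) < e" if e: "e > 0" for e
  proof -
    obtain N :: nat where N: "4 / e\<^sup>2 < real N" using reals_Archimedean2 by blast
    have "nrm (\<lambda>x. F m x - F n x) < e" if mn: "m \<ge> N" "n \<ge> N" for m n
    proof (rule power2_less_imp_less)
      have Npos: "0 < real N" using N e by (smt (verit) divide_pos_pos zero_less_power)
      have "1 / (real m + 1) < 1 / real N" "1 / (real n + 1) < 1 / real N"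
        using mn Npos by (auto intro!: divide_strict_left_mono mult_pos_pos)
      then have "(nrm (\<lambda>x. F m x - F n x))\<^sup>2 < 4 / real N"
        using par[of m n] LJ[of m] LJ[of n] by linarith
      also have "4 / real N < e\<^sup>2" using N Npos e by (simp add: field_simps)
      finally show "(nrm (\<lambda>x. F m x - F n x))\<^sup>2 < e\<^sup>2" .
    qed (use e in simp)
    then show ?thesis by blast
  qed
  obtain h where hH: "h \<in> H" and lim: "(\<lambda>n. nrm (\<lambda>x. F n x - h x)) \<longlonglongrightarrow> 0"
    using complete[of F] FH cauchy unfolding nrm_def ip_norm_def by blast
  have ip_lim: "(\<lambda>n. ip g (F n)) \<longlonglongrightarrow> ip g h" if g: "g \<in> H" for g
  proof -
    have "(\<lambda>n. ip g (F n) - ip g h) \<longlonglongrightarrow> 0"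
    proof (rule Lim_null_comparison)
      show "\<forall>\<^sub>F n in sequentially. norm (ip g (F n) - ip g h) \<le> nrm g * nrm (\<lambda>x. F n x - h x)"
        using cauchy_schwarz[OF g diff_mem[OF FH hH]] ip_diff_right[OF FH hH g] by (intro always_eventually) simp
      show "(\<lambda>n. nrm g * nrm (\<lambda>x. F n x - h x)) \<longlonglongrightarrow> 0"
        using tendsto_mult_left[OF lim, of "nrm g"] by simp
    qed
    then show ?thesis by (simp add: LIM_zero_iff)
  qed
  \<comment> \<open>First-order condition: adding \<open>t * kfun w\<close> to a near-minimiser
    cannot push \<open>J\<close> below \<open>d\<close>, and the slack \<open>1 / (n + 1)\<close>
    disappears in the limit.\<close>
  have var: "Re (t * (ip (kfun w) h - cnj (f w))) * 2 + (cmod t)\<^sup>2 * (nrm (kfun w))\<^sup>2 \<ge> 0"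
    if w: "w \<in> X" for t w
  proof -
    have k: "kfun w \<in> H" and tk: "(\<lambda>x. t * kfun w x) \<in> H" using w by (auto intro: scale_mem)
    have "0 \<le> 1 / (real n + 1) +
        (Re (t * (ip (kfun w) (F n) - cnj (f w))) * 2 + (cmod t)\<^sup>2 * (nrm (kfun w))\<^sup>2)" for n
    proof -
      let ?l = "(t, w) # L n"
      have lS: "?l \<in> S" using LS[of n] w by (auto simp: S_def)
      have "(nrm (comb ?l))\<^sup>2 =
          (cmod t * nrm (kfun w))\<^sup>2 + 2 * Re (t * ip (kfun w) (F n)) + (nrm (F n))\<^sup>2"
        using nrm_add_sq[OF tk FH, of n]
        by (simp add: comb_Cons F_def[symmetric] nrm_scale[OF k] ip_scale[OF k FH])
      then have "J ?l = J (L n) + Re (t * (ip (kfun w) (F n) - cnj (f w))) * 2 + (cmod t)\<^sup>2 * (nrm (kfun w))\<^sup>2"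
        by (simp add: J_def F_def pairing_def right_diff_distrib power_mult_distrib del: times_complex.sel) 
      then show ?thesis using d_le[OF lS] LJ[of n] by linarith
    qed
    moreover have "(\<lambda>n. 1 / (real n + 1) +
        (Re (t * (ip (kfun w) (F n) - cnj (f w))) * 2 + (cmod t)\<^sup>2 * (nrm (kfun w))\<^sup>2))
       \<longlonglongrightarrow> 0 + (Re (t * (ip (kfun w) h - cnj (f w))) * 2 + (cmod t)\<^sup>2 * (nrm (kfun w))\<^sup>2)"
      by (intro tendsto_intros ip_lim k) (use LIMSEQ_inverse_real_of_nat in \<open>simp add: inverse_eq_divide add.commute\<close>)
    ultimately have "0 \<le> 0 + (Re (t * (ip (kfun w) h - cnj (f w))) * 2 + (cmod t)\<^sup>2 * (nrm (kfun w))\<^sup>2)"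
      by (intro tendsto_lowerbound) auto
    then show ?thesis by simp
  qed
  have hf: "h = f"
  proof
    fix w show "h w = f w"
    proof (cases "w \<in> X")
      case True
      define z where "z = ip (kfun w) h - cnj (f w)"
      \<comment> \<open>For this \<open>t\<close> the linear term is a negative multiple of |z|^2;
        for small positive \<open>s\<close> it outweighs the quadratic term unless
        \<open>z = 0\<close>.\<close>
      have quad: "0 \<le> - 2 * s * (cmod z)\<^sup>2 + s\<^sup>2 * (cmod z)\<^sup>2 * (nrm (kfun w))\<^sup>2" for s
      proof -
        have "- of_real s * cnj z * z = of_real (- s * (cmod z)\<^sup>2)"
          by (simp only: of_real_mult complex_norm_square of_real_minus) (simp add: mult_ac)
        then have "Re (- of_real s * cnj z * z) = - s * (cmod z)\<^sup>2"
          by (simp only: Re_complex_of_real)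
        then show ?thesis
          using var[OF True, of "- of_real s * cnj z"]
          by (simp add: z_def[symmetric] norm_mult power_mult_distrib del: times_complex.sel)
      qed
      have "z = 0"
      proof (rule ccontr)
        assume z: "z \<noteq> 0"
        define s where "s = 1 / (1 + (nrm (kfun w))\<^sup>2)"
        have p: "0 < 1 + (nrm (kfun w))\<^sup>2" by (smt (verit) zero_le_power2)
        have s: "s > 0" "s * (nrm (kfun w))\<^sup>2 \<le> 1" using p by (auto simp: s_def field_simps)
        have "s * (cmod z)\<^sup>2 * (s * (nrm (kfun w))\<^sup>2) \<le> s * (cmod z)\<^sup>2 * 1"
          using s by (intro mult_left_mono) auto
        moreover have "s * (cmod z)\<^sup>2 > 0" using s z by simp
        ultimately show False using quad[of s] by (simp add: power2_eq_square mult_ac)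
      qed
      moreover have "ip (kfun w) h = cnj (h w)"
        using ip_cnj[OF hH kfun_mem[OF True]] ip_kfun[OF hH True] by simp
      ultimately show ?thesis by (simp add: z_def)
    qed (use off vanish_off[OF hH] in simp)
  qed
  have fH: "f \<in> H" using hH hf by simp
  have nlim: "(\<lambda>n. nrm (F n)) \<longlonglongrightarrow> nrm f"
  proof -
    have "(\<lambda>n. nrm (F n) - nrm f) \<longlonglongrightarrow> 0"
      by (rule Lim_null_comparison[OF _ lim])
        (use abs_nrm_diff[OF FH hH] hf in \<open>auto intro!: always_eventually\<close>)
    then show ?thesis by (simp add: LIM_zero_iff)
  qed
  \<comment> \<open>The assumed bound concerns combinations only; in the limit it can be applied to
    \<open>f\<close> paired with itself, which gives the norm bound.\<close>
  have "cmod (ip f (F n)) \<le> C * nrm (F n)" for n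
    using bound[of "L n"] LS[of n] ip_comb[OF fH, of "L n"] ip_cnj[OF FH fH, of n]
    by (simp add: F_def S_def)
  then have "cmod (ip f f) \<le> C * nrm f"
    by (intro tendsto_le[OF sequentially_bot tendsto_mult_left[OF nlim] tendsto_norm[OF ip_lim[OF fH, unfolded hf]]])
      (auto intro!: always_eventually)
  then have "nrm f * nrm f \<le> C * nrm f" by (simp add: ip_self[OF fH] norm_power norm_mult power2_eq_square fH)
  then have "nrm f \<le> C" using C fH nrm_nonneg[OF fH] by (cases "nrm f = 0") auto
  then show thesis
    using that[of L] fH LS lim by (auto simp: S_def F_def hf)
qed

end

subsection \<open>Integration over the circle\<close>

lemma space_circle_measure [simp]: "space circle_measure = \<TT>"
  and sets_circle_measure: "sets circle_measure = sets (restrict_space borel \<TT>)"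
  by (simp_all add: circle_measure_def space_restrict_space)

interpretation circle: prob_space circle_measure
  by (rule prob_space_circle_measure)

lemma borel_measurable_circle_continuous:
  fixes f :: "complex \<Rightarrow> 'b::{second_countable_topology, t2_space}"
  shows "continuous_on \<TT> f \<Longrightarrow> f \<in> borel_measurable circle_measure"
  using borel_measurable_continuous_on_restrict[of \<TT> f]
  by (simp add: measurable_cong_sets[OF sets_circle_measure refl])

lemma integrable_circle_continuous:
  fixes f :: "complex \<Rightarrow> 'b::{banach, second_countable_topology}"
  assumes "continuous_on \<TT> f"
  shows "integrable circle_measure f"
proof -
  have "compact (f ` \<TT>)" using assms by (intro compact_continuous_image) auto
  then obtain B where "\<And>z. z \<in> \<TT> \<Longrightarrow> norm (f z) \<le> B"
    using compact_imp_bounded[of "f ` \<TT>"] by (force simp: bounded_iff)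
  then show ?thesis
    using borel_measurable_circle_continuous[OF assms]
    by (intro circle.integrable_const_bound[where B=B] AE_I2) auto
qed

text \<open>The bridge from the measure on the circle to the parametrised integrals of contour
  integration; \<open>2 * pi\<close> undoes the normalisation.\<close>

lemma circle_integral_eq:
  fixes f :: "complex \<Rightarrow> complex"
  assumes "continuous_on \<TT> f"
  shows "((\<lambda>t. f (cis t)) has_integral (2 * pi * (\<integral>\<zeta>. f \<zeta> \<partial>circle_measure))) {0..2*pi}"
proof -
  have cont: "continuous_on S (\<lambda>t. f (cis t))" for S
    by (rule continuous_on_compose2[OF assms]) (auto intro!: continuous_intros)
  have cm: "cis \<in> measurable (uniform_measure lborel {0..<2*pi}) (restrict_space borel \<TT>)"
    using borel_measurable_continuous_onI[of cis] by (auto simp: measurable_restrict_space2_iff continuous_intros)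
  have m: "(\<lambda>t. f (cis t)) \<in> borel_measurable lborel"
    using borel_measurable_continuous_onI[OF cont] by simp
  have "(\<integral>\<zeta>. f \<zeta> \<partial>circle_measure) = (\<integral>t. f (cis t) \<partial>uniform_measure lborel {0..<2*pi})"
    unfolding circle_measure_def
    by (rule integral_distr[OF cm borel_measurable_continuous_on_restrict[OF assms]])
  also have "uniform_measure lborel {0..<2*pi} =
      density lborel (\<lambda>t. ennreal (indicator {0..<2*pi} t / (2 * pi)))"
    unfolding uniform_measure_def
    by (intro density_cong) (auto simp: indicator_def divide_ennreal_def inverse_ennreal field_simps)
  also have "(\<integral>t. f (cis t) \<partial>\<dots>) = (\<integral>t. (indicator {0..<2*pi} t / (2 * pi)) *\<^sub>R f (cis t) \<partial>lborel)"
    by (rule integral_density) (use m in auto)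
  also have "(\<integral>t. (indicator {0..<2*pi} t / (2 * pi)) *\<^sub>R f (cis t) \<partial>lborel) = (\<integral>t. (1 / (2*pi)) *\<^sub>R (indicator {0..2*pi} t *\<^sub>R f (cis t)) \<partial>lborel)"
  proof (rule integral_cong_AE)
    show "AE t in lborel. (indicator {0..<2*pi} t / (2 * pi)) *\<^sub>R f (cis t) = (1 / (2*pi)) *\<^sub>R (indicator {0..2*pi} t *\<^sub>R f (cis t))"
      using AE_lborel_singleton[of "2*pi"] by eventually_elim (auto simp: indicator_def)
  qed (use m in auto)
  also have "\<dots> = (1 / (2*pi)) *\<^sub>R (LINT t:{0..2*pi}|lborel. f (cis t))"
    unfolding set_lebesgue_integral_def by (subst integral_scaleR_right) simp
  finally have e: "(\<integral>\<zeta>. f \<zeta> \<partial>circle_measure) = (1 / (2*pi)) *\<^sub>R (LINT t:{0..2*pi}|lborel. f (cis t))" .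
  have si: "set_integrable lborel {0..2*pi} (\<lambda>t. f (cis t))"
    by (rule borel_integrable_atLeastAtMost') (rule cont)
  have "((\<lambda>t. f (cis t)) has_integral (LINT t:{0..2*pi}|lborel. f (cis t))) {0..2*pi}"
    using set_borel_integral_eq_integral[OF si] by (simp add: has_integral_integral)
  then show ?thesis unfolding e by (simp add: scaleR_conv_of_real)
qed

text \<open>On the circle \<open>\<zeta> - w = \<zeta> * (1 - w * cnj \<zeta>)\<close>, so Cauchy's
  formula becomes the reproducing property of the Cauchy kernel. Holomorphy on a larger disk makes
  \<open>u\<close> its own boundary function.\<close>

lemma circle_cauchy:
  assumes hol: "u holomorphic_on ball 0 R" and R: "R > 1" and w: "w \<in> \<DD>"
  shows "(\<integral>\<zeta>. u \<zeta> / (1 - w * cnj \<zeta>) \<partial>circle_measure) = u w"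
proof -
  have sub: "cball 0 1 \<subseteq> ball (0::complex) R" using R by auto
  have cu: "continuous_on (cball 0 1) u"
    using holomorphic_on_imp_continuous_on[OF holomorphic_on_subset[OF hol sub]] .
  have nz: "1 - w * cnj \<zeta> \<noteq> 0" if "\<zeta> \<in> \<TT>" for \<zeta>
  proof
    assume "1 - w * cnj \<zeta> = 0"
    then have "cmod (w * cnj \<zeta>) = 1" by (metis eq_iff_diff_eq_0 norm_one)
    then show False using w that by (simp add: norm_mult)
  qed
  have cont: "continuous_on \<TT> (\<lambda>\<zeta>. u \<zeta> / (1 - w * cnj \<zeta>))"
    by (intro continuous_intros continuous_on_subset[OF cu]) (use nz in auto)
  have "((\<lambda>\<zeta>. u \<zeta> / (\<zeta> - w)) has_contour_integral (2 * of_real pi * \<i> * u w)) (circlepath 0 1)"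
    by (rule Cauchy_integral_circlepath_simple[OF holomorphic_on_subset[OF hol sub]]) (use w in auto)
  then have "((\<lambda>t. u (cis t) / (cis t - w) * \<i> * cis t) has_integral (2 * of_real pi * \<i> * u w)) {0..2*pi}"
    unfolding circlepath_def by (subst (asm) has_contour_integral_part_circlepath_iff) auto
  moreover have "u (cis t) / (cis t - w) * \<i> * cis t = \<i> * (u (cis t) / (1 - w * cnj (cis t)))" for t
  proof -
    have "cis t * (1 - w * cnj (cis t)) = cis t - w"
      by (simp add: algebra_simps cis_cnj flip: cis_mult) (simp add: cis_mult)
    moreover have "1 - w * cnj (cis t) \<noteq> 0" using nz[of "cis t"] by simp
    moreover have "cis t - w \<noteq> 0" using calculation by (metis cis_neq_zero mult_eq_0_iff)
    ultimately have "cis t / (cis t - w) = 1 / (1 - w * cnj (cis t))" by (simp add: frac_eq_eq)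
    then show ?thesis by (metis mult.assoc mult.commute times_divide_eq_left mult_1)
  qed
  ultimately have "((\<lambda>t. \<i> * (u (cis t) / (1 - w * cnj (cis t)))) has_integral (2 * of_real pi * \<i> * u w)) {0..2*pi}"
    by simp
  moreover have "((\<lambda>t. \<i> * (u (cis t) / (1 - w * cnj (cis t)))) has_integral
       \<i> * (2 * pi * (\<integral>\<zeta>. u \<zeta> / (1 - w * cnj \<zeta>) \<partial>circle_measure))) {0..2*pi}"
    by (intro has_integral_mult_right circle_integral_eq[OF cont])
  ultimately have "\<i> * (2 * pi * (\<integral>\<zeta>. u \<zeta> / (1 - w * cnj \<zeta>) \<partial>circle_measure)) = 2 * of_real pi * \<i> * u w"
    by (rule has_integral_unique[rotated])
  then show ?thesis by simp
qed

lemma circle_mean_value: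
  assumes hol: "u holomorphic_on ball 0 R" and R: "R > 1"
  shows "(\<integral>\<zeta>. u \<zeta> \<partial>circle_measure) = u 0"
  using circle_cauchy[OF hol R, of 0] by simp

lemma radial_sequence:
  obtains r :: "nat \<Rightarrow> real"
  where "\<And>n. 0 < r n" "\<And>n. r n < 1"
    "\<And>n z. z \<in> cball 0 1 \<Longrightarrow> of_real (r n) * z \<in> \<DD>"
    "\<And>z :: complex. (\<lambda>n. of_real (r n) * z) \<longlonglongrightarrow> z"
proof -
  \<comment> \<open>The shift by two keeps \<open>r 0\<close> positive, so that
    \<open>1 / r n\<close> can serve as the radius on which a dilate is holomorphic.\<close>
  define r where "r n = 1 - 1 / real (Suc (Suc n))" for n
  have r: "0 < r n" "r n < 1" for n by (auto simp: r_def field_simps)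
  have "(\<lambda>n. 1 / real (Suc (Suc n))) \<longlonglongrightarrow> 0"
    using LIMSEQ_Suc[OF LIMSEQ_inverse_real_of_nat] by (simp add: inverse_eq_divide)
  from tendsto_diff[OF tendsto_const[of 1] this] have rlim: "r \<longlonglongrightarrow> 1" by (simp add: r_def[abs_def])
  have "of_real (r n) * z \<in> \<DD>" if "z \<in> cball 0 1" for n z
  proof -
    have "r n * cmod z \<le> r n * 1" using that r[of n] by (intro mult_left_mono) auto
    then have "r n * cmod z < 1" using r[of n] by linarith
    then show ?thesis using r[of n] by (simp add: norm_mult)
  qed
  moreover have "(\<lambda>n. of_real (r n) * z) \<longlonglongrightarrow> z" for z :: complex
  proof -
    have "(\<lambda>n. of_real (r n) * z) \<longlonglongrightarrow> of_real 1 * z" by (intro tendsto_intros rlim)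
    then show ?thesis by simp
  qed
  ultimately show thesis using that r by blast
qed

section \<open>The Poisson kernel as the real part of the kernel in
  \<open>outer_function\<close>\<close>

definition poisson :: "complex \<Rightarrow> complex \<Rightarrow> real"
  where "poisson z \<zeta> = Re ((\<zeta> + z) / (\<zeta> - z))"

lemma circle_minus_nonzero: "z \<in> \<DD> \<Longrightarrow> \<zeta> \<in> \<TT> \<Longrightarrow> \<zeta> - z \<noteq> 0"
  by auto

text \<open>Against a holomorphic function the first summand reproduces the value at
  \<open>z\<close>, while the second is analytic in \<open>\<zeta>\<close> and vanishes at 0, so it
  contributes nothing by the mean value property.\<close>

lemma poisson_eq:
  assumes z: "z \<in> \<DD>" and \<zeta>: "\<zeta> \<in> \<TT>"
  shows "complex_of_real (poisson z \<zeta>) = 1 / (1 - z * cnj \<zeta>) + cnj z * \<zeta> / (1 - cnj z * \<zeta>)"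
proof -
  have n: "\<zeta> * cnj \<zeta> = 1" using \<zeta> by (simp add: complex_norm_square[symmetric])
  have "\<zeta> * (1 - z * cnj \<zeta>) = \<zeta> - z" using n by (simp add: algebra_simps)
  have nz: "\<zeta> - z \<noteq> 0" "\<zeta> \<noteq> 0" using z \<zeta> by auto
  have nz2: "1 - z * cnj \<zeta> \<noteq> 0" using \<open>\<zeta> * (1 - z * cnj \<zeta>) = \<zeta> - z\<close> nz by force
  then have nz3: "1 - cnj z * \<zeta> \<noteq> 0" by (metis complex_cnj_cnj complex_cnj_diff complex_cnj_mult complex_cnj_one complex_cnj_zero)
  have "(\<zeta> + z) / (\<zeta> - z) = (1 + z * cnj \<zeta>) / (1 - z * cnj \<zeta>)"
  proof -
    have "\<zeta> * (1 + z * cnj \<zeta>) = \<zeta> + z" using n by (simp add: algebra_simps)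
    then show ?thesis using \<open>\<zeta> * (1 - z * cnj \<zeta>) = \<zeta> - z\<close> nz by (metis mult_divide_mult_cancel_left)
  qed
  then have "complex_of_real (2 * poisson z \<zeta>) =
      (1 + z * cnj \<zeta>) / (1 - z * cnj \<zeta>) + (1 + cnj z * \<zeta>) / (1 - cnj z * \<zeta>)"
    unfolding poisson_def
    using complex_add_cnj[of "(1 + z * cnj \<zeta>) / (1 - z * cnj \<zeta>)"] by simp
  also have "\<dots> = 2 * (1 / (1 - z * cnj \<zeta>) + cnj z * \<zeta> / (1 - cnj z * \<zeta>))"
    using nz2 nz3 by (simp add: field_simps)
  finally have "2 * complex_of_real (poisson z \<zeta>) = 2 * (1 / (1 - z * cnj \<zeta>) + cnj z * \<zeta> / (1 - cnj z * \<zeta>))"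
    by simp
  then show ?thesis by (metis mult_left_cancel zero_neq_numeral)
qed

lemma continuous_on_poisson: "z \<in> \<DD> \<Longrightarrow> continuous_on \<TT> (poisson z)"
  unfolding poisson_def using circle_minus_nonzero by (intro continuous_intros) auto

lemma circle_poisson:
  assumes hol: "F holomorphic_on ball 0 R" and R: "R > 1" and z: "z \<in> \<DD>"
  shows "(\<integral>\<zeta>. poisson z \<zeta> * Re (F \<zeta>) \<partial>circle_measure) = Re (F z)"
proof (cases "z = 0")
  case True
  have "continuous_on \<TT> F"
    using holomorphic_on_imp_continuous_on[OF hol] by (rule continuous_on_subset) (use R in auto)
  then have i: "integrable circle_measure F" by (rule integrable_circle_continuous)
  have "(\<integral>\<zeta>. poisson z \<zeta> * Re (F \<zeta>) \<partial>circle_measure) = (\<integral>\<zeta>. Re (F \<zeta>) \<partial>circle_measure)"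
    using True by (intro Bochner_Integration.integral_cong) (auto simp: poisson_def)
  then show ?thesis using circle_mean_value[OF hol R] integral_Re[OF i] True by simp
next
  case False
  \<comment> \<open>The second summand of the kernel brings in a pole at \<open>1 / cnj z\<close>,
    outside the closed disk; the case \<open>z = 0\<close> is separate because that radius is then
    meaningless.\<close>
  define S where "S = min R (1 / cmod z)"
  have S: "S > 1" using R z False by (auto simp: S_def)
  define G where "G \<zeta> = F \<zeta> * (cnj z * \<zeta> / (1 - cnj z * \<zeta>))" for \<zeta>
  have nz: "1 - cnj z * \<zeta> \<noteq> 0" if "\<zeta> \<in> ball 0 S" for \<zeta>
  proof
    assume "1 - cnj z * \<zeta> = 0"
    then have "cmod (cnj z * \<zeta>) = 1" by (metis eq_iff_diff_eq_0 norm_one)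
    then show False using that False by (simp add: norm_mult S_def field_simps)
  qed
  have holS: "F holomorphic_on ball 0 S"
    using hol by (rule holomorphic_on_subset) (auto simp: S_def)
  have holG: "G holomorphic_on ball 0 S"
    unfolding G_def by (intro holomorphic_intros holS) (use nz in auto)
  have cF: "continuous_on \<TT> F"
    using holomorphic_on_imp_continuous_on[OF hol] by (rule continuous_on_subset) (use R in auto)
  have cG: "continuous_on \<TT> G"
    using holomorphic_on_imp_continuous_on[OF holG] by (rule continuous_on_subset) (use S in auto)
  have nz': "1 - z * cnj \<zeta> \<noteq> 0" if "\<zeta> \<in> \<TT>" for \<zeta>
    using nz[of \<zeta>] that S by (metis complex_cnj_cnj complex_cnj_diff complex_cnj_mult complex_cnj_one complex_cnj_zero dist_0_norm mem_ball mem_sphere)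
  have c1: "continuous_on \<TT> (\<lambda>\<zeta>. F \<zeta> / (1 - z * cnj \<zeta>))"
    by (intro continuous_intros cF) (use nz' in auto)
  have "(\<integral>\<zeta>. of_real (poisson z \<zeta>) * F \<zeta> \<partial>circle_measure) =
      (\<integral>\<zeta>. F \<zeta> / (1 - z * cnj \<zeta>) + G \<zeta> \<partial>circle_measure)"
  proof (rule Bochner_Integration.integral_cong[OF refl])
    fix \<zeta> assume "\<zeta> \<in> space circle_measure"
    then show "of_real (poisson z \<zeta>) * F \<zeta> = F \<zeta> / (1 - z * cnj \<zeta>) + G \<zeta>"
      by (subst poisson_eq[OF z]) (auto simp: G_def algebra_simps)
  qed
  also have "\<dots> = F z + G 0"
    using circle_cauchy[OF hol R z] circle_mean_value[OF holG S]
    by (subst Bochner_Integration.integral_add)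
      (auto intro!: integrable_circle_continuous c1 cG)
  also have "\<dots> = F z" by (simp add: G_def)
  finally have e: "(\<integral>\<zeta>. of_real (poisson z \<zeta>) * F \<zeta> \<partial>circle_measure) = F z" .
  have "integrable circle_measure (\<lambda>\<zeta>. of_real (poisson z \<zeta>) * F \<zeta>)"
    by (intro integrable_circle_continuous continuous_intros continuous_on_poisson z cF)
  from integral_Re[OF this] show ?thesis using e by simp
qed

subsection \<open>Polynomials on the circle\<close>

lemma infinite_unit_circle: "infinite \<TT>"
proof
  assume fin: "finite \<TT>"
  have "(\<lambda>x. Complex x (sqrt (1 - x\<^sup>2))) ` {0..1} \<subseteq> \<TT>"
    by (auto simp: complex_norm abs_square_le_1)
  moreover have "inj_on (\<lambda>x. Complex x (sqrt (1 - x\<^sup>2))) {0..1}" by (rule inj_onI) simp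
  ultimately have "finite {0..1::real}" using fin finite_imageD finite_subset by blast
  then show False using infinite_Icc[of 0 "1::real"] by simp
qed

lemma poly_eq_on_circle:
  assumes "\<And>\<zeta>. \<zeta> \<in> \<TT> \<Longrightarrow> poly p \<zeta> = poly q \<zeta>"
  shows "p = (q :: complex poly)"
proof (rule ccontr)
  assume "p \<noteq> q"
  then have "finite {z. poly (p - q) z = 0}" by (intro poly_roots_finite) simp
  moreover have "\<TT> \<subseteq> {z. poly (p - q) z = 0}" using assms by auto
  ultimately show False using infinite_unit_circle finite_subset by blast
qed

text \<open>The conjugate reciprocal polynomial. On the circle it equals
  \<open>\<zeta> ^ n * cnj (poly p \<zeta>)\<close>, so that |p|^2 becomes a polynomial up to the
  factor \<open>\<zeta> ^ n\<close>. The exponent is a parameter because polynomials of different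
  degrees have to be reflected alike.\<close>

definition reciprocal_poly :: "nat \<Rightarrow> complex poly \<Rightarrow> complex poly"
  where "reciprocal_poly n p = (\<Sum>k\<le>n. monom (cnj (coeff p k)) (n - k))"

lemma poly_reciprocal_poly:
  assumes "degree p \<le> n" "z \<noteq> 0"
  shows "poly (reciprocal_poly n p) z = z ^ n * cnj (poly p (1 / cnj z))"
proof -
  have "poly p w = (\<Sum>k\<le>n. coeff p k * w ^ k)" for w
    by (subst poly_as_sum_of_monoms'[OF assms(1), symmetric]) (simp add: poly_sum poly_monom)
  then have "z ^ n * cnj (poly p (1 / cnj z)) = (\<Sum>k\<le>n. z ^ n * (cnj (coeff p k) * (1 / z) ^ k))"
    by (simp add: sum_distrib_left)
  also have "\<dots> = (\<Sum>k\<le>n. cnj (coeff p k) * z ^ (n - k))"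
    using assms(2) by (intro sum.cong refl) (simp add: power_divide power_diff)
  finally show ?thesis by (simp add: reciprocal_poly_def poly_sum poly_monom)
qed

lemma circle_cnj: "\<zeta> \<in> \<TT> \<Longrightarrow> \<zeta> * cnj \<zeta> = 1"
  by (simp add: complex_norm_square[symmetric])

lemma circle_inverse: "\<zeta> \<in> \<TT> \<Longrightarrow> 1 / cnj \<zeta> = \<zeta>"
  using circle_cnj[of \<zeta>] by (metis mult.commute nonzero_divide_eq_eq mult_zero_right zero_neq_one) 

lemma coeff_reciprocal_poly: "coeff (reciprocal_poly n p) n = cnj (coeff p 0)"
proof -
  have "coeff (reciprocal_poly n p) n = (\<Sum>k\<le>n. if k = 0 then cnj (coeff p k) else 0)"
    unfolding reciprocal_poly_def coeff_sum by (intro sum.cong refl) auto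
  then show ?thesis by simp
qed

text \<open>A trigonometric polynomial that is real on the circle equals its own conjugate there,
  and conjugation on the circle is reflection of the coefficients.\<close>

lemma reciprocal_poly_self:
  assumes deg: "degree P \<le> 2 * N"
    and real: "\<And>\<zeta>. \<zeta> \<in> \<TT> \<Longrightarrow> poly P \<zeta> * cnj \<zeta> ^ N \<in> \<real>"
  shows "reciprocal_poly (2 * N) P = P"
proof (rule poly_eq_on_circle)
  fix \<zeta> assume \<zeta>: "\<zeta> \<in> \<TT>"
  have "cnj (poly P \<zeta>) * \<zeta> ^ N = poly P \<zeta> * cnj \<zeta> ^ N"
    using real[OF \<zeta>] by (metis Reals_cnj_iff complex_cnj_cnj complex_cnj_mult complex_cnj_power)
  then have "cnj (poly P \<zeta>) * \<zeta> ^ N * \<zeta> ^ N = poly P \<zeta> * (\<zeta> * cnj \<zeta>) ^ N"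
    by (simp add: power_mult_distrib)
  moreover have "\<zeta> \<noteq> 0" using \<zeta> by auto
  ultimately show "poly (reciprocal_poly (2 * N) P) \<zeta> = poly P \<zeta>"
    using poly_reciprocal_poly[OF deg, of \<zeta>] circle_inverse[OF \<zeta>] circle_cnj[OF \<zeta>]
    by (simp add: mult.commute[of 2 N] power_mult power2_eq_square mult_ac)
qed

text \<open>At a zero on the circle the derivative vanishes too, since a nonnegative function of the
  angle has a minimum there.\<close>

lemma circle_double_root:
  assumes nonneg: "\<And>\<zeta>. \<zeta> \<in> \<TT> \<Longrightarrow> poly P \<zeta> * cnj \<zeta> ^ N \<in> \<real>\<^sub>\<ge>\<^sub>0"
    and \<alpha>: "\<alpha> \<in> \<TT>" and fac: "P = [:-\<alpha>, 1:] * S"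
  shows "poly S \<alpha> = 0"
proof -
  \<comment> \<open>The factor \<open>exp (- \<i> * w)\<close> replaces a conjugate, which makes
    this complex differentiable in \<open>w\<close>; for real \<open>w\<close> it is the given
    trigonometric polynomial.\<close>
  define \<Psi> where "\<Psi> w = poly P (\<alpha> * exp (\<i> * w)) * (cnj \<alpha> * exp (- \<i> * w)) ^ N" for w
  have P\<alpha>: "poly P \<alpha> = 0" using fac by simp
  have P'\<alpha>: "poly (pderiv P) \<alpha> = poly S \<alpha>" unfolding fac by (simp add: pderiv_mult pderiv_pCons del: mult_pCons_left)
  define D where "D = poly S \<alpha> * (\<alpha> * \<i>) * cnj \<alpha> ^ N"
  have "(\<Psi> has_field_derivative D) (at 0)"
    unfolding \<Psi>_def
    by (rule derivative_eq_intros poly_DERIV[THEN DERIV_chain2] refl)+ (simp add: D_def P\<alpha> P'\<alpha>)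
  then have "((\<lambda>t. \<Psi> (of_real t)) has_vector_derivative D) (at 0)"
    by (intro has_vector_derivative_real_field) simp
  then have dR: "((\<lambda>t. Re (\<Psi> (of_real t))) has_real_derivative Re D) (at 0)"
    and dI: "((\<lambda>t. Im (\<Psi> (of_real t))) has_real_derivative Im D) (at 0)"
    by (auto simp: has_vector_derivative_complex_iff)
  have pos: "\<Psi> (of_real t) \<in> \<real>\<^sub>\<ge>\<^sub>0" for t
  proof -
    have "\<alpha> * exp (\<i> * of_real t) \<in> \<TT>" using \<alpha> by (simp add: norm_mult)
    from nonneg[OF this] show ?thesis by (simp add: \<Psi>_def exp_cnj mult_ac)
  qed
  have z: "\<Psi> (of_real 0) = 0" by (simp add: \<Psi>_def P\<alpha>)
  have "Re D = 0"
    by (rule DERIV_local_min[OF dR, of 1]) (use pos z in \<open>auto simp: complex_nonneg_Reals_iff\<close>)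
  moreover have "Im D = 0"
    by (rule DERIV_local_min[OF dI, of 1]) (use pos z in \<open>auto simp: complex_nonneg_Reals_iff\<close>)
  ultimately have "D = 0" by (simp add: complex_eq_iff)
  moreover have "\<alpha> \<noteq> 0" using \<alpha> by auto
  ultimately show ?thesis by (simp add: D_def)
qed

text \<open>Dividing a nonnegative function by \<open>(cmod (\<zeta> - \<alpha>))\<^sup>2\<close>
  leaves the sign at \<open>\<alpha>\<close> undecided; it follows by approaching
  \<open>\<alpha>\<close> along the circle, as the nonnegative ray is closed.\<close>

lemma nonneg_on_circle_continuous:
  assumes cont: "continuous_on \<TT> f" and \<alpha>: "\<alpha> \<in> \<TT>"
    and nonneg: "\<And>\<zeta>. \<zeta> \<in> \<TT> \<Longrightarrow> \<zeta> \<noteq> \<alpha> \<Longrightarrow> f \<zeta> \<in> \<real>\<^sub>\<ge>\<^sub>0"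
  shows "f \<alpha> \<in> (\<real>\<^sub>\<ge>\<^sub>0 :: complex set)"
proof -
  define x where "x n = \<alpha> * cis (1 / real (Suc n))" for n
  have x: "x n \<in> \<TT>" for n using \<alpha> by (simp add: x_def norm_mult)
  have xne: "x n \<noteq> \<alpha>" for n
  proof
    assume "x n = \<alpha>"
    then have "cis (1 / real (Suc n)) = 1" using \<alpha> by (auto simp: x_def)
    then have "sin (1 / real (Suc n)) = 0" by (metis cis.sel(2) one_complex.sel(2))
    moreover have "0 < sin (1 / real (Suc n))"
      using pi_gt3 by (intro sin_gt_zero) (auto intro: le_less_trans[of _ 1])
    ultimately show False by simp
  qed
  have "(\<lambda>n. 1 / real (Suc n)) \<longlonglongrightarrow> 0" using LIMSEQ_inverse_real_of_nat by (simp add: inverse_eq_divide)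
  then have "x \<longlonglongrightarrow> \<alpha> * cis 0" unfolding x_def by (intro tendsto_intros)
  then have "x \<longlonglongrightarrow> \<alpha>" by simp
  then have "(\<lambda>n. f (x n)) \<longlonglongrightarrow> f \<alpha>"
    by (rule continuous_on_tendsto_compose[OF cont]) (use \<alpha> x in auto)
  then show ?thesis
    by (rule Lim_in_closed_set[OF closed_nonneg_Reals_complex, rotated -1]) (use nonneg x xne in auto)
qed

text \<open>Fejer--Riesz: the zeros of \<open>P\<close> come in pairs \<open>\<alpha>, 1 / cnj \<alpha>\<close>, and one factor of each
  pair has no zero in the disk.\<close>

lemma fejer_riesz:
  assumes "degree P \<le> 2 * N" "P \<noteq> 0"
    and "\<And>\<zeta>. \<zeta> \<in> \<TT> \<Longrightarrow> poly P \<zeta> * cnj \<zeta> ^ N \<in> \<real>\<^sub>\<ge>\<^sub>0"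
  shows "\<exists>A. (\<forall>z\<in>\<DD>. poly A z \<noteq> 0) \<and>
    (\<forall>\<zeta>\<in>\<TT>. poly P \<zeta> * cnj \<zeta> ^ N = of_real ((cmod (poly A \<zeta>))\<^sup>2))"
  using assms
proof (induction N arbitrary: P)
  case 0
  then obtain c where c: "P = [:c:]" using degree_eq_zeroE by auto
  have "c \<in> \<real>\<^sub>\<ge>\<^sub>0" using "0.prems"(3)[of 1] c by simp
  then obtain x where x: "c = of_real x" "x \<ge> 0" by (auto elim: nonneg_Reals_cases)
  then show ?case using "0.prems"(2) c
    by (intro exI[of _ "[:of_real (sqrt x):]"]) (auto simp flip: of_real_power)
next
  case (Suc N)
  note nonneg = Suc.prems(3)
  have rP: "reciprocal_poly (2 * Suc N) P = P"
    by (rule reciprocal_poly_self[OF Suc.prems(1)]) (use nonneg nonneg_Reals_subset_Reals in blast)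
  \<comment> \<open>This symmetry forces a root: a rootless \<open>P\<close> would be constant, so
    its coefficient at \<open>2 * Suc N\<close> would vanish, and with it
    \<open>poly P 0\<close>.\<close>
  have top: "coeff P (2 * Suc N) = cnj (coeff P 0)"
    using coeff_reciprocal_poly[of "2 * Suc N" P] rP by simp
  have "\<exists>\<alpha>. poly P \<alpha> = 0"
  proof (rule ccontr)
    assume no: "\<nexists>\<alpha>. poly P \<alpha> = 0"
    then have "degree P = 0" using fundamental_theorem_of_algebra constant_degree by blast
    then have "coeff P (2 * Suc N) = 0" by (simp add: coeff_eq_0)
    then have "poly P 0 = 0" using top by (simp add: poly_0_coeff_0)
    then show False using no by blast
  qed
  then obtain \<alpha> where \<alpha>: "poly P \<alpha> = 0" by blast
  then obtain S where S: "P = [:-\<alpha>, 1:] * S" by (metis poly_eq_0_iff_dvd dvdE)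
  show ?case
  proof (cases "\<alpha> = 0")
    case True
    have S0: "P = pCons 0 S" using S True by simp
    have Sn: "S \<noteq> 0" using S Suc.prems(2) by auto
    \<comment> \<open>The partner of the root 0 is infinity: the top coefficient vanishes too, so
      one division by the variable brings the degree from \<open>2 * N + 2\<close> down to
      \<open>2 * N\<close>.\<close>
    have "coeff P (2 * Suc N) = 0" using top \<alpha> True by (simp add: poly_0_coeff_0)
    then have "degree P \<noteq> 2 * Suc N" using Suc.prems(2) by (metis leading_coeff_0_iff)
    then have "degree S \<le> 2 * N" using Suc.prems(1) Sn by (simp add: S0)
    moreover have eq: "poly P \<zeta> * cnj \<zeta> ^ Suc N = poly S \<zeta> * cnj \<zeta> ^ N" if "\<zeta> \<in> \<TT>" for \<zeta>
    proof -
      have "poly P \<zeta> * cnj \<zeta> ^ Suc N = (\<zeta> * cnj \<zeta>) * (poly S \<zeta> * cnj \<zeta> ^ N)" by (simp add: S0)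
      then show ?thesis using circle_cnj[OF that] by simp
    qed
    moreover have "poly S \<zeta> * cnj \<zeta> ^ N \<in> \<real>\<^sub>\<ge>\<^sub>0" if "\<zeta> \<in> \<TT>" for \<zeta>
      using nonneg[OF that] unfolding eq[OF that] .
    ultimately show ?thesis using Suc.IH[of S] Sn by (metis (no_types, lifting))
  next
    case False
    define \<beta> where "\<beta> = 1 / cnj \<alpha>"
    have "poly S \<beta> = 0"
    proof (cases "cmod \<alpha> = 1")
      case True
      then have "\<beta> = \<alpha>" using circle_inverse[of \<alpha>] by (simp add: \<beta>_def)
      then show ?thesis using circle_double_root[OF nonneg _ S] True by auto
    next
      case ne: False
      have "\<beta> \<noteq> 0" using False by (simp add: \<beta>_def)
      then have "poly P \<beta> = 0"
        using poly_reciprocal_poly[OF Suc.prems(1), of \<beta>] rP \<alpha> by (simp add: \<beta>_def)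
      moreover have "\<beta> \<noteq> \<alpha>"
      proof
        assume "\<beta> = \<alpha>"
        then have "\<alpha> * cnj \<alpha> = 1" using False by (simp add: \<beta>_def field_simps)
        then have "cmod \<alpha> * cmod \<alpha> = 1" by (metis complex_mod_cnj norm_mult norm_one)
        then have "cmod \<alpha> = 1" using norm_ge_zero[of \<alpha>] by (metis abs_of_nonneg abs_square_eq_1 power2_eq_square)
        then show False using ne by simp
      qed
      ultimately show ?thesis using S by simp
    qed
    then obtain S1 where S1: "S = [:-\<beta>, 1:] * S1" by (metis poly_eq_0_iff_dvd dvdE)
    \<comment> \<open>The scalar turns the factor of the second root into
      \<open>1 - cnj \<alpha> * z\<close>. Together with \<open>z - \<alpha>\<close> and one power
      of \<open>cnj \<zeta>\<close> this is \<open>(cmod (\<zeta> - \<alpha>))\<^sup>2\<close> on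
      the circle, so nonnegativity is inherited by \<open>Q\<close>.\<close>
    define Q where "Q = smult (-\<beta>) S1"
    have "smult (-\<beta>) [:1, - cnj \<alpha>:] = [:-\<beta>, 1:]" using False by (simp add: \<beta>_def)
    then have fac: "P = [:-\<alpha>, 1:] * ([:1, - cnj \<alpha>:] * Q)"
      unfolding S S1 Q_def by (metis mult_smult_left mult_smult_right)
    have Qn: "Q \<noteq> 0" using fac Suc.prems(2) by auto
    have "degree ([:1, - cnj \<alpha>:] * Q) = 1 + degree Q"
      using Qn False by (subst degree_mult_eq) auto
    moreover have "[:1, - cnj \<alpha>:] * Q \<noteq> 0" using Qn by (simp only: mult_eq_0_iff) simp
    ultimately have "degree P = 1 + (1 + degree Q)"
      unfolding fac by (subst degree_mult_eq) (simp_all del: mult_pCons_left)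
    then have dQ: "degree Q \<le> 2 * N" using Suc.prems(1) by simp
    have ab: "(\<zeta> - \<alpha>) * (1 - cnj \<alpha> * \<zeta>) * cnj \<zeta> = of_real ((cmod (\<zeta> - \<alpha>))\<^sup>2)" if "\<zeta> \<in> \<TT>" for \<zeta>
    proof -
      have "(1 - cnj \<alpha> * \<zeta>) * cnj \<zeta> = cnj \<zeta> - cnj \<alpha> * (\<zeta> * cnj \<zeta>)" by (simp add: algebra_simps)
      then have "(1 - cnj \<alpha> * \<zeta>) * cnj \<zeta> = cnj (\<zeta> - \<alpha>)" using circle_cnj[OF that] by simp
      then show ?thesis by (simp add: mult.assoc complex_norm_square del: of_real_power)
    qed
    have eq: "poly P \<zeta> * cnj \<zeta> ^ Suc N = of_real ((cmod (\<zeta> - \<alpha>))\<^sup>2) * (poly Q \<zeta> * cnj \<zeta> ^ N)"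
      if "\<zeta> \<in> \<TT>" for \<zeta>
      unfolding ab[OF that, symmetric] fac by (simp add: algebra_simps)
    have off: "poly Q \<zeta> * cnj \<zeta> ^ N \<in> \<real>\<^sub>\<ge>\<^sub>0" if \<zeta>: "\<zeta> \<in> \<TT>" and ne: "\<zeta> \<noteq> \<alpha>" for \<zeta>
    proof -
      have p: "(cmod (\<zeta> - \<alpha>))\<^sup>2 > 0" using ne by simp
      obtain x where x: "x \<ge> 0" "poly P \<zeta> * cnj \<zeta> ^ Suc N = of_real x"
        using nonneg[OF \<zeta>] by (auto elim: nonneg_Reals_cases)
      then have "poly Q \<zeta> * cnj \<zeta> ^ N = of_real (x / (cmod (\<zeta> - \<alpha>))\<^sup>2)"
        using eq[OF \<zeta>] p by (simp add: field_simps)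
      then show ?thesis using x p by (simp del: of_real_divide)
    qed
    have "poly Q \<zeta> * cnj \<zeta> ^ N \<in> \<real>\<^sub>\<ge>\<^sub>0" if \<zeta>: "\<zeta> \<in> \<TT>" for \<zeta>
    proof (cases "\<zeta> = \<alpha>")
      case True
      have "continuous_on \<TT> (\<lambda>\<zeta>. poly Q \<zeta> * cnj \<zeta> ^ N)" by (intro continuous_intros)
      from nonneg_on_circle_continuous[OF this \<zeta>] show ?thesis using off True by blast
    qed (use off \<zeta> in blast)
    then obtain A where A: "\<And>z. z \<in> \<DD> \<Longrightarrow> poly A z \<noteq> 0"
      "\<And>\<zeta>. \<zeta> \<in> \<TT> \<Longrightarrow> poly Q \<zeta> * cnj \<zeta> ^ N = of_real ((cmod (poly A \<zeta>))\<^sup>2)"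
      using Suc.IH[OF dQ Qn] by blast
    \<comment> \<open>The two reflected factors have the same modulus
      \<open>cmod (\<zeta> - \<alpha>)\<close> on the circle, so the choice between them is free to
      avoid zeros in the disk.\<close>
    define F where "F = (if cmod \<alpha> \<ge> 1 then [:-\<alpha>, 1:] else [:1, - cnj \<alpha>:])"
    have "poly F z \<noteq> 0" if "z \<in> \<DD>" for z
    proof (cases "cmod \<alpha> \<ge> 1")
      case True
      then show ?thesis using that by (auto simp: F_def)
    next
      case small: False
      then have "cmod (z * cnj \<alpha>) < 1"
        using that mult_strict_mono'[of "cmod z" 1 "cmod \<alpha>" 1] by (simp add: norm_mult) 
      then have "z * cnj \<alpha> \<noteq> 1" by (metis less_irrefl norm_one)
      then show ?thesis using small by (simp add: F_def)
    qed
    moreover have "cmod (poly F \<zeta>) = cmod (\<zeta> - \<alpha>)" if \<zeta>: "\<zeta> \<in> \<TT>" for \<zeta>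
    proof (cases "cmod \<alpha> \<ge> 1")
      case True
      then show ?thesis by (simp add: F_def)
    next
      case small: False
      have "cmod (1 - \<zeta> * cnj \<alpha>) = cmod (\<zeta> * (cnj \<zeta> - cnj \<alpha>))"
        using circle_cnj[OF \<zeta>] by (simp add: right_diff_distrib)
      also have "\<dots> = cmod (cnj (\<zeta> - \<alpha>))" using \<zeta> by (simp add: norm_mult)
      finally show ?thesis using small by (simp add: F_def complex_mod_cnj del: complex_cnj_diff)
    qed
    ultimately show ?thesis
      using A eq by (intro exI[of _ "F * A"]) (auto simp: norm_mult power_mult_distrib)
  qed
qed

text \<open>A root with \<open>cmod \<alpha> \<ge> 1\<close> has distance at least
  \<open>1 - r\<close> from \<open>r * \<zeta>\<close>, so the distance of \<open>\<zeta>\<close> to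
  it is at most twice that of \<open>r * \<zeta>\<close>; each root costs a factor 1/2. The bound
  supplies the integrable minorant for \<open>ln\<close> of the modulus near zeros on the
  circle.\<close>

lemma poly_radial_lower_bound:
  assumes "\<And>z. z \<in> \<DD> \<Longrightarrow> poly A z \<noteq> 0"
  shows "\<exists>c>0. \<forall>\<zeta>\<in>\<TT>. \<forall>r. 0 \<le> r \<and> r < 1 \<longrightarrow> c * cmod (poly A \<zeta>) \<le> cmod (poly A (of_real r * \<zeta>))"
  using assms
proof (induction "degree A" arbitrary: A)
  case 0
  then obtain c where "A = [:c:]" using degree_eq_zeroE by metis
  then show ?case by (intro exI[of _ 1]) auto
next
  case (Suc n)
  then have "\<not> constant (poly A)" by (simp add: constant_degree)
  then obtain \<alpha> where \<alpha>: "poly A \<alpha> = 0" using fundamental_theorem_of_algebra by blast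
  then have a1: "cmod \<alpha> \<ge> 1" using Suc.prems[of \<alpha>] by (cases "cmod \<alpha> < 1") auto
  obtain B where B: "A = [:-\<alpha>, 1:] * B" using \<alpha> by (metis poly_eq_0_iff_dvd dvdE)
  have "B \<noteq> 0" using B Suc.hyps(2) by auto
  then have "degree A = 1 + degree B" unfolding B by (subst degree_mult_eq) auto
  then have "n = degree B" using Suc.hyps(2) by simp
  moreover have "poly B z \<noteq> 0" if "z \<in> \<DD>" for z using Suc.prems[OF that] B by auto
  ultimately obtain c where c: "c > 0"
    "\<forall>\<zeta>\<in>\<TT>. \<forall>r. 0 \<le> r \<and> r < 1 \<longrightarrow> c * cmod (poly B \<zeta>) \<le> cmod (poly B (of_real r * \<zeta>))"
    using Suc.hyps(1) by blast
  have "c / 2 * cmod (poly A \<zeta>) \<le> cmod (poly A (of_real r * \<zeta>))"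
    if \<zeta>: "\<zeta> \<in> \<TT>" and r: "0 \<le> r" "r < 1" for \<zeta> r
  proof -
    have "cmod (\<zeta> - of_real r * \<zeta>) = 1 - r"
    proof -
      have "\<zeta> - of_real r * \<zeta> = of_real (1 - r) * \<zeta>" by (simp add: algebra_simps)
      then show ?thesis using \<zeta> r by (simp only: norm_mult norm_of_real) simp
    qed
    moreover have "1 - r \<le> cmod (of_real r * \<zeta> - \<alpha>)"
      using norm_triangle_ineq2[of \<alpha> "of_real r * \<zeta>"] a1 \<zeta> r by (simp add: norm_mult norm_minus_commute)
    moreover have "cmod (\<zeta> - \<alpha>) \<le> cmod (\<zeta> - of_real r * \<zeta>) + cmod (of_real r * \<zeta> - \<alpha>)"
      using norm_triangle_ineq[of "\<zeta> - of_real r * \<zeta>" "of_real r * \<zeta> - \<alpha>"] by simp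
    ultimately have "cmod (\<zeta> - \<alpha>) / 2 \<le> cmod (of_real r * \<zeta> - \<alpha>)" by simp
    moreover have "c * cmod (poly B \<zeta>) \<le> cmod (poly B (of_real r * \<zeta>))" using c \<zeta> r by blast
    ultimately have "(cmod (\<zeta> - \<alpha>) / 2) * (c * cmod (poly B \<zeta>)) \<le>
        cmod (of_real r * \<zeta> - \<alpha>) * cmod (poly B (of_real r * \<zeta>))"
      using c by (intro mult_mono) auto
    moreover have "cmod (poly A z) = cmod (z - \<alpha>) * cmod (poly B z)" for z
      unfolding B poly_mult norm_mult by simp
    ultimately show ?thesis by (simp add: mult_ac)
  qed
  then show ?case using c by (intro exI[of _ "c / 2"]) auto
qed

text \<open>Lagrange interpolation: the \<open>L x\<close> are the basis polynomials of the nodes,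
  and \<open>C\<close> sums bounds for them on the closed disk.\<close>

lemma poly_bound_by_values:
  fixes S :: "complex set"
  assumes fin: "finite S"
  shows "\<exists>C\<ge>0. \<forall>p. degree p < card S \<longrightarrow> (\<forall>z\<in>cball 0 1. cmod (poly p z) \<le> C * (\<Sum>x\<in>S. cmod (poly p x)))"
proof -
  define L where "L x = (\<Prod>y\<in>S - {x}. smult (1 / (x - y)) [:-y, 1:])" for x
  have deg: "degree (L x) < card S" if "x \<in> S" for x
  proof -
    have "degree (L x) \<le> (\<Sum>y\<in>S - {x}. degree (smult (1 / (x - y)) [:-y, 1:]))"
      unfolding L_def by (rule degree_prod_sum_le[unfolded o_def]) (use fin in simp)
    also have "\<dots> \<le> (\<Sum>y\<in>S - {x}. 1)" by (intro sum_mono) simp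
    also have "\<dots> < card S" using that fin card_gt_0_iff[of S] by auto
    finally show ?thesis .
  qed
  have L: "poly (L x) y = (if x = y then 1 else 0)" if "x \<in> S" "y \<in> S" for x y
  proof (cases "x = y")
    case True
    have "poly (L x) y = 1"
      unfolding L_def poly_prod
    proof (rule prod.neutral, rule ballI)
      fix x' assume "x' \<in> S - {x}"
      then have "x - x' \<noteq> 0" by auto
      then show "poly (smult (1 / (x - x')) [:- x', 1:]) y = 1" using True by (simp add: divide_simps)
    qed
    then show ?thesis using True by simp
  next
    case False
    then show ?thesis using that fin by (auto simp: L_def poly_prod intro!: prod_zero bexI[of _ y])
  qed
  have ex: "\<exists>C\<ge>0. \<forall>z\<in>cball 0 1. cmod (poly q z) \<le> C" for q :: "complex poly"
  proof -
    have "bounded (poly q ` cball 0 1)"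
      by (intro compact_imp_bounded compact_continuous_image continuous_intros) auto
    then obtain C where "\<forall>z\<in>cball 0 1. cmod (poly q z) \<le> C" by (auto simp: bounded_iff)
    then show ?thesis by (intro exI[of _ "max 0 C"]) auto
  qed
  obtain B where B: "\<And>x. B x \<ge> 0" "\<And>x z. z \<in> cball 0 1 \<Longrightarrow> cmod (poly (L x) z) \<le> B x"
    using ex[of "L _"] by metis
  define C where "C = (\<Sum>x\<in>S. B x)"
  have "cmod (poly p z) \<le> C * (\<Sum>x\<in>S. cmod (poly p x))"
    if p: "degree p < card S" and z: "z \<in> cball 0 1" for p z
  proof -
    have "p = (\<Sum>x\<in>S. smult (poly p x) (L x))"
    proof (rule poly_eqI_degree[of S])
      show "degree (\<Sum>x\<in>S. smult (poly p x) (L x)) < card S"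
        using deg p by (intro degree_sum_less) (auto intro: le_less_trans[OF degree_smult_le])
      show "poly p y = poly (\<Sum>x\<in>S. smult (poly p x) (L x)) y" if "y \<in> S" for y
        using that fin by (simp add: poly_sum L if_distrib cong: if_cong)
    qed (use p in auto)
    then have "poly p z = (\<Sum>x\<in>S. poly p x * poly (L x) z)"
      by (metis (no_types, lifting) poly_smult poly_sum sum.cong)
    then have "cmod (poly p z) \<le> (\<Sum>x\<in>S. cmod (poly p x * poly (L x) z))" by (simp add: norm_sum)
    also have "\<dots> \<le> (\<Sum>x\<in>S. C * cmod (poly p x))"
    proof (rule sum_mono)
      fix x assume "x \<in> S"
      then have "B x \<le> C" unfolding C_def using fin B(1) by (simp add: member_le_sum)
      then have "cmod (poly (L x) z) \<le> C" using B(2)[OF z, of x] by simp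
      then have "cmod (poly p x) * cmod (poly (L x) z) \<le> cmod (poly p x) * C" by (intro mult_left_mono) auto
      then show "cmod (poly p x * poly (L x) z) \<le> C * cmod (poly p x)" by (simp add: norm_mult mult.commute)
    qed
    finally show ?thesis by (simp add: sum_distrib_left)
  qed
  moreover have "C \<ge> 0" unfolding C_def using B(1) by (simp add: sum_nonneg)
  ultimately show ?thesis by blast
qed

text \<open>Reflection turns the identity of moduli on the circle into a polynomial identity. At
  \<open>z0 = 1 / cnj w\<close> the reflected polynomials take the values \<open>z0 ^ N\<close>
  times the conjugates of the values at \<open>w\<close>, which is exactly the numerator at
  \<open>z0\<close>. That the degree of \<open>R\<close> is bounded independently of
  \<open>w\<close> confines all residuals to one finite-dimensional space.\<close>

lemma kernel_numerator_dvd: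
  fixes p q A :: "complex poly"
  assumes deg: "degree p \<le> N" "degree q \<le> N" "degree A \<le> N"
    and pyth: "\<And>\<zeta>. \<zeta> \<in> \<TT> \<Longrightarrow> (cmod (poly q \<zeta>))\<^sup>2 = (cmod (poly p \<zeta>))\<^sup>2 + (cmod (poly A \<zeta>))\<^sup>2"
  shows "\<exists>R. degree R \<le> N \<and> (\<forall>z. (1 - cnj w * z) * poly R z =
    cnj (poly q w) * poly q z - cnj (poly p w) * poly p z - cnj (poly A w) * poly A z)"
proof -
  define Q where "Q = smult (cnj (poly q w)) q - smult (cnj (poly p w)) p - smult (cnj (poly A w)) A"
  have dQ: "degree Q \<le> N"
    unfolding Q_def using deg by (intro degree_diff_le) (auto intro: order_trans[OF degree_smult_le])
  show ?thesis
  proof (cases "w = 0")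
    case True
    then show ?thesis using dQ by (intro exI[of _ Q]) (auto simp: Q_def)
  next
    case False
    define z0 where "z0 = 1 / cnj w"
    have z0: "z0 \<noteq> 0" "1 / cnj z0 = w" using False by (auto simp: z0_def)
    have "q * reciprocal_poly N q - p * reciprocal_poly N p - A * reciprocal_poly N A = 0"
    proof (rule poly_eq_on_circle)
      fix \<zeta> assume \<zeta>: "\<zeta> \<in> \<TT>"
      have nz: "\<zeta> \<noteq> 0" using \<zeta> by auto
      have e: "poly f \<zeta> * poly (reciprocal_poly N f) \<zeta> = \<zeta> ^ N * of_real ((cmod (poly f \<zeta>))\<^sup>2)"
        if "degree f \<le> N" for f
        using poly_reciprocal_poly[OF that nz] circle_inverse[OF \<zeta>]
        by (simp add: complex_norm_square mult_ac del: of_real_power)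
      show "poly (q * reciprocal_poly N q - p * reciprocal_poly N p - A * reciprocal_poly N A) \<zeta> = poly 0 \<zeta>"
        using deg by (simp add: e pyth[OF \<zeta>] algebra_simps del: of_real_power)
    qed
    then have "poly q z0 * poly (reciprocal_poly N q) z0 - poly p z0 * poly (reciprocal_poly N p) z0
        - poly A z0 * poly (reciprocal_poly N A) z0 = 0"
      by (metis poly_0 poly_diff poly_mult)
    then have "z0 ^ N * poly Q z0 = 0"
      using deg z0 by (simp add: poly_reciprocal_poly Q_def algebra_simps)
    then have "poly Q z0 = 0" using z0 by simp
    then obtain R' where R': "Q = [:-z0, 1:] * R'" by (metis poly_eq_0_iff_dvd dvdE)
    define R where "R = smult (-z0) R'"
    have "smult (-z0) [:1, - cnj w:] = [:-z0, 1:]" using False by (simp add: z0_def)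
    then have fac: "Q = [:1, - cnj w:] * R" unfolding R' R_def by (metis mult_smult_left mult_smult_right)
    have "degree R \<le> degree Q"
      by (cases "R = 0") (auto simp: fac degree_mult_eq simp del: mult_pCons_left)
    moreover have "(1 - cnj w * z) * poly R z = poly Q z" for z
      unfolding fac by (simp add: algebra_simps)
    ultimately show ?thesis using dQ by (intro exI[of _ R]) (auto simp: Q_def)
  qed
qed

text \<open>The inequality |p| <= |q| passes from the disk to its closure, so a zero of
  \<open>q\<close> on the circle is also a zero of \<open>p\<close> and cancels; the degree of
  \<open>q\<close> decreases.\<close>

lemma bounded_rational_pole_free:
  assumes "\<And>z. z \<in> \<DD> \<Longrightarrow> poly q z \<noteq> 0"
    and "\<And>z. z \<in> \<DD> \<Longrightarrow> b z = poly p z / poly q z"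
    and "\<And>z. z \<in> \<DD> \<Longrightarrow> cmod (b z) \<le> 1"
  shows "\<exists>p q :: complex poly. (\<forall>z\<in>cball 0 1. poly q z \<noteq> 0) \<and> (\<forall>z\<in>\<DD>. b z = poly p z / poly q z)"
  using assms
proof (induction "degree q" arbitrary: p q rule: less_induct)
  case less
  show ?case
  proof (cases "\<exists>\<zeta>\<in>cball 0 1. poly q \<zeta> = 0")
    case True
    then obtain \<zeta> where \<zeta>: "\<zeta> \<in> cball 0 1" "poly q \<zeta> = 0" by blast
    have "\<forall>z\<in>closure \<DD>. cmod (poly p z) - cmod (poly q z) \<in> {..0}"
    proof
      fix z assume z: "z \<in> closure \<DD>"
      have "closure \<DD> \<subseteq> (\<lambda>z. cmod (poly p z) - cmod (poly q z)) -` {..0}"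
      proof (rule closure_minimal)
        show "\<DD> \<subseteq> (\<lambda>z. cmod (poly p z) - cmod (poly q z)) -` {..0}"
          using less.prems by (fastforce simp: norm_divide divide_le_eq)
        show "closed ((\<lambda>z. cmod (poly p z) - cmod (poly q z)) -` {..0})"
          by (intro closed_vimage continuous_intros closed_atMost)
      qed
      then show "cmod (poly p z) - cmod (poly q z) \<in> {..0}" using z by blast
    qed
    then have "cmod (poly p \<zeta>) - cmod (poly q \<zeta>) \<in> {..0}" using \<zeta>(1) by (simp add: closure_ball)
    then have "poly p \<zeta> = 0" using \<zeta>(2) by simp
    then obtain p' where p': "p = [:-\<zeta>, 1:] * p'" by (metis poly_eq_0_iff_dvd dvdE)
    obtain q' where q': "q = [:-\<zeta>, 1:] * q'" using \<zeta> by (metis poly_eq_0_iff_dvd dvdE)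
    have "q \<noteq> 0" using less.prems(1)[of 0] by auto
    then have "q' \<noteq> 0" using q' by auto
    then have "degree q = 1 + degree q'" unfolding q' by (subst degree_mult_eq) auto
    moreover have "poly q' z \<noteq> 0" if "z \<in> \<DD>" for z using less.prems(1)[OF that] q' by auto
    moreover have "b z = poly p' z / poly q' z" if "z \<in> \<DD>" for z
    proof -
      have "z - \<zeta> \<noteq> 0" using less.prems(1)[OF that] q' by auto
      moreover have "poly p z = (z - \<zeta>) * poly p' z" "poly q z = (z - \<zeta>) * poly q' z"
        unfolding p' q' by (simp_all add: algebra_simps)
      ultimately show ?thesis using less.prems(2)[OF that] by simp
    qed
    ultimately show ?thesis using less.hyps[of q' p'] less.prems(3) by simp
  next
    case False
    then show ?thesis using less.prems by blast
  qed
qed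

subsection \<open>Outer functions with rational modulus\<close>

text \<open>Taking moduli removes the unimodular constant and the imaginary part of the exponent.
  For fixed \<open>z\<close> the kernel is bounded on the circle, which makes the integrand
  integrable.\<close>

lemma norm_outer_function:
  assumes out: "outer_function a" and z: "z \<in> \<DD>"
  shows "cmod (a z) = exp (\<integral>\<zeta>. poisson z \<zeta> * ln (cmod (nt_extension a \<zeta>)) \<partial>circle_measure)"
proof -
  define u where "u \<zeta> = ln (cmod (nt_extension a \<zeta>))" for \<zeta>
  have int: "integrable circle_measure u"
    using out unfolding outer_function_def u_def by blast
  have cont: "continuous_on \<TT> (\<lambda>\<zeta>. (\<zeta> + z) / (\<zeta> - z))"
    using circle_minus_nonzero[OF z] by (intro continuous_intros) auto
  then have "compact ((\<lambda>\<zeta>. (\<zeta> + z) / (\<zeta> - z)) ` \<TT>)" by (intro compact_continuous_image) auto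
  then obtain B where B: "\<And>\<zeta>. \<zeta> \<in> \<TT> \<Longrightarrow> cmod ((\<zeta> + z) / (\<zeta> - z)) \<le> B"
    using compact_imp_bounded by (fastforce simp: bounded_iff)
  have "integrable circle_measure (\<lambda>\<zeta>. (\<zeta> + z) / (\<zeta> - z) * of_real (u \<zeta>))"
  proof (rule Bochner_Integration.integrable_bound)
    show "integrable circle_measure (\<lambda>\<zeta>. B * u \<zeta>)" using int by simp
    show "(\<lambda>\<zeta>. (\<zeta> + z) / (\<zeta> - z) * of_real (u \<zeta>)) \<in> borel_measurable circle_measure"
      using int borel_measurable_circle_continuous[OF cont] by measurable
    show "AE \<zeta> in circle_measure. norm ((\<zeta> + z) / (\<zeta> - z) * of_real (u \<zeta>)) \<le> norm (B * u \<zeta>)"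
    proof (rule AE_I2)
      fix \<zeta> assume "\<zeta> \<in> space circle_measure"
      then have "cmod ((\<zeta> + z) / (\<zeta> - z)) \<le> B" using B by simp
      then have "cmod ((\<zeta> + z) / (\<zeta> - z)) * \<bar>u \<zeta>\<bar> \<le> \<bar>B\<bar> * \<bar>u \<zeta>\<bar>" by (intro mult_right_mono) auto
      then show "norm ((\<zeta> + z) / (\<zeta> - z) * of_real (u \<zeta>)) \<le> norm (B * u \<zeta>)"
        unfolding norm_mult norm_of_real real_norm_def abs_mult .
    qed
  qed
  from integral_Re[OF this]
  have "Re (\<integral>\<zeta>. (\<zeta> + z) / (\<zeta> - z) * of_real (u \<zeta>) \<partial>circle_measure) = (\<integral>\<zeta>. poisson z \<zeta> * u \<zeta> \<partial>circle_measure)"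
    by (simp add: poisson_def del: times_divide_eq_left times_divide_eq_right)
  moreover obtain c where "cmod c = 1"
    "a z = c * exp (\<integral>\<zeta>. (\<zeta> + z) / (\<zeta> - z) * of_real (u \<zeta>) \<partial>circle_measure)"
    using out z unfolding outer_function_def u_def by blast
  ultimately show ?thesis by (simp add: norm_mult u_def)
qed

lemma compact_cball_bound:
  assumes "continuous_on (cball 0 1) (f :: complex \<Rightarrow> complex)"
  obtains M where "M \<ge> 1" "\<And>z. z \<in> cball 0 1 \<Longrightarrow> cmod (f z) \<le> M"
proof -
  have "bounded (f ` cball 0 1)"
    using assms by (intro compact_imp_bounded compact_continuous_image) auto
  then obtain M where "\<forall>z\<in>cball 0 1. cmod (f z) \<le> M" by (auto simp: bounded_iff)
  then show thesis by (intro that[of "max 1 M"]) (auto simp: le_max_iff_disj)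
qed

text \<open>Zeros of \<open>A\<close> on the circle rule out a holomorphic logarithm near the closed
  disk. The dilates \<open>f (r * z)\<close> are zero-free on a larger disk and satisfy the Poisson
  formula through their logarithm; dominated convergence lets \<open>r\<close> tend to 1.\<close>

lemma ln_rational_poisson:
  fixes A q :: "complex poly"
  defines "f \<equiv> (\<lambda>z. poly A z / poly q z)"
  assumes A: "\<And>z. z \<in> \<DD> \<Longrightarrow> poly A z \<noteq> 0" and q: "\<And>z. z \<in> cball 0 1 \<Longrightarrow> poly q z \<noteq> 0"
    and int: "integrable circle_measure (\<lambda>\<zeta>. ln (cmod (f \<zeta>)))"
    and nz: "AE \<zeta> in circle_measure. poly A \<zeta> \<noteq> 0"
    and z: "z \<in> \<DD>"
  shows "(\<integral>\<zeta>. poisson z \<zeta> * ln (cmod (f \<zeta>)) \<partial>circle_measure) = ln (cmod (f z))"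
proof -
  have cf: "continuous_on (cball 0 1) f" unfolding f_def using q by (intro continuous_intros) auto
  have fnz: "f w \<noteq> 0" if "w \<in> \<DD>" for w using A[OF that] q[of w] that by (simp add: f_def)
  obtain M where M: "M \<ge> 1" "\<And>w. w \<in> cball 0 1 \<Longrightarrow> cmod (f w) \<le> M"
    using compact_cball_bound[OF cf] by blast
  obtain c where c: "c > 0"
    "\<And>\<zeta> r. \<zeta> \<in> \<TT> \<Longrightarrow> 0 \<le> r \<Longrightarrow> r < 1 \<Longrightarrow> c * cmod (poly A \<zeta>) \<le> cmod (poly A (of_real r * \<zeta>))"
    using poly_radial_lower_bound[of A] A by blast
  have cq: "continuous_on (cball 0 1) (\<lambda>w. 1 / poly q w)" using q by (intro continuous_intros) auto
  obtain M1 where M1: "M1 \<ge> 1" "\<And>w. w \<in> cball 0 1 \<Longrightarrow> cmod (1 / poly q w) \<le> M1"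
    using compact_cball_bound[OF cq] by blast
  obtain M2 where M2: "M2 \<ge> 1" "\<And>w. w \<in> cball 0 1 \<Longrightarrow> cmod (poly q w) \<le> M2"
    using compact_cball_bound[of "poly q"] continuous_on_poly[OF continuous_on_id] by blast
  \<comment> \<open>\<open>c\<close> compares the values of \<open>A\<close> along a radius; the two
    bounds on \<open>1 / q\<close> and \<open>q\<close> transfer this comparison to the
    quotient.\<close>
  define c1 where "c1 = c / (M1 * M2)"
  have c1: "c1 > 0" using c M1 M2 by (simp add: c1_def)
  obtain r :: "nat \<Rightarrow> real" where r: "\<And>n. 0 < r n" "\<And>n. r n < 1"
    and rin: "\<And>n z. z \<in> cball 0 1 \<Longrightarrow> of_real (r n) * z \<in> \<DD>"
    and zlim: "\<And>z :: complex. (\<lambda>n. of_real (r n) * z) \<longlonglongrightarrow> z"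
    using radial_sequence by blast
  have flim: "(\<lambda>n. f (of_real (r n) * w)) \<longlonglongrightarrow> f w" if w: "w \<in> cball 0 1" for w
  proof -
    show ?thesis
      using zlim[of w] continuous_on_tendsto_compose[OF cf, of "\<lambda>n. of_real (r n) * w" w sequentially] w rin[OF w]
      by (auto simp: less_imp_le)
  qed
  have lower: "c1 * cmod (f \<zeta>) \<le> cmod (f (of_real (r n) * \<zeta>))" if \<zeta>: "\<zeta> \<in> \<TT>" for n \<zeta>
  proof -
    let ?w = "of_real (r n) * \<zeta>"
    have w: "?w \<in> cball 0 1" using rin[of \<zeta> n] \<zeta> by (simp add: less_imp_le)
    have "cmod (f \<zeta>) \<le> cmod (poly A \<zeta>) * M1"
      using M1(2)[of \<zeta>] \<zeta> mult_left_mono[of "cmod (1 / poly q \<zeta>)" M1 "cmod (poly A \<zeta>)"]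
      by (simp add: f_def norm_divide)
    then have "c1 * cmod (f \<zeta>) \<le> c1 * (cmod (poly A \<zeta>) * M1)" using c1 by (intro mult_left_mono) auto
    also have "\<dots> = c * cmod (poly A \<zeta>) / M2" using M1 by (simp add: c1_def field_simps)
    also have "\<dots> \<le> cmod (poly A ?w) / M2"
      using c(2)[OF \<zeta>, of "r n"] r[of n] M2(1) by (intro divide_right_mono) auto
    also have "\<dots> \<le> cmod (poly A ?w) / cmod (poly q ?w)"
      using M2(2)[OF w] q[OF w] by (intro divide_left_mono mult_pos_pos) (use M2(1) in auto)
    finally show ?thesis by (simp add: f_def norm_divide)
  qed
  have step: "(\<integral>\<zeta>. poisson z \<zeta> * ln (cmod (f (of_real (r n) * \<zeta>))) \<partial>circle_measure) = ln (cmod (f (of_real (r n) * z)))" for n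
  proof -
    let ?R = "1 / r n"
    let ?g = "\<lambda>w. f (of_real (r n) * w)"
    have R: "?R > 1" using r[of n] by simp
    have inD: "of_real (r n) * w \<in> \<DD>" if "w \<in> ball 0 ?R" for w
      using that r[of n] by (simp add: norm_mult field_simps)
    have holf: "f holomorphic_on \<DD>"
      unfolding f_def by (intro holomorphic_intros) (use q in auto)
    have hol: "?g holomorphic_on ball 0 ?R"
    proof -
      have "(\<lambda>w. of_real (r n) * w) ` ball 0 ?R \<subseteq> \<DD>" using inD by blast
      from holomorphic_on_compose_gen[OF _ holf this] show ?thesis
        by (simp add: o_def holomorphic_intros)
    qed
    have "contractible (ball (0::complex) ?R)" by (intro convex_imp_contractible) auto
    then obtain F where F: "F holomorphic_on ball 0 ?R" "\<And>w. w \<in> ball 0 ?R \<Longrightarrow> ?g w = exp (F w)"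
      using contractible_imp_holomorphic_log[OF hol] fnz inD by metis
    have re: "ln (cmod (?g w)) = Re (F w)" if "w \<in> ball 0 ?R" for w
      using F(2)[OF that] by simp
    have "(\<integral>\<zeta>. poisson z \<zeta> * ln (cmod (?g \<zeta>)) \<partial>circle_measure) = (\<integral>\<zeta>. poisson z \<zeta> * Re (F \<zeta>) \<partial>circle_measure)"
      using R by (intro Bochner_Integration.integral_cong) (auto simp: re)
    also have "\<dots> = Re (F z)" by (rule circle_poisson[OF F(1) R z])
    also have "\<dots> = ln (cmod (?g z))" using re[of z] z R by auto
    finally show ?thesis .
  qed
  have cp: "continuous_on \<TT> (poisson z)" by (rule continuous_on_poisson[OF z])
  have "bounded (poisson z ` \<TT>)" using cp by (intro compact_imp_bounded compact_continuous_image) auto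
  then obtain B where B: "\<And>\<zeta>. \<zeta> \<in> \<TT> \<Longrightarrow> \<bar>poisson z \<zeta>\<bar> \<le> B" by (force simp: bounded_iff)
  have mf: "(\<lambda>\<zeta>. ln (cmod (f (of_real s * \<zeta>)))) \<in> borel_measurable circle_measure" if s: "s = 1 \<or> (\<exists>n. s = r n)" for s
  proof -
    have "continuous_on \<TT> (\<lambda>\<zeta>. cmod (f (of_real s * \<zeta>)))"
      by (intro continuous_on_norm continuous_on_compose2[OF cf] continuous_intros)
        (use s r in \<open>auto simp: norm_mult less_imp_le\<close>)
    from borel_measurable_circle_continuous[OF this] show ?thesis by measurable
  qed
  note [measurable] = borel_measurable_circle_continuous[OF cp]
  have "(\<lambda>n. \<integral>\<zeta>. poisson z \<zeta> * ln (cmod (f (of_real (r n) * \<zeta>))) \<partial>circle_measure)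
      \<longlonglongrightarrow> (\<integral>\<zeta>. poisson z \<zeta> * ln (cmod (f \<zeta>)) \<partial>circle_measure)"
  \<comment> \<open>The logarithms of the dilates lie between
    \<open>ln c1 + ln (cmod (f \<zeta>))\<close> and \<open>ln M\<close>, and \<open>B\<close>
    bounds the Poisson kernel.\<close>
  proof (rule integral_dominated_convergence[where w="\<lambda>\<zeta>. B * (\<bar>ln M\<bar> + \<bar>ln c1\<bar> + \<bar>ln (cmod (f \<zeta>))\<bar>)"])
    show "(\<lambda>\<zeta>. poisson z \<zeta> * ln (cmod (f \<zeta>))) \<in> borel_measurable circle_measure"
      using mf[of 1] by simp
    show "(\<lambda>\<zeta>. poisson z \<zeta> * ln (cmod (f (of_real (r n) * \<zeta>)))) \<in> borel_measurable circle_measure" for n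
      by (intro borel_measurable_times borel_measurable_circle_continuous[OF cp] mf) auto
    show "integrable circle_measure (\<lambda>\<zeta>. B * (\<bar>ln M\<bar> + \<bar>ln c1\<bar> + \<bar>ln (cmod (f \<zeta>))\<bar>))"
      using int by (auto intro!: Bochner_Integration.integrable_add)
    \<comment> \<open>Zeros of \<open>f\<close> have to be excluded: there the logarithms of the
      dilates diverge, while \<open>ln 0 = 0\<close>.\<close>
    have AE': "AE \<zeta> in circle_measure. \<zeta> \<in> \<TT> \<and> f \<zeta> \<noteq> 0"
      using nz AE_space by eventually_elim (use q in \<open>auto simp: f_def\<close>)
    show "AE \<zeta> in circle_measure. (\<lambda>n. poisson z \<zeta> * ln (cmod (f (of_real (r n) * \<zeta>)))) \<longlonglongrightarrow> poisson z \<zeta> * ln (cmod (f \<zeta>))"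
      using AE' by eventually_elim (intro tendsto_intros flim, auto)
    show "AE \<zeta> in circle_measure. norm (poisson z \<zeta> * ln (cmod (f (of_real (r n) * \<zeta>))))
        \<le> B * (\<bar>ln M\<bar> + \<bar>ln c1\<bar> + \<bar>ln (cmod (f \<zeta>))\<bar>)" for n
      using AE'
    proof eventually_elim
      case (elim \<zeta>)
      let ?x = "cmod (f (of_real (r n) * \<zeta>))"
      have x: "?x > 0" "?x \<le> M" "c1 * cmod (f \<zeta>) \<le> ?x"
        using elim rin[of \<zeta> n] fnz M(2) lower[of \<zeta> n] by (auto simp: less_imp_le)
      have "ln ?x \<le> ln M" using x M(1) by (subst ln_le_cancel_iff) auto
      moreover have "ln (c1 * cmod (f \<zeta>)) \<le> ln ?x" using x c1 elim by (subst ln_le_cancel_iff) auto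
      then have "ln c1 + ln (cmod (f \<zeta>)) \<le> ln ?x" using c1 elim by (simp add: ln_mult)
      ultimately have "\<bar>ln ?x\<bar> \<le> \<bar>ln M\<bar> + \<bar>ln c1\<bar> + \<bar>ln (cmod (f \<zeta>))\<bar>" by linarith
      moreover have "\<bar>poisson z \<zeta>\<bar> \<le> B" using B elim by blast
      moreover have "0 \<le> B" using calculation(2) by linarith
      ultimately show ?case unfolding real_norm_def abs_mult by (intro mult_mono) auto
    qed
  qed
  moreover have "(\<lambda>n. ln (cmod (f (of_real (r n) * z)))) \<longlonglongrightarrow> ln (cmod (f z))"
    using fnz[OF z] z by (intro tendsto_intros flim) (auto simp: less_imp_le)
  ultimately show ?thesis unfolding step by (rule LIMSEQ_unique)
qed

text \<open>Both functions have the same Poisson integral as logarithm of their modulus, so their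
  quotient has modulus 1 throughout the disk and is constant by the maximum principle. Integrability
  of the logarithm and nonvanishing almost everywhere are inherited from \<open>a\<close>.\<close>

lemma outer_function_rational:
  fixes A q :: "complex poly"
  assumes out: "outer_function a"
    and A: "\<And>z. z \<in> \<DD> \<Longrightarrow> poly A z \<noteq> 0" and q: "\<And>z. z \<in> cball 0 1 \<Longrightarrow> poly q z \<noteq> 0"
    and eq: "AE \<zeta> in circle_measure. cmod (nt_extension a \<zeta>) = cmod (poly A \<zeta> / poly q \<zeta>)"
  shows "\<exists>c. cmod c = 1 \<and> (\<forall>z\<in>\<DD>. a z = c * (poly A z / poly q z))"
proof -
  define f where "f z = poly A z / poly q z" for z
  have cf: "continuous_on (cball 0 1) f" unfolding f_def using q by (intro continuous_intros) auto
  have holf: "f holomorphic_on \<DD>" unfolding f_def by (intro holomorphic_intros) (use q in auto)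
  have hola: "a holomorphic_on \<DD>" using out by (simp add: outer_function_def)
  have fnz: "f w \<noteq> 0" if "w \<in> \<DD>" for w using A[OF that] q[of w] that by (simp add: f_def)
  have "continuous_on \<TT> (\<lambda>\<zeta>. cmod (f \<zeta>))"
    by (intro continuous_on_norm continuous_on_subset[OF cf]) auto
  note [measurable] = borel_measurable_circle_continuous[OF this]
  have int0: "integrable circle_measure (\<lambda>\<zeta>. ln (cmod (nt_extension a \<zeta>)))"
    using out by (simp add: outer_function_def)
  note [measurable] = borel_measurable_integrable[OF int0]
  have lneq: "AE \<zeta> in circle_measure. ln (cmod (nt_extension a \<zeta>)) = ln (cmod (f \<zeta>))"
    using eq by eventually_elim (simp add: f_def)
  have int: "integrable circle_measure (\<lambda>\<zeta>. ln (cmod (f \<zeta>)))"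
    by (rule integrable_cong_AE_imp[OF int0]) (use lneq in auto)
  have nz: "AE \<zeta> in circle_measure. poly A \<zeta> \<noteq> 0"
  proof -
    have "AE \<zeta> in circle_measure. \<exists>L. has_nt_limit a \<zeta> L \<and> L \<noteq> 0"
      using out by (simp add: outer_function_def)
    then show ?thesis using eq AE_space
      by eventually_elim (auto simp: nt_extension_eq)
  qed
  have norm_eq: "cmod (a z) = cmod (f z)" if z: "z \<in> \<DD>" for z
  proof -
    note [measurable] = borel_measurable_circle_continuous[OF continuous_on_poisson[OF z]]
    have "(\<integral>\<zeta>. poisson z \<zeta> * ln (cmod (nt_extension a \<zeta>)) \<partial>circle_measure) =
        (\<integral>\<zeta>. poisson z \<zeta> * ln (cmod (f \<zeta>)) \<partial>circle_measure)"
      by (rule integral_cong_AE) (use lneq in auto)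
    also have "\<dots> = ln (cmod (f z))"
      using ln_rational_poisson[OF A q _ nz z] int by (simp add: f_def)
    finally show ?thesis using norm_outer_function[OF out z] fnz[OF z] by simp
  qed
  have "(\<lambda>z. a z / f z) constant_on \<DD>"
  proof (rule maximum_modulus_principle[where U=\<DD> and \<xi>=0])
    show "(\<lambda>z. a z / f z) holomorphic_on \<DD>" using hola holf fnz by (intro holomorphic_intros) auto
    show "norm (a z / f z) \<le> norm (a 0 / f 0)" if "z \<in> \<DD>" for z
      using norm_eq[OF that] norm_eq[of 0] fnz[OF that] fnz[of 0] by (simp add: norm_divide)
  qed auto
  then obtain c where c: "\<And>z. z \<in> \<DD> \<Longrightarrow> a z / f z = c" by (auto simp: constant_on_def)
  have "cmod c = 1" using c[of 0] norm_eq[of 0] fnz[of 0] by (auto simp: norm_divide)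
  moreover have "a z = c * f z" if "z \<in> \<DD>" for z using c[OF that] fnz[OF that] by auto
  ultimately show ?thesis unfolding f_def by blast
qed

subsection \<open>Cauchy kernels and the Hardy space\<close>

lemma circle_cauchy_schwarz:
  fixes f g :: "complex \<Rightarrow> complex"
  assumes f: "continuous_on \<TT> f" and g: "continuous_on \<TT> g"
  shows "(cmod (\<integral>\<zeta>. f \<zeta> * cnj (g \<zeta>) \<partial>circle_measure))\<^sup>2 \<le>
    (\<integral>\<zeta>. (cmod (f \<zeta>))\<^sup>2 \<partial>circle_measure) * (\<integral>\<zeta>. (cmod (g \<zeta>))\<^sup>2 \<partial>circle_measure)"
proof -
  define X where "X = (\<integral>\<zeta>. cmod (f \<zeta>) * cmod (g \<zeta>) \<partial>circle_measure)"
  define A where "A = (\<integral>\<zeta>. (cmod (f \<zeta>))\<^sup>2 \<partial>circle_measure)"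
  define B where "B = (\<integral>\<zeta>. (cmod (g \<zeta>))\<^sup>2 \<partial>circle_measure)"
  have i: "integrable circle_measure (\<lambda>\<zeta>. cmod (f \<zeta>) * cmod (g \<zeta>))"
    "integrable circle_measure (\<lambda>\<zeta>. (cmod (f \<zeta>))\<^sup>2)" "integrable circle_measure (\<lambda>\<zeta>. (cmod (g \<zeta>))\<^sup>2)"
    by (intro integrable_circle_continuous continuous_intros f g)+
  have quad: "0 \<le> t\<^sup>2 * A - 2 * t * X + B" for t
  proof -
    have "0 \<le> (\<integral>\<zeta>. (t * cmod (f \<zeta>) - cmod (g \<zeta>))\<^sup>2 \<partial>circle_measure)" by simp
    also have "\<dots> = (\<integral>\<zeta>. t\<^sup>2 * (cmod (f \<zeta>))\<^sup>2 - 2 * t * (cmod (f \<zeta>) * cmod (g \<zeta>)) + (cmod (g \<zeta>))\<^sup>2 \<partial>circle_measure)"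
      by (simp add: power2_diff power_mult_distrib algebra_simps)
    also have "\<dots> = t\<^sup>2 * A - 2 * t * X + B"
      unfolding A_def B_def X_def using i by simp
    finally show ?thesis .
  qed
  have A0: "A \<ge> 0" by (simp add: A_def)
  have "X\<^sup>2 \<le> A * B"
  proof (cases "A = 0")
    case True
    have "X = 0"
    proof (rule ccontr)
      assume "X \<noteq> 0"
      \<comment> \<open>With \<open>A = 0\<close> the quadratic is linear in \<open>t\<close>, and
        this \<open>t\<close> gives it the value -1.\<close>
      then show False using quad[of "(B + 1) / (2 * X)"] True by simp
    qed
    then show ?thesis using True by simp
  next
    case False
    then show ?thesis using quad[of "X / A"] A0 by (simp add: field_simps power2_eq_square)
  qed
  moreover have "cmod (\<integral>\<zeta>. f \<zeta> * cnj (g \<zeta>) \<partial>circle_measure) \<le> X"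
    unfolding X_def using integral_norm_bound[of circle_measure "\<lambda>\<zeta>. f \<zeta> * cnj (g \<zeta>)"] by (simp add: norm_mult)
  then have "(cmod (\<integral>\<zeta>. f \<zeta> * cnj (g \<zeta>) \<partial>circle_measure))\<^sup>2 \<le> X\<^sup>2" by (intro power_mono) auto
  ultimately show ?thesis by (simp add: A_def B_def)
qed

text \<open>Combinations of the kernels of H^2, the concrete counterpart of \<open>comb\<close> for
  \<open>b = 0\<close>.\<close>

definition cauchy_comb :: "(complex \<times> complex) list \<Rightarrow> complex \<Rightarrow> complex"
  where "cauchy_comb l z = (\<Sum>(c, w)\<leftarrow>l. c / (1 - cnj w * z))"

definition cauchy_energy :: "(complex \<times> complex) list \<Rightarrow> real"
  where "cauchy_energy l = (\<integral>\<zeta>. (cmod (cauchy_comb l \<zeta>))\<^sup>2 \<partial>circle_measure)"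

text \<open>The adjoint of multiplication by \<open>f\<close>, acting on combinations of kernels.\<close>

definition adjoint_list :: "(complex \<Rightarrow> complex) \<Rightarrow> (complex \<times> complex) list \<Rightarrow> (complex \<times> complex) list"
  where "adjoint_list f l = map (\<lambda>(c, w). (c * cnj (f w), w)) l"

lemma snd_adjoint_list [simp]: "snd ` set (adjoint_list f l) = snd ` set l"
  by (force simp: adjoint_list_def image_iff)

text \<open>The adjoint relation <u, T_f* k> = <f u, k>, expressed by point evaluations so that only
  values at the nodes enter.\<close>

lemma sum_adjoint_list:
  "(\<Sum>(c, w)\<leftarrow>adjoint_list f l. cnj c * u w) = (\<Sum>(c, w)\<leftarrow>l. cnj c * (f w * u w))"
  by (induction l) (auto simp: adjoint_list_def mult.assoc)

lemma cauchy_comb_Nil [simp]: "cauchy_comb [] z = 0"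
  and cauchy_comb_Cons [simp]: "cauchy_comb ((c, w) # l) z = c / (1 - cnj w * z) + cauchy_comb l z"
  by (simp_all add: cauchy_comb_def)

lemma cauchy_denominator_nonzero: "w \<in> \<DD> \<Longrightarrow> z \<in> cball 0 1 \<Longrightarrow> 1 - cnj w * z \<noteq> 0"
proof
  assume w: "w \<in> \<DD>" and z: "z \<in> cball 0 1" and "1 - cnj w * z = 0"
  then have "cmod (cnj w * z) = 1" by (metis eq_iff_diff_eq_0 norm_one)
  then have "cmod w * cmod z = 1" by (simp add: norm_mult)
  moreover have "cmod w * cmod z \<le> cmod w * 1" using z by (intro mult_left_mono) auto
  ultimately show False using w by simp
qed

text \<open>The poles \<open>1 / cnj w\<close> lie outside the closed disk, and there are finitely
  many. Circle integrals of these functions therefore fall under Cauchy's formula directly.\<close>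

lemma holomorphic_cauchy_comb:
  assumes "snd ` set l \<subseteq> \<DD>"
  obtains R where "R > 1" "cauchy_comb l holomorphic_on ball 0 R"
proof -
  have "\<exists>R>1. cauchy_comb l holomorphic_on ball 0 R"
    using assms
  proof (induction l)
    case Nil
    then show ?case by (intro exI[of _ 2]) (auto simp: cauchy_comb_def[abs_def])
  next
    case (Cons p l)
    obtain c w where p: "p = (c, w)" by force
    then obtain R where R: "R > 1" "cauchy_comb l holomorphic_on ball 0 R" using Cons by auto
    have w: "cmod w < 1" using Cons.prems p by simp
    define S where "S = (if w = 0 then R else min R (1 / cmod w))"
    have S: "S > 1" using R w by (auto simp: S_def)
    have nz: "1 - cnj w * z \<noteq> 0" if "z \<in> ball 0 S" for z
    proof
      assume "1 - cnj w * z = 0"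
      then have "cmod (cnj w * z) = 1" by (metis eq_iff_diff_eq_0 norm_one)
      then show False using that by (auto simp: norm_mult S_def field_simps split: if_splits)
    qed
    have "(\<lambda>z. c / (1 - cnj w * z) + cauchy_comb l z) holomorphic_on ball 0 S"
      by (intro holomorphic_intros holomorphic_on_subset[OF R(2)]) (use nz in \<open>auto simp: S_def\<close>)
    then show ?case using S by (auto simp: p cauchy_comb_Cons[abs_def])
  qed
  then show thesis using that by blast
qed

lemma continuous_cauchy_comb:
  assumes "snd ` set l \<subseteq> \<DD>" shows "continuous_on (cball 0 1) (cauchy_comb l)"
proof -
  obtain R where R: "R > 1" "cauchy_comb l holomorphic_on ball 0 R" using holomorphic_cauchy_comb[OF assms] .
  show ?thesis
    using holomorphic_on_imp_continuous_on[OF R(2)] by (rule continuous_on_subset) (use R in auto)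
qed

lemma continuous_circle_cauchy_comb:
  "snd ` set l \<subseteq> \<DD> \<Longrightarrow> continuous_on \<TT> (cauchy_comb l)"
  by (rule continuous_on_subset[OF continuous_cauchy_comb]) auto

lemma integral_cnj_cauchy_comb:
  assumes u: "u holomorphic_on ball 0 R" and R: "R > 1" and l: "snd ` set l \<subseteq> \<DD>"
  shows "(\<integral>\<zeta>. u \<zeta> * cnj (cauchy_comb l \<zeta>) \<partial>circle_measure) = (\<Sum>(c, w)\<leftarrow>l. cnj c * u w)"
  using l
proof (induction l)
  case Nil
  then show ?case by simp
next
  case (Cons p l)
  obtain c w where p: "p = (c, w)" by force
  have w: "w \<in> \<DD>" and l: "snd ` set l \<subseteq> \<DD>" using Cons.prems p by auto
  have cu: "continuous_on \<TT> u"
    using holomorphic_on_imp_continuous_on[OF u] by (rule continuous_on_subset) (use R in auto)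
  have nz: "1 - w * cnj \<zeta> \<noteq> 0" if "\<zeta> \<in> \<TT>" for \<zeta>
    using cauchy_denominator_nonzero[OF w, of \<zeta>] that
    by (metis complex_cnj_cnj complex_cnj_diff complex_cnj_mult complex_cnj_one complex_cnj_zero dist_0_norm mem_cball mem_sphere order_refl)
  have i1: "integrable circle_measure (\<lambda>\<zeta>. u \<zeta> / (1 - w * cnj \<zeta>))"
    by (intro integrable_circle_continuous continuous_intros cu) (use nz in auto)
  have i2: "integrable circle_measure (\<lambda>\<zeta>. u \<zeta> * cnj (cauchy_comb l \<zeta>))"
    by (intro integrable_circle_continuous continuous_intros cu continuous_circle_cauchy_comb l)
  have "(\<integral>\<zeta>. u \<zeta> * cnj (cauchy_comb (p # l) \<zeta>) \<partial>circle_measure)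
      = (\<integral>\<zeta>. cnj c * (u \<zeta> / (1 - w * cnj \<zeta>)) + u \<zeta> * cnj (cauchy_comb l \<zeta>) \<partial>circle_measure)"
    by (simp add: p algebra_simps)
  also have "\<dots> = cnj c * u w + (\<Sum>(c, w)\<leftarrow>l. cnj c * u w)"
    using Cons.IH[OF l] circle_cauchy[OF u R w]
    by (subst Bochner_Integration.integral_add[OF integrable_mult_right[OF i1] i2]) (simp del: times_divide_eq_right)
  finally show ?case by (simp add: p)
qed

text \<open>The reproducing property applied to the combination itself. It expresses a circle
  integral by values at the nodes, the only form in which H(b) can be compared with it.\<close>

lemma cauchy_energy_eq:
  assumes l: "snd ` set l \<subseteq> \<DD>"
  shows "(\<Sum>(c, w)\<leftarrow>l. cnj c * cauchy_comb l w) = of_real (cauchy_energy l)"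
proof -
  obtain R where R: "R > 1" "cauchy_comb l holomorphic_on ball 0 R" using holomorphic_cauchy_comb[OF l] .
  have "(\<Sum>(c, w)\<leftarrow>l. cnj c * cauchy_comb l w) = (\<integral>\<zeta>. cauchy_comb l \<zeta> * cnj (cauchy_comb l \<zeta>) \<partial>circle_measure)"
    by (rule integral_cnj_cauchy_comb[OF R(2,1) l, symmetric])
  also have "\<dots> = (\<integral>\<zeta>. complex_of_real ((cmod (cauchy_comb l \<zeta>))\<^sup>2) \<partial>circle_measure)"
    by (simp only: complex_norm_square)
  finally show ?thesis by (simp add: cauchy_energy_def del: of_real_power)
qed

lemma cauchy_energy_nonneg [simp]: "cauchy_energy l \<ge> 0"
  by (simp add: cauchy_energy_def)

lemma cauchy_pairing_bound:
  assumes u: "u holomorphic_on ball 0 R" and R: "R > 1" and l: "snd ` set l \<subseteq> \<DD>"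
  shows "(cmod (\<Sum>(c, w)\<leftarrow>l. cnj c * u w))\<^sup>2 \<le> (\<integral>\<zeta>. (cmod (u \<zeta>))\<^sup>2 \<partial>circle_measure) * cauchy_energy l"
proof -
  have cu: "continuous_on \<TT> u"
    using holomorphic_on_imp_continuous_on[OF u] by (rule continuous_on_subset) (use R in auto)
  show ?thesis
    using circle_cauchy_schwarz[OF cu continuous_circle_cauchy_comb[OF l]]
    unfolding integral_cnj_cauchy_comb[OF u R l] cauchy_energy_def .
qed

text \<open>T_f* k is the projection of \<open>cnj f * k\<close> onto H^2. Without projections: the
  energy equals <T_f* k, cnj f k>, and Cauchy-Schwarz followed by cancelling one factor gives the
  bound.\<close>

lemma cauchy_energy_adjoint:
  assumes f: "f holomorphic_on ball 0 R" and R: "R > 1" and l: "snd ` set l \<subseteq> \<DD>"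
  shows "cauchy_energy (adjoint_list f l) \<le> (\<integral>\<zeta>. (cmod (f \<zeta>))\<^sup>2 * (cmod (cauchy_comb l \<zeta>))\<^sup>2 \<partial>circle_measure)"
proof -
  let ?u = "cauchy_comb (adjoint_list f l)" and ?E = "cauchy_energy (adjoint_list f l)"
  have la: "snd ` set (adjoint_list f l) \<subseteq> \<DD>" using l by simp
  obtain R' where R': "R' > 1" "?u holomorphic_on ball 0 R'" using holomorphic_cauchy_comb[OF la] .
  have h: "(\<lambda>z. f z * ?u z) holomorphic_on ball 0 (min R R')"
    by (intro holomorphic_intros holomorphic_on_subset[OF f] holomorphic_on_subset[OF R'(2)]) auto
  have cf: "continuous_on \<TT> f"
    using holomorphic_on_imp_continuous_on[OF f] by (rule continuous_on_subset) (use R in auto)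
  have "complex_of_real ?E = (\<Sum>(c, w)\<leftarrow>l. cnj c * (f w * ?u w))"
    unfolding cauchy_energy_eq[OF la, symmetric] by (rule sum_adjoint_list)
  also have "\<dots> = (\<integral>\<zeta>. ?u \<zeta> * cnj (cnj (f \<zeta>) * cauchy_comb l \<zeta>) \<partial>circle_measure)"
    using integral_cnj_cauchy_comb[OF h _ l] R R' by (simp add: mult_ac)
  finally have "(cmod (complex_of_real ?E))\<^sup>2 \<le> ?E * (\<integral>\<zeta>. (cmod (cnj (f \<zeta>) * cauchy_comb l \<zeta>))\<^sup>2 \<partial>circle_measure)"
    using circle_cauchy_schwarz[OF continuous_circle_cauchy_comb[OF la], of "\<lambda>\<zeta>. cnj (f \<zeta>) * cauchy_comb l \<zeta>"]
      continuous_circle_cauchy_comb[OF l] cf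
    by (simp add: cauchy_energy_def[symmetric] continuous_intros)
  then have "?E * ?E \<le> ?E * (\<integral>\<zeta>. (cmod (f \<zeta>))\<^sup>2 * (cmod (cauchy_comb l \<zeta>))\<^sup>2 \<partial>circle_measure)"
    by (simp add: norm_mult power_mult_distrib) (simp add: power2_eq_square)
  moreover have "0 \<le> (\<integral>\<zeta>. (cmod (f \<zeta>))\<^sup>2 * (cmod (cauchy_comb l \<zeta>))\<^sup>2 \<partial>circle_measure)" by simp
  ultimately show ?thesis
    using cauchy_energy_nonneg[of "adjoint_list f l"] by (cases "?E = 0") (auto simp: mult_le_cancel_left)
qed

text \<open>With \<open>f\<close> and \<open>g\<close> the rational forms of \<open>b\<close> and
  \<open>a\<close>, this says that ||T_a* k||^2 is at most ||k||^2 - ||T_b* k||^2, which is the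
  squared norm of a kernel combination in H(b).\<close>

lemma cauchy_energy_pythagorean:
  assumes f: "f holomorphic_on ball 0 R" and g: "g holomorphic_on ball 0 R" and R: "R > 1"
    and l: "snd ` set l \<subseteq> \<DD>"
    and pyth: "\<And>\<zeta>. \<zeta> \<in> \<TT> \<Longrightarrow> (cmod (f \<zeta>))\<^sup>2 + (cmod (g \<zeta>))\<^sup>2 = 1"
  shows "cauchy_energy (adjoint_list f l) + cauchy_energy (adjoint_list g l) \<le> cauchy_energy l"
proof -
  have c: "continuous_on \<TT> f" "continuous_on \<TT> g"
    using holomorphic_on_imp_continuous_on[OF f] holomorphic_on_imp_continuous_on[OF g] R
    by (auto elim!: continuous_on_subset)
  note cl = continuous_circle_cauchy_comb[OF l]
  have "(\<integral>\<zeta>. (cmod (f \<zeta>))\<^sup>2 * (cmod (cauchy_comb l \<zeta>))\<^sup>2 \<partial>circle_measure) +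
      (\<integral>\<zeta>. (cmod (g \<zeta>))\<^sup>2 * (cmod (cauchy_comb l \<zeta>))\<^sup>2 \<partial>circle_measure) =
      (\<integral>\<zeta>. (cmod (f \<zeta>))\<^sup>2 * (cmod (cauchy_comb l \<zeta>))\<^sup>2 + (cmod (g \<zeta>))\<^sup>2 * (cmod (cauchy_comb l \<zeta>))\<^sup>2 \<partial>circle_measure)"
    by (intro Bochner_Integration.integral_add[symmetric] integrable_circle_continuous continuous_intros c cl)
  also have "\<dots> = cauchy_energy l"
    unfolding cauchy_energy_def
    by (intro Bochner_Integration.integral_cong) (simp_all add: distrib_right[symmetric] pyth)
  finally show ?thesis
    using cauchy_energy_adjoint[OF f R l] cauchy_energy_adjoint[OF g R l] by linarith
qed

lemma cauchy_energy_single: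
  assumes z: "z \<in> \<DD>"
  shows "cauchy_energy [(1, z)] = 1 / (1 - (cmod z)\<^sup>2)"
proof -
  have "complex_of_real (cauchy_energy [(1, z)]) = 1 / (1 - cnj z * z)"
    using cauchy_energy_eq[of "[(1, z)]"] z by simp
  also have "\<dots> = complex_of_real (1 / (1 - (cmod z)\<^sup>2))"
    by (simp add: complex_norm_square mult.commute del: of_real_power)
  finally show ?thesis by (simp only: of_real_eq_iff)
qed

lemma cauchy_comb_point_bound:
  assumes l: "snd ` set l \<subseteq> \<DD>" and z: "z \<in> \<DD>"
  shows "cmod (cauchy_comb l z) \<le> sqrt (cauchy_energy l) / sqrt (1 - (cmod z)\<^sup>2)"
proof -
  obtain R where R: "R > 1" "cauchy_comb l holomorphic_on ball 0 R" using holomorphic_cauchy_comb[OF l] .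
  have s: "snd ` set [(1, z)] \<subseteq> \<DD>" using z by simp
  have "(cmod (cauchy_comb l z))\<^sup>2 \<le> cauchy_energy l / (1 - (cmod z)\<^sup>2)"
    using cauchy_pairing_bound[OF R(2,1) s]
    unfolding cauchy_energy_single[OF z] cauchy_energy_def[of l, symmetric] by simp
  then show ?thesis using real_le_rsqrt by (simp add: real_sqrt_divide[symmetric])
qed

section \<open>Integral means and the pairing of Hardy functions with Cauchy kernels\<close>

lemma mean2_nonneg: "mean2 f r \<ge> 0"
  by (simp add: mean2_def)

text \<open>With \<open>M\<close> the supremum of the square root of \<open>mean2\<close> over the radii below 1, Cauchy--Schwarz applied to
  \<open>mean2 u r = \<langle>u(r\<^sup>2 \<cdot>), u\<rangle>\<close> gives \<open>M\<^sup>2 \<le> M \<cdot> \<parallel>u\<parallel>\<close>.\<close>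

lemma mean2_cauchy_comb:
  assumes l: "snd ` set l \<subseteq> \<DD>" and r: "0 \<le> r" "r < 1"
  shows "mean2 (cauchy_comb l) r \<le> cauchy_energy l"
proof -
  define \<phi> where "\<phi> r = mean2 (cauchy_comb l) r" for r
  have step: "(\<phi> r)\<^sup>2 \<le> \<phi> (r\<^sup>2) * cauchy_energy l" if r: "0 \<le> r" "r < 1" for r
  proof -
    \<comment> \<open>The Cauchy kernel depends on \<open>cnj w * z\<close> only, so dilating the
      variable is the same as moving the nodes towards 0.\<close>
    define l' where "l' = map (\<lambda>(c, w). (c, of_real r * w)) l"
    have l': "snd ` set l' \<subseteq> \<DD>"
    proof -
      have "r * cmod w < 1" if "cmod w < 1" for w :: complex
        using mult_strict_mono'[of r 1 "cmod w" 1] r that by simp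
      moreover have "cmod w < 1" if "(c, w) \<in> set l" for c w using l that by force
      ultimately show ?thesis using r by (auto simp: l'_def norm_mult)
    qed
    have dil: "cauchy_comb l' z = cauchy_comb l (of_real r * z)" for z
      unfolding cauchy_comb_def l'_def by (induction l) (auto simp: mult_ac)
    have \<phi>: "\<phi> r = cauchy_energy l'" by (simp add: \<phi>_def mean2_def cauchy_energy_def dil)
    obtain R where R: "R > 1" "cauchy_comb l holomorphic_on ball 0 R" using holomorphic_cauchy_comb[OF l] .
    have hol: "(\<lambda>z. cauchy_comb l (of_real (r\<^sup>2) * z)) holomorphic_on ball 0 R"
    proof -
      have "r\<^sup>2 * cmod z < R" if "cmod z < R" for z
      proof -
        have "r\<^sup>2 * cmod z \<le> 1 * cmod z" using r by (intro mult_right_mono) (auto simp: power_le_one)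
        then show ?thesis using that by simp
      qed
      then show ?thesis
        using holomorphic_on_compose_gen[of "\<lambda>z. of_real (r\<^sup>2) * z" "ball 0 R" "cauchy_comb l" "ball 0 R"] R(2)
        by (force simp: o_def norm_mult norm_power intro!: holomorphic_intros)
    qed
    have "complex_of_real (\<phi> r) = (\<Sum>(c, w)\<leftarrow>l. cnj c * cauchy_comb l (of_real (r\<^sup>2) * w))"
      unfolding \<phi> cauchy_energy_eq[OF l', symmetric]
      unfolding dil unfolding l'_def map_map
      by (intro arg_cong[of _ _ sum_list] map_cong) (auto simp: power2_eq_square mult_ac)
    then have "(cmod (complex_of_real (\<phi> r)))\<^sup>2 \<le> \<phi> (r\<^sup>2) * cauchy_energy l"
      using cauchy_pairing_bound[OF hol R(1) l] by (simp add: \<phi>_def mean2_def)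
    then show ?thesis by simp
  qed
  \<comment> \<open>A crude bound whose sole purpose is to make the supremum finite, so that it can
    be cancelled below.\<close>
  have "bounded (cauchy_comb l ` cball 0 1)"
    by (intro compact_imp_bounded compact_continuous_image continuous_cauchy_comb l) auto
  then obtain B where B: "\<And>z. z \<in> cball 0 1 \<Longrightarrow> cmod (cauchy_comb l z) \<le> B" by (force simp: bounded_iff)
  have bdd: "\<phi> r \<le> B\<^sup>2" if r: "0 \<le> r" "r < 1" for r
  proof -
    have "\<phi> r \<le> (\<integral>\<zeta>. B\<^sup>2 \<partial>circle_measure)"
      unfolding \<phi>_def mean2_def
    proof (rule integral_mono)
      have "continuous_on \<TT> (\<lambda>\<zeta>. cauchy_comb l (of_real r * \<zeta>))"
        by (rule continuous_on_compose2[OF continuous_cauchy_comb[OF l]])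
          (use r in \<open>auto intro!: continuous_intros simp: norm_mult\<close>)
      then show "integrable circle_measure (\<lambda>\<zeta>. (cmod (cauchy_comb l (of_real r * \<zeta>)))\<^sup>2)"
        by (intro integrable_circle_continuous continuous_intros)
      show "(cmod (cauchy_comb l (of_real r * \<zeta>)))\<^sup>2 \<le> B\<^sup>2" if "\<zeta> \<in> space circle_measure" for \<zeta>
        using B[of "of_real r * \<zeta>"] that r by (intro power_mono) (auto simp: norm_mult)
    qed auto
    then show ?thesis using circle.prob_space by simp
  qed
  \<comment> \<open>Here \<open>M\<close> is the supremum of \<open>mean2\<close> without the root,
    so the inequality to be cancelled reads \<open>M * M \<le> M * cauchy_energy l\<close>.\<close>
  define M where "M = (SUP r\<in>{0..<1}. \<phi> r)"
  have bA: "bdd_above (\<phi> ` {0..<1})" using bdd by (auto intro!: bdd_aboveI2)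
  have le: "\<phi> r \<le> M" if "0 \<le> r" "r < 1" for r
    unfolding M_def by (rule cSUP_upper[OF _ bA]) (use that in auto)
  have M0: "M \<ge> 0" using le[of 0] mean2_nonneg[of "cauchy_comb l" 0] by (simp add: \<phi>_def)
  have "\<phi> r \<le> sqrt (M * cauchy_energy l)" if r: "0 \<le> r" "r < 1" for r
  proof (rule real_le_rsqrt)
    have "r\<^sup>2 < 1" using r by (simp add: abs_square_less_1)
    then have "\<phi> (r\<^sup>2) * cauchy_energy l \<le> M * cauchy_energy l" by (intro mult_right_mono le) auto
    then show "(\<phi> r)\<^sup>2 \<le> M * cauchy_energy l" using step[OF r] by linarith
  qed
  then have "M \<le> sqrt (M * cauchy_energy l)" unfolding M_def by (intro cSUP_least) auto
  then have "M\<^sup>2 \<le> (sqrt (M * cauchy_energy l))\<^sup>2" using M0 by (intro power_mono)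
  then have "M * M \<le> M * cauchy_energy l" using M0 by (simp add: power2_eq_square)
  then have "M \<le> cauchy_energy l" using M0 by (cases "M = 0") auto
  then show ?thesis using le[OF r] by (simp add: \<phi>_def)
qed

lemma Hardy2_norm_nonneg: "h \<in> Hardy2 \<Longrightarrow> Hardy2_norm h \<ge> 0"
  and mean2_le_Hardy2_norm: "h \<in> Hardy2 \<Longrightarrow> 0 \<le> r \<Longrightarrow> r < 1 \<Longrightarrow> mean2 h r \<le> (Hardy2_norm h)\<^sup>2"
proof -
  assume h: "h \<in> Hardy2"
  have le: "mean2 h r \<le> (SUP r\<in>{0..<1}. mean2 h r)" if "0 \<le> r" "r < 1" for r
    by (rule cSUP_upper) (use that h in \<open>auto simp: Hardy2_def\<close>)
  have nn: "0 \<le> (SUP r\<in>{0..<1}. mean2 h r)" using le[of 0] mean2_nonneg[of h 0] by linarith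
  then show "Hardy2_norm h \<ge> 0" by (simp add: Hardy2_norm_def)
  show "mean2 h r \<le> (Hardy2_norm h)\<^sup>2" if "0 \<le> r" "r < 1"
    using le[OF that] nn by (simp add: Hardy2_norm_def)
qed

text \<open>The dilate \<open>h (r * z)\<close> is holomorphic across the circle and its circle
  integral is \<open>mean2 h r\<close>, so the Cauchy pairing bound applies to it; continuity at the
  nodes allows \<open>r\<close> to tend to 1.\<close>

lemma Hardy2_pairing_bound:
  assumes h: "h \<in> Hardy2" and l: "snd ` set l \<subseteq> \<DD>"
  shows "cmod (\<Sum>(c, w)\<leftarrow>l. cnj c * h w) \<le> Hardy2_norm h * sqrt (cauchy_energy l)"
proof -
  have hol: "h holomorphic_on \<DD>" using h by (simp add: Hardy2_def)
  obtain r :: "nat \<Rightarrow> real" where r: "\<And>n. 0 < r n" "\<And>n. r n < 1"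
    and zlim: "\<And>z :: complex. (\<lambda>n. of_real (r n) * z) \<longlonglongrightarrow> z"
    using radial_sequence by metis
  have bound: "cmod (\<Sum>(c, w)\<leftarrow>l. cnj c * h (of_real (r n) * w)) \<le> Hardy2_norm h * sqrt (cauchy_energy l)" for n
  proof (rule power2_le_imp_le)
    have "1 / r n > 1" using r[of n] by simp
    moreover have "(\<lambda>w. h (of_real (r n) * w)) holomorphic_on ball 0 (1 / r n)"
    proof -
      have "of_real (r n) * w \<in> \<DD>" if "w \<in> ball 0 (1 / r n)" for w
        using that r[of n] by (simp add: norm_mult field_simps)
      then show ?thesis
        using holomorphic_on_compose_gen[of "\<lambda>w. of_real (r n) * w" "ball 0 (1 / r n)" h \<DD>] hol
        by (simp add: o_def image_subset_iff holomorphic_intros)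
    qed
    ultimately have "(cmod (\<Sum>(c, w)\<leftarrow>l. cnj c * h (of_real (r n) * w)))\<^sup>2 \<le> mean2 h (r n) * cauchy_energy l"
      using cauchy_pairing_bound[OF _ _ l, of "\<lambda>w. h (of_real (r n) * w)" "1 / r n"] by (simp add: mean2_def)
    also have "\<dots> \<le> (Hardy2_norm h)\<^sup>2 * cauchy_energy l"
      using mean2_le_Hardy2_norm[OF h, of "r n"] r[of n] by (intro mult_right_mono) auto
    finally show "(cmod (\<Sum>(c, w)\<leftarrow>l. cnj c * h (of_real (r n) * w)))\<^sup>2 \<le> (Hardy2_norm h * sqrt (cauchy_energy l))\<^sup>2"
      by (simp add: power_mult_distrib)
  qed (simp add: Hardy2_norm_nonneg[OF h])
  have "(\<lambda>n. \<Sum>(c, w)\<leftarrow>l. cnj c * h (of_real (r n) * w)) \<longlonglongrightarrow> (\<Sum>(c, w)\<leftarrow>l. cnj c * h w)"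
    using l
  proof (induction l)
    case (Cons p l)
    obtain c w where p: "p = (c, w)" by force
    have w: "w \<in> \<DD>" using Cons.prems p by simp
    have "isCont h w"
      using holomorphic_on_imp_continuous_on[OF hol] w by (simp add: continuous_on_eq_continuous_at)
    then have "(\<lambda>n. h (of_real (r n) * w)) \<longlonglongrightarrow> h w" using zlim by (rule isCont_tendsto_compose)
    then show ?case using Cons by (auto simp: p intro!: tendsto_intros)
  qed simp
  from tendsto_norm[OF this] show ?thesis
    by (rule tendsto_upperbound) (use bound in auto)
qed

lemma Hardy2_point_bound:
  assumes h: "h \<in> Hardy2" and z: "z \<in> \<DD>"
  shows "cmod (h z) \<le> Hardy2_norm h / sqrt (1 - (cmod z)\<^sup>2)"
proof -
  have s: "snd ` set [(1, z)] \<subseteq> \<DD>" using z by simp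
  show ?thesis using Hardy2_pairing_bound[OF h s] cauchy_energy_single[OF z] by (simp add: real_sqrt_divide)
qed

subsection \<open>The structure of \<open>\<H>(b)\<close> for rational \<open>b\<close>\<close>

lemma cauchy_comb_append: "cauchy_comb (l @ l') z = cauchy_comb l z + cauchy_comb l' z"
  by (simp add: cauchy_comb_def)

text \<open>Both functions share the denominator \<open>q\<close>, and the relation between them is
  stated for polynomials on the circle, so that reflection can be applied to it.\<close>

locale rational_dBR = rkhs "\<DD>" "dBR_kernel b" H ip
  for b :: "complex \<Rightarrow> complex" and H ip +
  fixes a :: "complex \<Rightarrow> complex" and p q A :: "complex poly"
  assumes q_nz: "\<And>z. z \<in> cball 0 1 \<Longrightarrow> poly q z \<noteq> 0"
    and b_eq: "\<And>z. z \<in> \<DD> \<Longrightarrow> b z = poly p z / poly q z"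
    and a_eq: "\<And>z. z \<in> \<DD> \<Longrightarrow> a z = poly A z / poly q z"
    and pyth: "\<And>\<zeta>. \<zeta> \<in> \<TT> \<Longrightarrow> (cmod (poly q \<zeta>))\<^sup>2 = (cmod (poly p \<zeta>))\<^sup>2 + (cmod (poly A \<zeta>))\<^sup>2"
begin

lemma adjoint_list_cong:
  "(\<And>z. z \<in> \<DD> \<Longrightarrow> f z = g z) \<Longrightarrow> snd ` set l \<subseteq> \<DD> \<Longrightarrow> adjoint_list f l = adjoint_list g l"
  unfolding adjoint_list_def by (intro map_cong) auto

lemma kfun_eq: "z \<in> \<DD> \<Longrightarrow> kfun w z = (1 - cnj (b w) * b z) / (1 - cnj w * z)"
  unfolding kfun_def dBR_kernel_def by simp

lemma comb_eq:
  assumes "snd ` set l \<subseteq> \<DD>" and z: "z \<in> \<DD>"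
  shows "comb l z = cauchy_comb l z - b z * cauchy_comb (adjoint_list b l) z"
  using assms(1)
proof (induction l)
  case (Cons x l)
  then show ?case
    using z by (cases x) (auto simp: comb_Cons kfun_eq adjoint_list_def diff_divide_distrib algebra_simps)
qed (simp add: comb_Nil adjoint_list_def)

lemma nrm_comb_sq:
  assumes l: "snd ` set l \<subseteq> \<DD>"
  shows "(nrm (comb l))\<^sup>2 = cauchy_energy l - cauchy_energy (adjoint_list b l)"
proof -
  have la: "snd ` set (adjoint_list b l) \<subseteq> \<DD>" using l by simp
  have "complex_of_real ((nrm (comb l))\<^sup>2) = pairing (comb l) l"
    using ip_self[OF comb_mem[OF l]] ip_comb[OF comb_mem[OF l] l] by simp
  then have "complex_of_real ((nrm (comb l))\<^sup>2) = cnj (pairing (comb l) l)"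
    by (metis complex_cnj_complex_of_real)
  also have "\<dots> = (\<Sum>(c, w)\<leftarrow>l. cnj c * comb l w)"
  proof -
    have "cnj (pairing f l) = (\<Sum>(c, w)\<leftarrow>l. cnj c * f w)" for f
      by (induction l) (auto simp: pairing_def)
    then show ?thesis .
  qed
  also have "\<dots> = (\<Sum>(c, w)\<leftarrow>l. cnj c * (cauchy_comb l w - b w * cauchy_comb (adjoint_list b l) w))"
    using comb_eq[OF l] l by (intro arg_cong[of _ _ sum_list] map_cong) auto
  also have "\<dots> = (\<Sum>(c, w)\<leftarrow>l. cnj c * cauchy_comb l w) - (\<Sum>(c, w)\<leftarrow>l. cnj c * (b w * cauchy_comb (adjoint_list b l) w))"
  proof -
    have "(\<Sum>(c, w)\<leftarrow>l. cnj c * (f w - g w)) = (\<Sum>(c, w)\<leftarrow>l. cnj c * f w) - (\<Sum>(c, w)\<leftarrow>l. cnj c * g w)"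
      for f g :: "complex \<Rightarrow> complex"
      by (induction l) (auto simp: algebra_simps)
    then show ?thesis .
  qed
  also have "\<dots> = of_real (cauchy_energy l - cauchy_energy (adjoint_list b l))"
    using sum_adjoint_list[of "cauchy_comb (adjoint_list b l)" b l] cauchy_energy_eq[OF l] cauchy_energy_eq[OF la]
    by simp
  finally show ?thesis by (simp only: of_real_eq_iff)
qed

lemma holomorphic_rational:
  obtains R where "R > 1" "\<And>f. (\<lambda>z. poly f z / poly q z) holomorphic_on ball 0 R"
proof -
  have "q \<noteq> 0" using q_nz[of 0] by auto
  \<comment> \<open>The element 2 keeps the set nonempty when \<open>q\<close> has no roots. The
    radius depends on \<open>q\<close> alone, so it serves several numerators at once.\<close>
  then have fin: "finite (insert 2 (cmod ` {z. poly q z = 0}))" using poly_roots_finite by auto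
  define R where "R = Min (insert 2 (cmod ` {z. poly q z = 0}))"
  have "1 < cmod z" if "poly q z = 0" for z using q_nz[of z] that by force
  then have "R > 1" unfolding R_def using fin by (subst Min_gr_iff) auto
  moreover have "poly q z \<noteq> 0" if "z \<in> ball 0 R" for z
  proof
    assume "poly q z = 0"
    then have "R \<le> cmod z" unfolding R_def using fin by (intro Min_le) auto
    then show False using that by simp
  qed
  then have "(\<lambda>z. poly f z / poly q z) holomorphic_on ball 0 R" for f
    by (intro holomorphic_intros) auto
  ultimately show thesis using that by blast
qed

lemma energy_adjoint_le:
  assumes l: "snd ` set l \<subseteq> \<DD>"
  shows "cauchy_energy (adjoint_list a l) \<le> (nrm (comb l))\<^sup>2"
proof -
  obtain R where R: "R > 1" "\<And>f. (\<lambda>z. poly f z / poly q z) holomorphic_on ball 0 R"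
    using holomorphic_rational by blast
  have "(cmod (poly p \<zeta> / poly q \<zeta>))\<^sup>2 + (cmod (poly A \<zeta> / poly q \<zeta>))\<^sup>2 = 1" if "\<zeta> \<in> \<TT>" for \<zeta>
  proof -
    have "(cmod (poly q \<zeta>))\<^sup>2 \<noteq> 0" using q_nz[of \<zeta>] that by simp
    then show ?thesis
      unfolding norm_divide power_divide add_divide_distrib[symmetric] pyth[OF that, symmetric] by simp
  qed 
  from cauchy_energy_pythagorean[OF R(2) R(2) R(1) l this]
  have "cauchy_energy (adjoint_list b l) + cauchy_energy (adjoint_list a l) \<le> cauchy_energy l"
    using adjoint_list_cong[OF b_eq l] adjoint_list_cong[OF a_eq l] by simp
  then show ?thesis using nrm_comb_sq[OF l] by simp
qed

text \<open>Pairing \<open>a * h\<close> with a combination is pairing \<open>h\<close> with T_a* k,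
  which is bounded by the norm of that combination; the duality test then gives membership and
  contractivity together.\<close>

lemma mult_Hardy2_mem:
  assumes h: "h \<in> Hardy2"
  defines "f \<equiv> \<lambda>z. if z \<in> \<DD> then a z * h z else 0"
  shows "f \<in> H" and "nrm f \<le> Hardy2_norm h"
proof -
  have "cmod (pairing f l) \<le> Hardy2_norm h * nrm (comb l)" if l: "snd ` set l \<subseteq> \<DD>" for l
  proof -
    have la: "snd ` set (adjoint_list a l) \<subseteq> \<DD>" using l by simp
    have "cnj (pairing f l) = (\<Sum>(c, w)\<leftarrow>adjoint_list a l. cnj c * h w)"
      using l by (induction l) (auto simp: pairing_def adjoint_list_def f_def)
    then have "cmod (pairing f l) \<le> Hardy2_norm h * sqrt (cauchy_energy (adjoint_list a l))"
      using Hardy2_pairing_bound[OF h la] by (metis complex_mod_cnj)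
    also have "\<dots> \<le> Hardy2_norm h * nrm (comb l)"
      using energy_adjoint_le[OF l] Hardy2_norm_nonneg[OF h] comb_mem[OF l]
      by (intro mult_left_mono real_le_lsqrt) auto
    finally show ?thesis .
  qed
  moreover have "f x = 0" if "x \<notin> \<DD>" for x using that by (auto simp: f_def)
  ultimately obtain L where "f \<in> H" "nrm f \<le> Hardy2_norm h"
    using mem_of_pairing_bound[of f "Hardy2_norm h"] Hardy2_norm_nonneg[OF h] by metis
  then show "f \<in> H" "nrm f \<le> Hardy2_norm h" by auto
qed

definition N :: nat where "N = max (degree p) (max (degree q) (degree A))"

text \<open>The kernel of H(b) minus \<open>a z * cnj (a w)\<close> times the Cauchy kernel has a
  numerator divisible by \<open>1 - cnj w * z\<close>. Multiplying by \<open>q\<close> leaves a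
  polynomial, and summing over the nodes does not raise the degree bound.\<close>

lemma ex_residual_poly:
  assumes "snd ` set l \<subseteq> \<DD>"
  shows "\<exists>P. degree P \<le> N \<and>
    (\<forall>z\<in>\<DD>. poly q z * (comb l z - a z * cauchy_comb (adjoint_list a l) z) = poly P z)"
  using assms
proof (induction l)
  case Nil
  then show ?case by (intro exI[of _ 0]) (auto simp: comb_Nil adjoint_list_def)
next
  case (Cons x l)
  obtain c w where x: "x = (c, w)" by force
  have w: "w \<in> \<DD>" using Cons.prems x by simp
  obtain P where P: "degree P \<le> N"
    "\<And>z. z \<in> \<DD> \<Longrightarrow> poly q z * (comb l z - a z * cauchy_comb (adjoint_list a l) z) = poly P z"
    using Cons by auto
  obtain R where R: "degree R \<le> N" "\<And>z. (1 - cnj w * z) * poly R z =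
      cnj (poly q w) * poly q z - cnj (poly p w) * poly p z - cnj (poly A w) * poly A z"
  proof -
    have "degree p \<le> N" "degree q \<le> N" "degree A \<le> N" by (simp_all add: N_def)
    from kernel_numerator_dvd[OF this pyth, of w] show thesis using that by blast
  qed
  \<comment> \<open>The factor \<open>1 / cnj (poly q w)\<close> is the denominator at the node,
    left over after multiplying by \<open>poly q z\<close>.\<close>
  let ?P = "smult (c / cnj (poly q w)) R + P"
  have "poly q z * (comb (x # l) z - a z * cauchy_comb (adjoint_list a (x # l)) z) = poly ?P z" if z: "z \<in> \<DD>" for z
  proof -
    have nz: "poly q z \<noteq> 0" "poly q w \<noteq> 0" "1 - cnj w * z \<noteq> 0"
      using q_nz[of z] q_nz[of w] z w cauchy_denominator_nonzero[OF w, of z] by auto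
    have "poly q z * (1 - cnj (b w) * b z - cnj (a w) * a z) =
        (cnj (poly q w) * poly q z - cnj (poly p w) * poly p z - cnj (poly A w) * poly A z) / cnj (poly q w)"
      using nz by (simp add: b_eq[OF z] b_eq[OF w] a_eq[OF z] a_eq[OF w] field_simps)
    also have "\<dots> = (1 - cnj w * z) * poly R z / cnj (poly q w)" by (simp only: R(2))
    finally have main: "poly q z * ((1 - cnj (b w) * b z - cnj (a w) * a z) / (1 - cnj w * z)) = poly R z / cnj (poly q w)"
      using nz by (simp add: field_simps)
    have split: "comb (x # l) z - a z * cauchy_comb (adjoint_list a (x # l)) z =
       c * ((1 - cnj (b w) * b z - cnj (a w) * a z) / (1 - cnj w * z)) +
       (comb l z - a z * cauchy_comb (adjoint_list a l) z)"
      using z by (simp add: x comb_Cons kfun_eq adjoint_list_def diff_divide_distrib add_divide_distrib algebra_simps)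
    have dist: "x * (c * t + y) = c * (x * t) + x * y" for x t y :: complex
      by (simp add: algebra_simps)
    show ?thesis
      unfolding split dist main poly_add poly_smult P(2)[OF z, symmetric] by simp
  qed
  moreover have "degree ?P \<le> N"
    using P R by (intro degree_add_le) (auto intro: order_trans[OF degree_smult_le])
  ultimately show ?case by blast
qed

lemma cauchy_comb_adjoint_bound:
  assumes l: "snd ` set l \<subseteq> \<DD>" and z: "z \<in> \<DD>"
  shows "cmod (cauchy_comb (adjoint_list a l) z) \<le> nrm (comb l) / sqrt (1 - (cmod z)\<^sup>2)"
proof -
  have la: "snd ` set (adjoint_list a l) \<subseteq> \<DD>" using l by simp
  have "1 - (cmod z)\<^sup>2 > 0" using z by (simp add: abs_square_less_1)
  moreover have "sqrt (cauchy_energy (adjoint_list a l)) \<le> nrm (comb l)"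
    using energy_adjoint_le[OF l] comb_mem[OF l] by (intro real_le_lsqrt) auto
  ultimately show ?thesis
    using cauchy_comb_point_bound[OF la z] by (meson divide_right_mono order_trans real_sqrt_ge_zero less_imp_le)
qed

text \<open>A residual polynomial has degree at most \<open>N\<close> and is controlled at \<open>N + 1\<close> points of the
  disk, hence on the closed disk.\<close>

lemma residual_poly_bound:
  obtains K where "K \<ge> 0"
    "\<And>l P z. snd ` set l \<subseteq> \<DD> \<Longrightarrow> degree P \<le> N \<Longrightarrow>
      (\<And>z. z \<in> \<DD> \<Longrightarrow> poly q z * (comb l z - a z * cauchy_comb (adjoint_list a l) z) = poly P z) \<Longrightarrow>
      z \<in> cball 0 1 \<Longrightarrow> cmod (poly P z) \<le> K * nrm (comb l)"
proof -
  have "infinite \<DD>" using uncountable_ball[of 1 "0::complex"] countable_finite by auto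
  then obtain S where S: "finite S" "card S = N + 1" "S \<subseteq> \<DD>" using infinite_arbitrarily_large by metis
  obtain C where C: "C \<ge> 0"
    "\<And>P z. degree P < card S \<Longrightarrow> z \<in> cball 0 1 \<Longrightarrow> cmod (poly P z) \<le> C * (\<Sum>x\<in>S. cmod (poly P x))"
    using poly_bound_by_values[OF S(1)] by blast
  \<comment> \<open>The norm of the kernel at \<open>x\<close> bounds the value of
    \<open>comb l\<close>, and the growth bound for Hardy functions bounds the value of its Hardy
    part.\<close>
  define B where "B x = cmod (poly q x) * (nrm (kfun x) + cmod (a x) / sqrt (1 - (cmod x)\<^sup>2))" for x
  have sq: "0 < 1 - (cmod x)\<^sup>2" if "x \<in> \<DD>" for x using that by (simp add: abs_square_less_1)
  show thesis
  proof (rule that[of "C * (\<Sum>x\<in>S. B x)"])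
    have "B x \<ge> 0" if "x \<in> S" for x
      using sq[of x] that S(3) by (auto simp: B_def intro!: mult_nonneg_nonneg add_nonneg_nonneg divide_nonneg_nonneg)
    then show "0 \<le> C * (\<Sum>x\<in>S. B x)" using C(1) by (simp add: sum_nonneg)
    fix l P and z :: complex
    assume l: "snd ` set l \<subseteq> \<DD>" and dP: "degree P \<le> N" and z: "z \<in> cball 0 1"
      and P: "\<And>z. z \<in> \<DD> \<Longrightarrow> poly q z * (comb l z - a z * cauchy_comb (adjoint_list a l) z) = poly P z"
    have "cmod (poly P x) \<le> B x * nrm (comb l)" if "x \<in> S" for x
    proof -
      have x: "x \<in> \<DD>" using that S by auto
      have "cmod (comb l x - a x * cauchy_comb (adjoint_list a l) x) \<le>
          cmod (comb l x) + cmod (a x) * cmod (cauchy_comb (adjoint_list a l) x)"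
        using norm_triangle_ineq4[of "comb l x" "a x * cauchy_comb (adjoint_list a l) x"] by (simp add: norm_mult)
      also have "\<dots> \<le> nrm (kfun x) * nrm (comb l) + cmod (a x) * (nrm (comb l) / sqrt (1 - (cmod x)\<^sup>2))"
        using point_bound[OF comb_mem[OF l] x] cauchy_comb_adjoint_bound[OF l x]
        by (intro add_mono mult_left_mono) auto
      finally have "cmod (poly q x) * cmod (comb l x - a x * cauchy_comb (adjoint_list a l) x) \<le>
          cmod (poly q x) * (nrm (kfun x) * nrm (comb l) + cmod (a x) * (nrm (comb l) / sqrt (1 - (cmod x)\<^sup>2)))"
        by (intro mult_left_mono) auto
      then show ?thesis unfolding P[OF x, symmetric] norm_mult B_def by (simp add: algebra_simps)
    qed
    then have "(\<Sum>x\<in>S. cmod (poly P x)) \<le> (\<Sum>x\<in>S. B x) * nrm (comb l)"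
      by (simp add: sum_distrib_right sum_mono)
    then have "C * (\<Sum>x\<in>S. cmod (poly P x)) \<le> C * ((\<Sum>x\<in>S. B x) * nrm (comb l))"
      using C(1) by (intro mult_left_mono)
    then show "cmod (poly P z) \<le> C * (\<Sum>x\<in>S. B x) * nrm (comb l)"
      using C(2)[of P z] dP S(2) z by (simp add: mult.assoc)
  qed
qed

lemma Hardy2_of_mean2_bound:
  assumes "g holomorphic_on \<DD>" "c \<ge> 0" "\<And>r. 0 \<le> r \<Longrightarrow> r < 1 \<Longrightarrow> mean2 g r \<le> c\<^sup>2"
  shows "g \<in> Hardy2" and "Hardy2_norm g \<le> c"
proof -
  show "g \<in> Hardy2" unfolding Hardy2_def using assms by (auto intro!: bdd_aboveI2)
  have "(SUP r\<in>{0..<1}. mean2 g r) \<le> c\<^sup>2" using assms by (intro cSUP_least) auto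
  then show "Hardy2_norm g \<le> c" unfolding Hardy2_norm_def using assms(2) by (intro real_le_lsqrt)
qed

text \<open>Combinations split explicitly into a Hardy part and a polynomial over \<open>q\<close>,
  each bounded by the H(b) norm. Approximating \<open>f\<close> in norm by combinations makes both
  parts Cauchy, and their limits give the splitting of \<open>f\<close>.\<close>

lemma decomposition:
  obtains K where "K \<ge> 0"
    "\<And>f. f \<in> H \<Longrightarrow> \<exists>g s. g \<in> Hardy2 \<and> Hardy2_norm g \<le> nrm f \<and> continuous_on (cball 0 1) s \<and>
      (\<forall>z\<in>\<DD>. f z = a z * g z + s z) \<and> (\<forall>z\<in>cball 0 1. cmod (s z) \<le> K * nrm f)"
proof -
  obtain K0 where K0: "K0 \<ge> 0"
    "\<And>l P z. snd ` set l \<subseteq> \<DD> \<Longrightarrow> degree P \<le> N \<Longrightarrow>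
      (\<And>z. z \<in> \<DD> \<Longrightarrow> poly q z * (comb l z - a z * cauchy_comb (adjoint_list a l) z) = poly P z) \<Longrightarrow>
      z \<in> cball 0 1 \<Longrightarrow> cmod (poly P z) \<le> K0 * nrm (comb l)"
    using residual_poly_bound by metis
  have cq: "continuous_on (cball 0 1) (\<lambda>w. 1 / poly q w)" using q_nz by (intro continuous_intros) auto
  then have "bounded ((\<lambda>w. 1 / poly q w) ` cball 0 1)"
    by (intro compact_imp_bounded compact_continuous_image) auto
  then obtain M where M: "M > 0" "\<And>w. w \<in> cball 0 1 \<Longrightarrow> cmod (1 / poly q w) \<le> M"
    by (auto simp: bounded_pos)
  show thesis
  proof (rule that[of "M * K0"])
    show "0 \<le> M * K0" using M K0 by simp
    fix f assume f: "f \<in> H"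
    have off: "f x = 0" if "x \<notin> \<DD>" for x using vanish_off[OF f that] .
    \<comment> \<open>By Cauchy-Schwarz \<open>f\<close> satisfies the duality test with its own
      norm; the test is reused because it also delivers combinations converging to
      \<open>f\<close>.\<close>
    have pb: "cmod (pairing f l) \<le> nrm f * nrm (comb l)" if l: "snd ` set l \<subseteq> \<DD>" for l
      using cauchy_schwarz[OF comb_mem[OF l] f] ip_comb[OF f l] by (simp add: mult.commute)
    obtain L where L: "\<And>n. snd ` set (L n) \<subseteq> \<DD>"
      and lim: "(\<lambda>n. nrm (\<lambda>x. comb (L n) x - f x)) \<longlonglongrightarrow> 0"
      using mem_of_pairing_bound[OF off pb nrm_nonneg[OF f]] by metis
    define F where "F n = comb (L n)" for n
    define G where "G n = cauchy_comb (adjoint_list a (L n))" for n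
    have FH: "F n \<in> H" for n using comb_mem[OF L] by (simp add: F_def)
    define e where "e n = nrm (\<lambda>x. F n x - f x)" for n
    have e: "e \<longlonglongrightarrow> 0" using lim by (simp add: e_def[abs_def] F_def)
    have nlim: "(\<lambda>n. nrm (F n)) \<longlonglongrightarrow> nrm f"
    proof -
      have "(\<lambda>n. nrm (F n) - nrm f) \<longlonglongrightarrow> 0"
        by (rule Lim_null_comparison[OF _ e]) (use abs_nrm_diff[OF FH f] in \<open>auto simp: e_def intro!: always_eventually\<close>)
      then show ?thesis by (simp add: LIM_zero_iff)
    qed
    have dF: "nrm (\<lambda>x. F m x - F n x) \<le> e m + e n" for m n
      using nrm_triangle[OF diff_mem[OF FH f] diff_mem[OF f FH], of m n] nrm_diff_commute[OF f FH, of n]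
      by (simp add: e_def)
    have small: "\<exists>k. \<forall>m\<ge>k. \<forall>n\<ge>k. c * nrm (\<lambda>x. F m x - F n x) < d" if d: "d > 0" and c: "c \<ge> 0" for c d
    proof -
      have "(\<lambda>n. c * e n) \<longlonglongrightarrow> c * 0" by (intro tendsto_intros e)
      then obtain k where k: "\<And>n. n \<ge> k \<Longrightarrow> \<bar>c * e n\<bar> < d / 2"
        using d LIMSEQ_D[of "\<lambda>n. c * e n" 0 "d / 2"] by auto
      have "c * nrm (\<lambda>x. F m x - F n x) < d" if "m \<ge> k" "n \<ge> k" for m n
        using mult_left_mono[OF dF[of m n] c] k[OF that(1)] k[OF that(2)] by (simp add: distrib_left)
      then show ?thesis by blast
    qed
    \<comment> \<open>Differences of the approximants are realised as combinations, so that the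
      bounds for single combinations become Cauchy estimates.\<close>
    define Df where "Df m n = L m @ lscale (-1) (L n)" for m n
    have Df: "snd ` set (Df m n) \<subseteq> \<DD>" for m n using L by (simp add: Df_def image_Un)
    have comb_Df: "comb (Df m n) = (\<lambda>x. F m x - F n x)" for m n
      by (simp add: Df_def comb_append comb_lscale F_def)
    have G_Df: "cauchy_comb (adjoint_list a (Df m n)) z = G m z - G n z" for m n z
    proof -
      have "cauchy_comb (adjoint_list a (lscale (-1) l)) z = - cauchy_comb (adjoint_list a l) z" for l
        by (induction l) (auto simp: adjoint_list_def lscale_def)
      then show ?thesis by (simp add: Df_def adjoint_list_def cauchy_comb_append G_def)
    qed
    have "\<exists>P. \<forall>n. degree (P n) \<le> N \<and> (\<forall>z\<in>\<DD>. poly q z * (F n z - a z * G n z) = poly (P n) z)"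
      using ex_residual_poly[OF L] unfolding F_def G_def by metis
    then obtain P where P: "\<And>n. degree (P n) \<le> N"
      "\<And>n z. z \<in> \<DD> \<Longrightarrow> poly q z * (F n z - a z * G n z) = poly (P n) z" by blast
    have P_Df: "cmod (poly (P m) z - poly (P n) z) \<le> K0 * nrm (\<lambda>x. F m x - F n x)" if z: "z \<in> cball 0 1" for m n z
    proof -
      have "cmod (poly (P m - P n) z) \<le> K0 * nrm (comb (Df m n))"
      proof (rule K0(2)[OF Df _ _ z])
        show "degree (P m - P n) \<le> N" using P(1) by (intro degree_diff_le)
        show "poly q z * (comb (Df m n) z - a z * cauchy_comb (adjoint_list a (Df m n)) z) = poly (P m - P n) z"
          if "z \<in> \<DD>" for z
          unfolding comb_Df G_Df using P(2)[OF that, of m] P(2)[OF that, of n] by (simp add: algebra_simps)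
      qed
      then show ?thesis by (simp add: comb_Df)
    qed
    have "uniformly_convergent_on (cball 0 1) (\<lambda>n. poly (P n))"
    proof (intro Cauchy_uniformly_convergent uniformly_Cauchy_onI')
      fix d :: real assume "d > 0"
      from small[OF this K0(1)] obtain k where "\<And>m n. m \<ge> k \<Longrightarrow> n \<ge> k \<Longrightarrow> K0 * nrm (\<lambda>x. F m x - F n x) < d" by blast
      then show "\<exists>M. \<forall>x\<in>cball 0 1. \<forall>m\<ge>M. \<forall>n>m. dist (poly (P m) x) (poly (P n) x) < d"
        unfolding dist_norm by (intro exI[of _ k] ballI allI impI) (rule le_less_trans[OF P_Df], auto)
    qed
    then obtain s0 where s0: "uniform_limit (cball 0 1) (\<lambda>n. poly (P n)) s0 sequentially"
      by (auto simp: uniformly_convergent_on_def)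
    have cs0: "continuous_on (cball 0 1) s0"
      by (rule uniform_limit_theorem[OF _ s0]) (auto intro!: always_eventually continuous_intros)
    have s0lim: "(\<lambda>n. poly (P n) z) \<longlonglongrightarrow> s0 z" if "z \<in> cball 0 1" for z
      using tendsto_uniform_limitI[OF s0 that] .
    have s0b: "cmod (s0 z) \<le> K0 * nrm f" if z: "z \<in> cball 0 1" for z
    proof (rule tendsto_le[OF sequentially_bot tendsto_mult_left[OF nlim] tendsto_norm[OF s0lim[OF z]]])
      show "\<forall>\<^sub>F n in sequentially. cmod (poly (P n) z) \<le> K0 * nrm (F n)"
        using K0(2)[OF L P(1) _ z] P(2) by (intro always_eventually allI) (simp add: F_def G_def)
    qed
    \<comment> \<open>The growth bound degenerates at the circle, so the Hardy parts are controlled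
      uniformly only on smaller disks, in contrast to the polynomials. This is enough for a
      holomorphic limit and for each single radius in \<open>mean2\<close>.\<close>
    have Gb: "cmod (G m z - G n z) \<le> 1 / sqrt (1 - \<rho>\<^sup>2) * nrm (\<lambda>x. F m x - F n x)"
      and Gb': "cmod (G n z) \<le> 1 / sqrt (1 - \<rho>\<^sup>2) * nrm (F n)"
      if \<rho>: "\<rho> < 1" and z: "z \<in> cball 0 \<rho>" for m n z \<rho>
    proof -
      have "0 \<le> \<rho>" using z norm_ge_zero[of z] by (simp del: norm_ge_zero)
      have "z \<in> \<DD>" using z \<rho> by simp
      have le: "x / sqrt (1 - (cmod z)\<^sup>2) \<le> 1 / sqrt (1 - \<rho>\<^sup>2) * x" if "x \<ge> 0" for x
      proof -
        have "(cmod z)\<^sup>2 \<le> \<rho>\<^sup>2" using z by (intro power_mono) auto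
        moreover have "\<rho>\<^sup>2 < 1" using \<rho> \<open>0 \<le> \<rho>\<close> by (simp add: abs_square_less_1)
        ultimately have "1 / sqrt (1 - (cmod z)\<^sup>2) \<le> 1 / sqrt (1 - \<rho>\<^sup>2)" by (intro divide_left_mono) auto
        from mult_right_mono[OF this that] show ?thesis by simp
      qed
      show "cmod (G m z - G n z) \<le> 1 / sqrt (1 - \<rho>\<^sup>2) * nrm (\<lambda>x. F m x - F n x)"
        using cauchy_comb_adjoint_bound[OF Df \<open>z \<in> \<DD>\<close>, of m n] le[OF nrm_nonneg[OF diff_mem[OF FH FH]], of m n]
        by (simp add: G_Df comb_Df)
      show "cmod (G n z) \<le> 1 / sqrt (1 - \<rho>\<^sup>2) * nrm (F n)"
        using cauchy_comb_adjoint_bound[OF L \<open>z \<in> \<DD>\<close>, of n] le[OF nrm_nonneg[OF FH], of n]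
        by (simp add: G_def F_def)
    qed
    define g where "g z = lim (\<lambda>n. G n z)" for z
    have ul: "uniform_limit (cball 0 \<rho>) G g sequentially" if \<rho>: "0 \<le> \<rho>" "\<rho> < 1" for \<rho>
    proof -
      have "\<rho>\<^sup>2 < 1" using \<rho> by (simp add: abs_square_less_1)
      then have cpos: "0 \<le> 1 / sqrt (1 - \<rho>\<^sup>2)" by simp
      have "uniformly_convergent_on (cball 0 \<rho>) G"
      proof (intro Cauchy_uniformly_convergent uniformly_Cauchy_onI')
        fix d :: real assume "d > 0"
        from small[OF this cpos] obtain k where
          "\<And>m n. m \<ge> k \<Longrightarrow> n \<ge> k \<Longrightarrow> 1 / sqrt (1 - \<rho>\<^sup>2) * nrm (\<lambda>x. F m x - F n x) < d" by blast
        then show "\<exists>M. \<forall>x\<in>cball 0 \<rho>. \<forall>m\<ge>M. \<forall>n>m. dist (G m x) (G n x) < d"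
          unfolding dist_norm by (intro exI[of _ k] ballI allI impI) (rule le_less_trans[OF Gb[OF \<rho>(2)]], auto)
      qed
      then show ?thesis by (simp add: uniformly_convergent_uniform_limit_iff g_def[abs_def])
    qed
    have Glim: "(\<lambda>n. G n z) \<longlonglongrightarrow> g z" if z: "z \<in> \<DD>" for z
      using tendsto_uniform_limitI[OF ul[of "cmod z"], of z] z by simp
    have holG: "G n holomorphic_on \<DD>" for n
    proof -
      have "snd ` set (adjoint_list a (L n)) \<subseteq> \<DD>" using L by simp
      then obtain R where "R > 1" "G n holomorphic_on ball 0 R"
        using holomorphic_cauchy_comb unfolding G_def by metis
      then show ?thesis by (auto elim!: holomorphic_on_subset)
    qed
    have holg: "g holomorphic_on \<DD>"
    proof (rule holomorphic_uniform_sequence[OF open_ball holG])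
      fix x :: complex assume x: "x \<in> \<DD>"
      define d where "d = (1 - cmod x) / 2"
      have sub: "cball x d \<subseteq> cball 0 (cmod x + d)"
      proof
        fix y assume "y \<in> cball x d"
        then have "cmod (x - y) \<le> d" by (simp add: dist_norm)
        then show "y \<in> cball 0 (cmod x + d)" using norm_triangle_ineq4[of x "x - y"] by simp
      qed
      have "d > 0" "cmod x + d < 1" using x by (auto simp: d_def field_simps)
      moreover have "uniform_limit (cball x d) G g sequentially"
        using ul[of "cmod x + d"] calculation by (intro uniform_limit_on_subset[OF _ sub]) auto
      moreover have "cball x d \<subseteq> \<DD>" using sub \<open>cmod x + d < 1\<close> by (auto simp: subset_iff)
      ultimately show "\<exists>d>0. cball x d \<subseteq> \<DD> \<and> uniform_limit (cball x d) G g sequentially" by blast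
    qed
    have cont_r: "continuous_on \<TT> (\<lambda>\<zeta>. h (of_real r * \<zeta>))"
      if "h holomorphic_on \<DD>" and r: "0 \<le> r" "r < 1" for h and r :: real
      by (rule continuous_on_compose2[OF holomorphic_on_imp_continuous_on[OF that(1)]])
        (use r in \<open>auto intro!: continuous_intros simp: norm_mult\<close>)
    have mean: "mean2 g r \<le> (nrm f)\<^sup>2" if r: "0 \<le> r" "r < 1" for r
    proof -
      \<comment> \<open>A convergent sequence of norms is bounded, which yields a constant majorant
        on the circle of radius \<open>r\<close>.\<close>
      obtain B where "\<And>n. norm (nrm (F n)) \<le> B"
        using convergent_imp_Bseq[OF convergentI[OF nlim]] unfolding Bseq_def by blast
      then have B: "nrm (F n) \<le> B" for n by (metis abs_le_D1 real_norm_def)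
      have "r\<^sup>2 < 1" using r by (simp add: abs_square_less_1)
      have "(\<lambda>n. mean2 (G n) r) \<longlonglongrightarrow> mean2 g r"
        unfolding mean2_def
      proof (rule integral_dominated_convergence[where w="\<lambda>_. (1 / sqrt (1 - r\<^sup>2) * B)\<^sup>2"])
        show "(\<lambda>\<zeta>. (cmod (g (of_real r * \<zeta>)))\<^sup>2) \<in> borel_measurable circle_measure"
          by (intro borel_measurable_circle_continuous continuous_intros cont_r[OF holg r])
        show "(\<lambda>\<zeta>. (cmod (G n (of_real r * \<zeta>)))\<^sup>2) \<in> borel_measurable circle_measure" for n
          by (intro borel_measurable_circle_continuous continuous_intros cont_r[OF holG r])
        show "AE \<zeta> in circle_measure. (\<lambda>n. (cmod (G n (of_real r * \<zeta>)))\<^sup>2) \<longlonglongrightarrow> (cmod (g (of_real r * \<zeta>)))\<^sup>2"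
          using r by (intro AE_I2 tendsto_intros Glim) (simp add: norm_mult)
        show "AE \<zeta> in circle_measure. norm ((cmod (G n (of_real r * \<zeta>)))\<^sup>2) \<le> (1 / sqrt (1 - r\<^sup>2) * B)\<^sup>2" for n
        proof (rule AE_I2)
          fix \<zeta> assume "\<zeta> \<in> space circle_measure"
          then have "cmod (G n (of_real r * \<zeta>)) \<le> 1 / sqrt (1 - r\<^sup>2) * nrm (F n)"
            using r by (intro Gb') (auto simp: norm_mult)
          also have "\<dots> \<le> 1 / sqrt (1 - r\<^sup>2) * B" using B \<open>r\<^sup>2 < 1\<close> by (intro mult_left_mono) auto
          finally show "norm ((cmod (G n (of_real r * \<zeta>)))\<^sup>2) \<le> (1 / sqrt (1 - r\<^sup>2) * B)\<^sup>2"
            by (simp add: power_mono)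
        qed
      qed simp
      moreover have "mean2 (G n) r \<le> (nrm (F n))\<^sup>2" for n
      proof -
        have "snd ` set (adjoint_list a (L n)) \<subseteq> \<DD>" using L by simp
        from mean2_cauchy_comb[OF this r] show ?thesis
          using energy_adjoint_le[OF L, of n] by (simp add: G_def F_def)
      qed
      ultimately show ?thesis
        by (intro tendsto_le[OF sequentially_bot tendsto_power[OF nlim]]) (auto intro!: always_eventually)
    qed
    note g = Hardy2_of_mean2_bound[OF holg nrm_nonneg[OF f] mean]
    define s where "s z = s0 z / poly q z" for z
    have "continuous_on (cball 0 1) s"
      unfolding s_def using q_nz by (intro continuous_intros cs0) auto
    moreover have "f z = a z * g z + s z" if z: "z \<in> \<DD>" for z
    proof -
      have Flim: "(\<lambda>n. F n z) \<longlonglongrightarrow> f z"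
      proof -
        have "(\<lambda>n. F n z - f z) \<longlonglongrightarrow> 0"
        proof (rule Lim_null_comparison)
          show "\<forall>\<^sub>F n in sequentially. norm (F n z - f z) \<le> nrm (kfun z) * e n"
            using point_bound[OF diff_mem[OF FH f] z] by (auto simp: e_def intro!: always_eventually)
          show "(\<lambda>n. nrm (kfun z) * e n) \<longlonglongrightarrow> 0" using tendsto_mult_left[OF e] by simp
        qed
        then show ?thesis by (simp add: LIM_zero_iff)
      qed
      have "(\<lambda>n. poly q z * (F n z - a z * G n z)) \<longlonglongrightarrow> poly q z * (f z - a z * g z)"
        by (intro tendsto_intros Flim Glim z)
      moreover have "(\<lambda>n. poly q z * (F n z - a z * G n z)) \<longlonglongrightarrow> s0 z"
        using s0lim[of z] z by (simp add: P(2)[OF z])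
      ultimately have "poly q z * (f z - a z * g z) = s0 z" by (rule LIMSEQ_unique)
      moreover have "poly q z \<noteq> 0" using q_nz[of z] z by simp
      ultimately show ?thesis by (simp add: s_def field_simps)
    qed
    moreover have "cmod (s z) \<le> M * K0 * nrm f" if z: "z \<in> cball 0 1" for z
    proof -
      have "cmod (s z) = cmod (1 / poly q z) * cmod (s0 z)" by (simp add: s_def norm_divide)
      also have "\<dots> \<le> M * (K0 * nrm f)" using M(1) by (intro mult_mono M(2) s0b z) auto
      finally show ?thesis by simp
    qed
    ultimately show "\<exists>g s. g \<in> Hardy2 \<and> Hardy2_norm g \<le> nrm f \<and> continuous_on (cball 0 1) s \<and>
      (\<forall>z\<in>\<DD>. f z = a z * g z + s z) \<and> (\<forall>z\<in>cball 0 1. cmod (s z) \<le> M * K0 * nrm f)"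
      using g by blast
  qed
qed

end

subsection \<open>Non-tangential limits and Carleson measures\<close>

lemma has_nt_limit_cong:
  assumes "\<And>z. z \<in> \<DD> \<Longrightarrow> f z = g z"
  shows "has_nt_limit f \<zeta> L \<longleftrightarrow> has_nt_limit g \<zeta> L"
  unfolding has_nt_limit_def
  by (intro all_cong Lim_cong_within refl) (auto simp: stolz_region_def assms)

lemma has_nt_limit_continuous:
  assumes "continuous_on (cball 0 1) s" "\<zeta> \<in> \<TT>"
  shows "has_nt_limit s \<zeta> (s \<zeta>)"
proof -
  have "(s \<longlongrightarrow> s \<zeta>) (at \<zeta> within cball 0 1)" using assms by (auto simp: continuous_on_def)
  then show ?thesis
    unfolding has_nt_limit_def
    by (intro allI impI) (rule tendsto_within_subset, auto simp: stolz_region_def)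
qed

lemma has_nt_limit_add:
  "has_nt_limit f \<zeta> L \<Longrightarrow> has_nt_limit g \<zeta> M \<Longrightarrow> has_nt_limit (\<lambda>z. f z + g z) \<zeta> (L + M)"
  and has_nt_limit_mult:
  "has_nt_limit f \<zeta> L \<Longrightarrow> has_nt_limit g \<zeta> M \<Longrightarrow> has_nt_limit (\<lambda>z. f z * g z) \<zeta> (L * M)"
  and has_nt_limit_divide:
  "has_nt_limit f \<zeta> L \<Longrightarrow> has_nt_limit g \<zeta> M \<Longrightarrow> M \<noteq> 0 \<Longrightarrow> has_nt_limit (\<lambda>z. f z / g z) \<zeta> (L / M)"
  unfolding has_nt_limit_def by (auto intro!: tendsto_intros)

text \<open>At a zero of \<open>f\<close> the linear decay of \<open>f\<close> beats the growth \<open>(1 - |z|)\<^sup>-\<^sup>1\<^sup>/\<^sup>2\<close> of a Hardy function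
  in a Stolz region.\<close>

lemma has_nt_limit_zero_mult_Hardy2:
  assumes f: "\<And>z. z \<in> \<DD> \<Longrightarrow> cmod (f z) \<le> M * cmod (z - \<zeta>)" and M: "M \<ge> 0"
    and g: "g \<in> Hardy2" and \<zeta>: "\<zeta> \<in> \<TT>"
  shows "has_nt_limit (\<lambda>z. f z * g z) \<zeta> 0"
  unfolding has_nt_limit_def
proof (intro allI impI)
  fix \<alpha> :: real assume \<alpha>: "\<alpha> > 1"
  define n where "n = Hardy2_norm g"
  have n: "n \<ge> 0" using Hardy2_norm_nonneg[OF g] by (simp add: n_def)
  show "((\<lambda>z. f z * g z) \<longlongrightarrow> 0) (at \<zeta> within stolz_region \<alpha> \<zeta>)"
  proof (rule Lim_null_comparison)
    have "cmod (f z * g z) \<le> M * n * sqrt \<alpha> * sqrt (cmod (z - \<zeta>))" if z: "z \<in> stolz_region \<alpha> \<zeta>" for z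
    proof -
      have zD: "z \<in> \<DD>" and st: "cmod (z - \<zeta>) < \<alpha> * (1 - cmod z)" using z by (auto simp: stolz_region_def)
      let ?d = "cmod (z - \<zeta>)"
      have d: "?d > 0" using zD \<zeta> by auto
      have "(cmod z)\<^sup>2 \<le> cmod z" using zD by (simp add: power2_eq_square mult_left_le)
      then have "1 - cmod z \<le> 1 - (cmod z)\<^sup>2" by simp
      then have "?d / \<alpha> \<le> 1 - (cmod z)\<^sup>2"
        using st \<alpha> by (smt (verit) pos_divide_less_eq mult.commute)
      then have "sqrt (?d / \<alpha>) \<le> sqrt (1 - (cmod z)\<^sup>2)" by simp
      moreover have "0 < sqrt (?d / \<alpha>)" using d \<alpha> by simp
      ultimately have "n / sqrt (1 - (cmod z)\<^sup>2) \<le> n / sqrt (?d / \<alpha>)"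
        using n by (intro divide_left_mono mult_pos_pos) auto
      then have "cmod (g z) \<le> n / sqrt (?d / \<alpha>)"
        using Hardy2_point_bound[OF g zD] by (simp add: n_def)
      then have "cmod (f z) * cmod (g z) \<le> (M * ?d) * (n / sqrt (?d / \<alpha>))"
        using f[OF zD] M by (intro mult_mono) auto
      also have "\<dots> = M * n * sqrt \<alpha> * (?d / sqrt ?d)" by (simp add: real_sqrt_divide)
      also have "?d / sqrt ?d = sqrt ?d" by (rule real_div_sqrt) simp
      finally show ?thesis by (simp add: norm_mult)
    qed
    then show "\<forall>\<^sub>F z in at \<zeta> within stolz_region \<alpha> \<zeta>. norm (f z * g z) \<le> M * n * sqrt \<alpha> * sqrt (cmod (z - \<zeta>))"
      by (simp add: eventually_at_filter)
    have "((\<lambda>z. M * n * sqrt \<alpha> * sqrt (cmod (z - \<zeta>))) \<longlongrightarrow> M * n * sqrt \<alpha> * sqrt (cmod (\<zeta> - \<zeta>)))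
        (at \<zeta> within stolz_region \<alpha> \<zeta>)"
      by (intro tendsto_intros)
    then show "((\<lambda>z. M * n * sqrt \<alpha> * sqrt (cmod (z - \<zeta>))) \<longlongrightarrow> 0) (at \<zeta> within stolz_region \<alpha> \<zeta>)" by simp
  qed
qed

text \<open>The extension is defined by a choice on an uncontrolled set of boundary points. The
  limit along a fixed radial sequence is measurable everywhere and agrees with it wherever the
  non-tangential limit exists.\<close>

lemma measurable_modification_nt_extension:
  assumes sets: "sets \<mu> = sets (restrict_space borel (cball 0 1))" and adm: "admissible \<mu> f"
  obtains G where "G \<in> borel_measurable \<mu>" "AE z in \<mu>. nt_extension f z = G z"
proof -
  have hol: "f holomorphic_on \<DD>" and lim: "AE \<zeta> in \<mu>. \<zeta> \<in> \<TT> \<longrightarrow> (\<exists>L. has_nt_limit f \<zeta> L)"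
    using adm by (auto simp: admissible_def)
  have cf: "continuous_on \<DD> f" by (rule holomorphic_on_imp_continuous_on[OF hol])
  obtain r :: "nat \<Rightarrow> real" where r: "\<And>n. 0 < r n" "\<And>n. r n < 1"
    and rin: "\<And>n z. z \<in> cball 0 1 \<Longrightarrow> of_real (r n) * z \<in> \<DD>"
    and zlim: "\<And>z :: complex. (\<lambda>n. of_real (r n) * z) \<longlonglongrightarrow> z"
    using radial_sequence by blast
  define G where "G z = lim (\<lambda>n. f (of_real (r n) * z))" for z
  have "(\<lambda>z. f (of_real (r n) * z)) \<in> borel_measurable \<mu>" for n
  proof -
    have "continuous_on (cball 0 1) (\<lambda>z. f (of_real (r n) * z))"
      by (rule continuous_on_compose2[OF cf]) (use rin in \<open>auto intro!: continuous_intros\<close>)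
    from borel_measurable_continuous_on_restrict[OF this] show ?thesis
      by (simp add: measurable_cong_sets[OF sets refl])
  qed
  then have "G \<in> borel_measurable \<mu>" unfolding G_def by (rule borel_measurable_lim_metric)
  moreover have "AE z in \<mu>. nt_extension f z = G z"
    using lim AE_space
  proof eventually_elim
    case (elim z)
    have z: "z \<in> cball 0 1" using elim(2) sets_eq_imp_space_eq[OF sets] by (simp add: space_restrict_space)
    show ?case
    proof (cases "z \<in> \<DD>")
      case True
      then have "isCont f z" using cf by (simp add: continuous_on_eq_continuous_at)
      then have "(\<lambda>n. f (of_real (r n) * z)) \<longlonglongrightarrow> f z" using zlim by (rule isCont_tendsto_compose)
      then show ?thesis using True by (simp add: G_def nt_extension_def limI)
    next
      case False
      then have \<zeta>: "z \<in> \<TT>" using z by auto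
      then obtain L where L: "has_nt_limit f z L" using elim(1) by blast
      then have "(f \<longlongrightarrow> L) (at z within stolz_region 2 z)" by (auto simp: has_nt_limit_def)
      \<comment> \<open>A radial point has distance exactly \<open>1 - r n\<close> to the boundary
        point, so it lies in the region of aperture 2.\<close>
      moreover have "filterlim (\<lambda>n. of_real (r n) * z) (at z within stolz_region 2 z) sequentially"
        unfolding filterlim_at
      proof (rule conjI[OF always_eventually zlim], rule allI)
        fix n
        have "of_real (r n) * z - z = of_real (r n - 1) * z" by (simp add: algebra_simps)
        then have d: "cmod (of_real (r n) * z - z) = 1 - r n"
          using r[of n] \<zeta> by (simp only: norm_mult norm_of_real) simp
        then show "of_real (r n) * z \<in> stolz_region 2 z \<and> of_real (r n) * z \<noteq> z"
          using rin[OF z, of n] r[of n] \<zeta> by (auto simp: stolz_region_def norm_mult)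
      qed
      ultimately have "(\<lambda>n. f (of_real (r n) * z)) \<longlonglongrightarrow> L" by (rule filterlim_compose)
      then show ?thesis using nt_extension_eq[OF \<zeta> L] by (simp add: G_def limI)
    qed
  qed
  ultimately show thesis using that by blast
qed

text \<open>Moving the density into the integrand requires measurability, hence \<open>G\<close>.
  Agreement is available only where \<open>\<phi>\<close> is nonzero; elsewhere the factor
  \<open>\<phi>\<close> annihilates the integrand.\<close>

lemma nn_integral_density_nt_extension:
  assumes sets: "sets \<mu> = sets (restrict_space borel (cball 0 1))"
    and \<phi> [measurable]: "\<phi> \<in> borel_measurable \<mu>" and adm: "admissible (density \<mu> \<phi>) h"
  obtains G where "G \<in> borel_measurable \<mu>" "AE z in \<mu>. \<phi> z \<noteq> 0 \<longrightarrow> nt_extension h z = G z"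
    "(\<integral>\<^sup>+z. ennreal ((cmod (nt_extension h z))\<^sup>2) \<partial>density \<mu> \<phi>) =
      (\<integral>\<^sup>+z. \<phi> z * ennreal ((cmod (G z))\<^sup>2) \<partial>\<mu>)"
proof -
  have "sets (density \<mu> \<phi>) = sets (restrict_space borel (cball 0 1))" using sets by simp
  then obtain G where G: "G \<in> borel_measurable (density \<mu> \<phi>)" "AE z in density \<mu> \<phi>. nt_extension h z = G z"
    using measurable_modification_nt_extension adm by blast
  have [measurable]: "G \<in> borel_measurable \<mu>" using G(1) by simp
  have "AE z in \<mu>. \<phi> z > 0 \<longrightarrow> nt_extension h z = G z" using G(2) by (simp add: AE_density)
  then have "AE z in \<mu>. \<phi> z \<noteq> 0 \<longrightarrow> nt_extension h z = G z"
    by eventually_elim (auto simp: zero_less_iff_neq_zero)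
  moreover have "(\<integral>\<^sup>+z. ennreal ((cmod (nt_extension h z))\<^sup>2) \<partial>density \<mu> \<phi>) =
      (\<integral>\<^sup>+z. ennreal ((cmod (G z))\<^sup>2) \<partial>density \<mu> \<phi>)"
    by (rule nn_integral_cong_AE) (use G(2) in \<open>eventually_elim, simp\<close>)
  then have "(\<integral>\<^sup>+z. ennreal ((cmod (nt_extension h z))\<^sup>2) \<partial>density \<mu> \<phi>) =
      (\<integral>\<^sup>+z. \<phi> z * ennreal ((cmod (G z))\<^sup>2) \<partial>\<mu>)"
    by (simp add: nn_integral_density)
  ultimately show thesis using that \<open>G \<in> borel_measurable \<mu>\<close> by blast
qed

text \<open>Reduces norm bounds to integral bounds, where monotonicity applies; when the integral is
  infinite both sides fail.\<close>

lemma mu_norm_le_iff: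
  assumes "K \<ge> 0"
  shows "mu_norm \<mu> f \<le> ennreal K \<longleftrightarrow> (\<integral>\<^sup>+ z. ennreal ((cmod (nt_extension f z))\<^sup>2) \<partial>\<mu>) \<le> ennreal (K\<^sup>2)"
proof (cases "\<integral>\<^sup>+ z. ennreal ((cmod (nt_extension f z))\<^sup>2) \<partial>\<mu>")
  case (real x)
  then show ?thesis
    using assms real_sqrt_le_iff[of x "K\<^sup>2"] by (simp add: mu_norm_def Let_def)
next
  case top
  then show ?thesis by (simp add: mu_norm_def Let_def top_unique)
qed

section \<open>Transfer of the Carleson property for rational data\<close>

context rational_dBR
begin

text \<open>\<open>a\<close> is known only inside the disk; this is its continuous representative on
  the closed disk.\<close>

definition abar :: "complex \<Rightarrow> complex" where "abar z = poly A z / poly q z"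

lemma continuous_abar: "continuous_on (cball 0 1) abar"
  unfolding abar_def using q_nz by (intro continuous_intros) auto

lemma nt_extension_a: "z \<in> cball 0 1 \<Longrightarrow> nt_extension a z = abar z"
proof (cases "z \<in> \<DD>")
  case True
  then show ?thesis by (simp add: nt_extension_def a_eq abar_def)
next
  case False
  assume "z \<in> cball 0 1"
  with False have z: "z \<in> \<TT>" by auto
  have "has_nt_limit a z (abar z)"
    using has_nt_limit_continuous[OF continuous_abar z] has_nt_limit_cong[of a abar]
    by (simp add: a_eq abar_def)
  then show ?thesis using nt_extension_eq[OF z] by blast
qed

lemma abar_zero_bound:
  assumes "\<zeta> \<in> \<TT>" "abar \<zeta> = 0"
  obtains M where "M \<ge> 0" "\<And>z. z \<in> \<DD> \<Longrightarrow> cmod (a z) \<le> M * cmod (z - \<zeta>)"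
proof -
  have "poly A \<zeta> = 0" using assms q_nz[of \<zeta>] by (simp add: abar_def)
  then obtain B where B: "A = [:-\<zeta>, 1:] * B" by (metis poly_eq_0_iff_dvd dvdE)
  have "continuous_on (cball 0 1) (\<lambda>z. poly B z / poly q z)" using q_nz by (intro continuous_intros) auto
  then obtain M where M: "M \<ge> 1" "\<And>z. z \<in> cball 0 1 \<Longrightarrow> cmod (poly B z / poly q z) \<le> M"
    using compact_cball_bound by blast
  show thesis
  proof (rule that[of M])
    show "cmod (a z) \<le> M * cmod (z - \<zeta>)" if z: "z \<in> \<DD>" for z
    proof -
      have "poly A z = (z - \<zeta>) * poly B z" unfolding B by (simp add: algebra_simps)
      then have "a z = (z - \<zeta>) * (poly B z / poly q z)" by (simp add: a_eq[OF z])
      then have "cmod (a z) = cmod (z - \<zeta>) * cmod (poly B z / poly q z)" by (simp only: norm_mult)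
      also have "\<dots> \<le> cmod (z - \<zeta>) * M" using z by (intro mult_left_mono M(2)) auto
      finally show ?thesis by (simp add: mult.commute)
    qed
  qed (use M in simp)
qed

text \<open>The constant is unchanged when passing to H^2, because multiplication by
  \<open>a\<close> is contractive. In the other direction the continuous part of the decomposition
  adds a multiple of the total mass of \<open>\<mu>\<close>.\<close>

lemma Carleson_iff:
  assumes sets: "sets \<mu> = sets (restrict_space borel (cball 0 1))" and fin: "finite_measure \<mu>"
    and A_nz: "\<And>z. z \<in> \<DD> \<Longrightarrow> poly A z \<noteq> 0"
    and hol: "\<And>f. f \<in> H \<Longrightarrow> f holomorphic_on \<DD>"
  shows "Carleson_measure \<mu> H nrm \<longleftrightarrow>
    Carleson_measure (density \<mu> (\<lambda>z. ennreal ((cmod (nt_extension a z))\<^sup>2))) Hardy2 Hardy2_norm"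
proof -
  define \<phi> where "\<phi> z = ennreal ((cmod (nt_extension a z))\<^sup>2)" for z
  have space: "space \<mu> = cball 0 1"
    using sets_eq_imp_space_eq[OF sets] by (simp add: space_restrict_space)
  have \<phi>_eq: "\<phi> z = ennreal ((cmod (abar z))\<^sup>2)" if "z \<in> cball 0 1" for z
    using nt_extension_a[OF that] by (simp add: \<phi>_def)
  have "abar \<in> borel_measurable \<mu>"
    using borel_measurable_continuous_on_restrict[OF continuous_abar] by (simp add: measurable_cong_sets[OF sets refl])
  then have "(\<lambda>z. ennreal ((cmod (abar z))\<^sup>2)) \<in> borel_measurable \<mu>" by measurable
  then have \<phi>m [measurable]: "\<phi> \<in> borel_measurable \<mu>"
    using measurable_cong[of \<mu> \<phi> "\<lambda>z. ennreal ((cmod (abar z))\<^sup>2)" borel] \<phi>_eq by (simp add: space)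
  have \<phi>_pos: "\<phi> z > 0 \<longleftrightarrow> abar z \<noteq> 0" if "z \<in> cball 0 1" for z using \<phi>_eq[OF that] by simp
  have abar_D: "abar z = a z" "abar z \<noteq> 0" if "z \<in> \<DD>" for z
    using that A_nz[OF that] q_nz[of z] by (auto simp: abar_def a_eq)
  have AE_cball: "AE z in \<mu>. z \<in> cball 0 1" using AE_space[of \<mu>] by (simp add: space)
  have "Carleson_measure \<mu> H nrm \<longleftrightarrow> Carleson_measure (density \<mu> \<phi>) Hardy2 Hardy2_norm"
  proof
    assume car: "Carleson_measure \<mu> H nrm"
    then obtain C where C: "C > 0" "\<And>f. f \<in> H \<Longrightarrow> mu_norm \<mu> f \<le> ennreal (C * nrm f)"
      and adm: "\<And>f. f \<in> H \<Longrightarrow> admissible \<mu> f"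
      by (auto simp: Carleson_measure_def)
    show "Carleson_measure (density \<mu> \<phi>) Hardy2 Hardy2_norm"
      unfolding Carleson_measure_def
    proof (intro conjI exI[of _ C] ballI C(1))
      fix h assume h: "h \<in> Hardy2"
      define f where "f = (\<lambda>z. if z \<in> \<DD> then a z * h z else 0)"
      have f: "f \<in> H" "nrm f \<le> Hardy2_norm h" using mult_Hardy2_mem[OF h] by (auto simp: f_def)
      have flim: "AE z in \<mu>. z \<in> cball 0 1 \<and> (z \<in> \<TT> \<longrightarrow> (\<exists>L. has_nt_limit f z L))"
        using adm[OF f(1)] AE_cball by (simp add: admissible_def)
      \<comment> \<open>Dividing by \<open>abar\<close> recovers the limit of \<open>h\<close>
        exactly at the boundary points that the density sees.\<close>
      have hlim: "has_nt_limit h z (L / abar z)" if z: "z \<in> \<TT>" "has_nt_limit f z L" "abar z \<noteq> 0" for z L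
      proof -
        have "has_nt_limit (\<lambda>z. f z / abar z) z (L / abar z)"
          using has_nt_limit_divide[OF z(2) has_nt_limit_continuous[OF continuous_abar z(1)] z(3)] .
        then show ?thesis
        proof (subst has_nt_limit_cong[of h "\<lambda>z. f z / abar z"])
          show "h w = f w / abar w" if "w \<in> \<DD>" for w using that abar_D[OF that] by (simp add: f_def)
        qed
      qed
      show adm': "admissible (density \<mu> \<phi>) h"
        unfolding admissible_def AE_density[OF \<phi>m]
      proof
        show "h holomorphic_on \<DD>" using h by (simp add: Hardy2_def)
        show "AE z in \<mu>. 0 < \<phi> z \<longrightarrow> z \<in> \<TT> \<longrightarrow> (\<exists>L. has_nt_limit h z L)"
          using flim by eventually_elim (use hlim \<phi>_pos in blast)
      qed
      obtain G where G: "AE z in \<mu>. \<phi> z \<noteq> 0 \<longrightarrow> nt_extension h z = G z"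
        "(\<integral>\<^sup>+z. ennreal ((cmod (nt_extension h z))\<^sup>2) \<partial>density \<mu> \<phi>) = (\<integral>\<^sup>+z. \<phi> z * ennreal ((cmod (G z))\<^sup>2) \<partial>\<mu>)"
        using nn_integral_density_nt_extension[OF sets \<phi>m adm'] by blast
      have "(\<integral>\<^sup>+z. \<phi> z * ennreal ((cmod (G z))\<^sup>2) \<partial>\<mu>) \<le> (\<integral>\<^sup>+z. ennreal ((cmod (nt_extension f z))\<^sup>2) \<partial>\<mu>)"
      proof (rule nn_integral_mono_AE)
        show "AE z in \<mu>. \<phi> z * ennreal ((cmod (G z))\<^sup>2) \<le> ennreal ((cmod (nt_extension f z))\<^sup>2)"
          using G(1) flim
        proof eventually_elim
          case (elim z)
          have z: "z \<in> cball 0 1" using elim by blast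
          show ?case
          proof (cases "abar z = 0")
            case True
            then show ?thesis using \<phi>_eq[OF z] by simp
          next
            case False
            then have Gz: "G z = nt_extension h z" using elim \<phi>_pos[OF z] by auto
            have "nt_extension f z = abar z * nt_extension h z"
            proof (cases "z \<in> \<DD>")
              case True
              then show ?thesis by (simp add: nt_extension_def f_def abar_D)
            next
              case out: False
              then have \<zeta>: "z \<in> \<TT>" using z by auto
              then obtain L where L: "has_nt_limit f z L" using elim by blast
              show ?thesis
                using nt_extension_eq[OF \<zeta> L] nt_extension_eq[OF \<zeta> hlim[OF \<zeta> L False]] False by simp
            qed
            then show ?thesis
              by (simp add: \<phi>_eq[OF z] Gz norm_mult power_mult_distrib ennreal_mult)
          qed
        qed
      qed
      also have "\<dots> \<le> ennreal ((C * nrm f)\<^sup>2)"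
        using C(2)[OF f(1)] C(1) f(1) by (subst mu_norm_le_iff[symmetric]) auto
      also have "\<dots> \<le> ennreal ((C * Hardy2_norm h)\<^sup>2)"
        using C(1) f by (intro ennreal_leI power_mono mult_left_mono) auto
      finally show "mu_norm (density \<mu> \<phi>) h \<le> ennreal (C * Hardy2_norm h)"
        using C(1) Hardy2_norm_nonneg[OF h] by (subst mu_norm_le_iff) (auto simp: G(2))
    qed
  next
    assume "Carleson_measure (density \<mu> \<phi>) Hardy2 Hardy2_norm"
    then obtain C where C: "C > 0" "\<And>g. g \<in> Hardy2 \<Longrightarrow> mu_norm (density \<mu> \<phi>) g \<le> ennreal (C * Hardy2_norm g)"
      and adm: "\<And>g. g \<in> Hardy2 \<Longrightarrow> admissible (density \<mu> \<phi>) g"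
      by (auto simp: Carleson_measure_def)
    obtain K where K: "K \<ge> 0"
      "\<And>f. f \<in> H \<Longrightarrow> \<exists>g s. g \<in> Hardy2 \<and> Hardy2_norm g \<le> nrm f \<and> continuous_on (cball 0 1) s \<and>
      (\<forall>z\<in>\<DD>. f z = a z * g z + s z) \<and> (\<forall>z\<in>cball 0 1. cmod (s z) \<le> K * nrm f)"
      using decomposition by metis
    define m where "m = measure \<mu> (space \<mu>)"
    have m: "m \<ge> 0" "emeasure \<mu> (space \<mu>) = ennreal m"
      using finite_measure.emeasure_eq_measure[OF fin] by (auto simp: m_def)
    \<comment> \<open>From (x + y)^2 <= 2 x^2 + 2 y^2: \<open>C\<close> bounds the part
      \<open>a * g\<close>, and the part \<open>s\<close>, at most \<open>K * nrm f\<close> in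
      modulus, is integrated against a measure of mass \<open>m\<close>.\<close>
    define C' where "C' = sqrt (2 * C\<^sup>2 + 2 * K\<^sup>2 * m)"
    have C'_pos: "C' > 0" unfolding C'_def using C(1) m(1) by (intro real_sqrt_gt_zero add_pos_nonneg) auto
    have C'_sq: "C'\<^sup>2 = 2 * C\<^sup>2 + 2 * K\<^sup>2 * m" unfolding C'_def using m(1) by simp
    show "Carleson_measure \<mu> H nrm"
      unfolding Carleson_measure_def
    proof (intro conjI exI[of _ C'] ballI C'_pos)
      fix f assume f: "f \<in> H"
      obtain g s where g: "g \<in> Hardy2" "Hardy2_norm g \<le> nrm f" and s: "continuous_on (cball 0 1) s"
        and fgs: "\<And>z. z \<in> \<DD> \<Longrightarrow> f z = a z * g z + s z"
        and sb: "\<And>z. z \<in> cball 0 1 \<Longrightarrow> cmod (s z) \<le> K * nrm f"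
        using K(2)[OF f] by blast
      have fgs': "f z = abar z * g z + s z" if "z \<in> \<DD>" for z using fgs[OF that] abar_D[OF that] by simp
      have lim1: "has_nt_limit f z (abar z * L + s z)" if "z \<in> \<TT>" "has_nt_limit g z L" for z L
        using has_nt_limit_add[OF has_nt_limit_mult[OF has_nt_limit_continuous[OF continuous_abar that(1)] that(2)]
            has_nt_limit_continuous[OF s that(1)]]
        by (subst has_nt_limit_cong[OF fgs'])
      \<comment> \<open>At these points admissibility for the weighted measure says nothing about
        \<open>g\<close>; the limit of \<open>f\<close> is produced by the decay of \<open>a\<close>
        alone.\<close>
      have lim0: "has_nt_limit f z (s z)" if z: "z \<in> \<TT>" "abar z = 0" for z
      proof -
        obtain M where M: "M \<ge> 0" "\<And>w. w \<in> \<DD> \<Longrightarrow> cmod (a w) \<le> M * cmod (w - z)" using abar_zero_bound[OF z] by blast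
        from has_nt_limit_add[OF has_nt_limit_zero_mult_Hardy2[OF M(2,1) g(1) z(1)] has_nt_limit_continuous[OF s z(1)]]
        show ?thesis by (subst has_nt_limit_cong[OF fgs]) simp_all
      qed
      have glim: "AE z in \<mu>. z \<in> cball 0 1 \<and> (abar z \<noteq> 0 \<longrightarrow> z \<in> \<TT> \<longrightarrow> (\<exists>L. has_nt_limit g z L))"
      proof -
        have "AE z in \<mu>. 0 < \<phi> z \<longrightarrow> z \<in> \<TT> \<longrightarrow> (\<exists>L. has_nt_limit g z L)"
          using adm[OF g(1)] unfolding admissible_def AE_density[OF \<phi>m] by blast
        then show ?thesis using AE_cball by eventually_elim (use \<phi>_pos in blast)
      qed
      show "admissible \<mu> f"
        unfolding admissible_def
      proof
        show "f holomorphic_on \<DD>" by (rule hol[OF f])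
        show "AE z in \<mu>. z \<in> \<TT> \<longrightarrow> (\<exists>L. has_nt_limit f z L)"
          using glim by eventually_elim (use lim0 lim1 in blast)
      qed
      \<comment> \<open>Splitting the integral of a sum below requires a measurable term. The
        extension of \<open>f\<close> itself occurs only on the smaller side of a monotonicity
        step.\<close>
      obtain G where Gm [measurable]: "G \<in> borel_measurable \<mu>"
        and G: "AE z in \<mu>. \<phi> z \<noteq> 0 \<longrightarrow> nt_extension g z = G z"
        "(\<integral>\<^sup>+z. ennreal ((cmod (nt_extension g z))\<^sup>2) \<partial>density \<mu> \<phi>) = (\<integral>\<^sup>+z. \<phi> z * ennreal ((cmod (G z))\<^sup>2) \<partial>\<mu>)"
        using nn_integral_density_nt_extension[OF sets \<phi>m adm[OF g(1)]] by blast
      define c where "c = 2 * (K * nrm f)\<^sup>2"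
      have c: "c \<ge> 0" by (simp add: c_def)
      have "(\<integral>\<^sup>+z. ennreal ((cmod (nt_extension f z))\<^sup>2) \<partial>\<mu>) \<le>
          (\<integral>\<^sup>+z. 2 * (\<phi> z * ennreal ((cmod (G z))\<^sup>2)) + ennreal c \<partial>\<mu>)"
      proof (rule nn_integral_mono_AE)
        show "AE z in \<mu>. ennreal ((cmod (nt_extension f z))\<^sup>2) \<le> 2 * (\<phi> z * ennreal ((cmod (G z))\<^sup>2)) + ennreal c"
          using G(1) glim
        proof eventually_elim
          case (elim z)
          have z: "z \<in> cball 0 1" using elim by blast
          \<comment> \<open>At a zero of \<open>abar\<close> the value of \<open>G\<close> is
            arbitrary, but it is multiplied by 0, so one formula covers all points.\<close>
          have e: "nt_extension f z = abar z * G z + s z"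
          proof (cases "abar z = 0")
            case True
            then have "z \<in> \<TT>" using z abar_D(2)[of z] by force
            then show ?thesis using nt_extension_eq[OF _ lim0] True by simp
          next
            case False
            then have Gz: "G z = nt_extension g z" using elim \<phi>_pos[OF z] by auto
            show ?thesis
            proof (cases "z \<in> \<DD>")
              case True
              then show ?thesis by (simp add: nt_extension_def Gz fgs')
            next
              case out: False
              then have \<zeta>: "z \<in> \<TT>" using z by auto
              then obtain L where L: "has_nt_limit g z L" using elim False by blast
              show ?thesis
                using nt_extension_eq[OF \<zeta> L] nt_extension_eq[OF \<zeta> lim1[OF \<zeta> L]] Gz by simp
            qed
          qed
          have "(cmod (nt_extension f z))\<^sup>2 \<le> (cmod (abar z * G z) + cmod (s z))\<^sup>2"
            unfolding e by (intro power_mono norm_triangle_ineq) simp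
          also have "\<dots> \<le> 2 * (cmod (abar z * G z))\<^sup>2 + 2 * (cmod (s z))\<^sup>2"
            using sum_squares_bound[of "cmod (abar z * G z)" "cmod (s z)"] by (simp add: power2_sum)
          also have "\<dots> \<le> 2 * ((cmod (abar z))\<^sup>2 * (cmod (G z))\<^sup>2) + c"
            using power_mono[OF sb[OF z], of 2] by (simp add: c_def norm_mult power_mult_distrib)
          finally have "ennreal ((cmod (nt_extension f z))\<^sup>2) \<le> ennreal (2 * ((cmod (abar z))\<^sup>2 * (cmod (G z))\<^sup>2) + c)"
            by (rule ennreal_leI)
          also have "\<dots> = 2 * (\<phi> z * ennreal ((cmod (G z))\<^sup>2)) + ennreal c"
            using c by (simp add: \<phi>_eq[OF z] ennreal_mult)
          finally show ?case .
        qed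
      qed
      also have "\<dots> = 2 * (\<integral>\<^sup>+z. \<phi> z * ennreal ((cmod (G z))\<^sup>2) \<partial>\<mu>) + ennreal c * ennreal m"
        by (subst nn_integral_add) (auto simp: nn_integral_cmult m(2))
      also have "\<dots> \<le> 2 * ennreal ((C * nrm f)\<^sup>2) + ennreal c * ennreal m"
      proof (intro add_right_mono mult_left_mono)
        have "(\<integral>\<^sup>+z. \<phi> z * ennreal ((cmod (G z))\<^sup>2) \<partial>\<mu>) \<le> ennreal ((C * Hardy2_norm g)\<^sup>2)"
          unfolding G(2)[symmetric]
          using C(2)[OF g(1)] C(1) Hardy2_norm_nonneg[OF g(1)] by (subst mu_norm_le_iff[symmetric]) auto
        also have "\<dots> \<le> ennreal ((C * nrm f)\<^sup>2)"
          using C(1) g Hardy2_norm_nonneg[OF g(1)] by (intro ennreal_leI power_mono mult_left_mono) auto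
        finally show "(\<integral>\<^sup>+z. \<phi> z * ennreal ((cmod (G z))\<^sup>2) \<partial>\<mu>) \<le> ennreal ((C * nrm f)\<^sup>2)" .
      qed simp
      also have "\<dots> = ennreal (2 * (C * nrm f)\<^sup>2 + c * m)"
        using c m(1) by (simp add: ennreal_mult)
      also have "2 * (C * nrm f)\<^sup>2 + c * m = (C' * nrm f)\<^sup>2"
        unfolding power_mult_distrib C'_sq c_def by (simp add: algebra_simps)
      finally show "mu_norm \<mu> f \<le> ennreal (C' * nrm f)"
        using C'_pos f by (subst mu_norm_le_iff) auto
    qed
  qed
  then show ?thesis by (simp only: \<phi>_def[abs_def])
qed

end

text \<open>The outer function is prescribed by its modulus on the circle, and that modulus is the
  square root of a rational expression. Spectral factorisation exhibits a rational function with the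
  same modulus and no zeros in the disk, which must then be \<open>a\<close> up to a unimodular
  constant.\<close>

lemma ex_rational_mate:
  assumes rat: "rational_on_disk b" and ne: "nonextreme b" and mate: "pythagorean_mate b a"
  obtains q A p :: "complex poly" where
    "\<And>z. z \<in> cball 0 1 \<Longrightarrow> poly q z \<noteq> 0" "\<And>z. z \<in> \<DD> \<Longrightarrow> poly A z \<noteq> 0"
    "\<And>z. z \<in> \<DD> \<Longrightarrow> b z = poly p z / poly q z" "\<And>z. z \<in> \<DD> \<Longrightarrow> a z = poly A z / poly q z"
    "\<And>\<zeta>. \<zeta> \<in> \<TT> \<Longrightarrow> (cmod (poly q \<zeta>))\<^sup>2 = (cmod (poly p \<zeta>))\<^sup>2 + (cmod (poly A \<zeta>))\<^sup>2"
proof -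
  have b1: "cmod (b z) \<le> 1" if "z \<in> \<DD>" for z
    using ne that by (auto simp: nonextreme_def Hinf_unit_ball_def)
  obtain p0 q0 :: "complex poly" where "\<And>z. z \<in> \<DD> \<Longrightarrow> poly q0 z \<noteq> 0" "\<And>z. z \<in> \<DD> \<Longrightarrow> b z = poly p0 z / poly q0 z"
    using rat unfolding rational_on_disk_def by blast
  then obtain p q :: "complex poly" where q: "\<And>z. z \<in> cball 0 1 \<Longrightarrow> poly q z \<noteq> 0"
    and b: "\<And>z. z \<in> \<DD> \<Longrightarrow> b z = poly p z / poly q z"
    using bounded_rational_pole_free[of q0 b p0] b1 by blast
  have cb: "continuous_on (cball 0 1) (\<lambda>z. poly p z / poly q z)" using q by (intro continuous_intros) auto
  have nt_b: "nt_extension b \<zeta> = poly p \<zeta> / poly q \<zeta>" if \<zeta>: "\<zeta> \<in> \<TT>" for \<zeta>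
  proof (rule nt_extension_eq[OF \<zeta>])
    show "has_nt_limit b \<zeta> (poly p \<zeta> / poly q \<zeta>)"
      using has_nt_limit_continuous[OF cb \<zeta>] has_nt_limit_cong[of b "\<lambda>z. poly p z / poly q z"] b by blast
  qed
  have le: "cmod (poly p \<zeta>) \<le> cmod (poly q \<zeta>)" if \<zeta>: "\<zeta> \<in> \<TT>" for \<zeta>
  proof -
    have "cmod (poly p \<zeta> / poly q \<zeta>) \<le> 1"
    proof (rule continuous_le_on_closure[of \<DD> "\<lambda>z. cmod (poly p z / poly q z)" \<zeta> 1])
      show "continuous_on (closure \<DD>) (\<lambda>z. cmod (poly p z / poly q z))"
        using cb by (simp add: closure_ball continuous_on_norm)
    qed (use \<zeta> b b1 in \<open>auto simp: closure_ball\<close>)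
    then show ?thesis using q[of \<zeta>] \<zeta> by (simp add: norm_divide divide_le_eq)
  qed
  define n where "n = max (degree p) (degree q)"
  have dn: "degree p \<le> n" "degree q \<le> n" by (auto simp: n_def)
  \<comment> \<open>Reflecting both polynomials to the common degree \<open>n\<close> makes |q|^2 -
    |p|^2 on the circle the trigonometric polynomial
    \<open>poly P \<zeta> * cnj \<zeta> ^ n\<close>.\<close>
  define P where "P = q * reciprocal_poly n q - p * reciprocal_poly n p"
  have P_circle: "poly P \<zeta> * cnj \<zeta> ^ n = of_real ((cmod (poly q \<zeta>))\<^sup>2 - (cmod (poly p \<zeta>))\<^sup>2)"
    if \<zeta>: "\<zeta> \<in> \<TT>" for \<zeta>
  proof -
    have nz: "\<zeta> \<noteq> 0" using \<zeta> by auto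
    have "poly f \<zeta> * poly (reciprocal_poly n f) \<zeta> = \<zeta> ^ n * of_real ((cmod (poly f \<zeta>))\<^sup>2)"
      if "degree f \<le> n" for f
      using poly_reciprocal_poly[OF that nz] circle_inverse[OF \<zeta>]
      by (simp add: complex_norm_square mult_ac del: of_real_power)
    then have "poly P \<zeta> = \<zeta> ^ n * of_real ((cmod (poly q \<zeta>))\<^sup>2 - (cmod (poly p \<zeta>))\<^sup>2)"
      using dn by (simp add: P_def algebra_simps)
    moreover have "\<zeta> ^ n * cnj \<zeta> ^ n = 1" using circle_cnj[OF \<zeta>] by (simp add: power_mult_distrib[symmetric])
    ultimately show ?thesis by (simp add: mult_ac)
  qed
  have deg_rec: "degree (reciprocal_poly n f) \<le> n" for f
    unfolding reciprocal_poly_def by (rule degree_sum_le) (auto intro: order_trans[OF degree_monom_le])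
  have "degree P \<le> 2 * n"
    unfolding P_def using dn deg_rec[of p] deg_rec[of q]
    by (intro degree_diff_le order_trans[OF degree_mult_le]) (simp_all add: add_mono mult_2)
  moreover have P_nonneg: "poly P \<zeta> * cnj \<zeta> ^ n \<in> \<real>\<^sub>\<ge>\<^sub>0" if "\<zeta> \<in> \<TT>" for \<zeta>
    unfolding P_circle[OF that] using le[OF that] by (simp add: power_mono del: of_real_diff of_real_power)
  have out: "outer_function a" and eq1: "AE \<zeta> in circle_measure. (cmod (nt_extension a \<zeta>))\<^sup>2 + (cmod (nt_extension b \<zeta>))\<^sup>2 = 1"
    using mate by (auto simp: pythagorean_mate_def)
  have eq2: "AE \<zeta> in circle_measure. \<zeta> \<in> \<TT> \<and> (cmod (nt_extension a \<zeta>))\<^sup>2 + (cmod (poly p \<zeta> / poly q \<zeta>))\<^sup>2 = 1"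
    using eq1 AE_space by eventually_elim (auto simp: nt_b)
  have nz: "AE \<zeta> in circle_measure. \<zeta> \<in> \<TT> \<longrightarrow> nt_extension a \<zeta> \<noteq> 0"
  proof -
    have "AE \<zeta> in circle_measure. \<exists>L. has_nt_limit a \<zeta> L \<and> L \<noteq> 0"
      using out by (simp add: outer_function_def)
    then show ?thesis by eventually_elim (auto simp: nt_extension_eq)
  qed
  \<comment> \<open>Otherwise |b| = 1 on the whole circle, and \<open>a\<close> would have boundary
    values 0 almost everywhere, contrary to being outer.\<close>
  have "P \<noteq> 0"
  proof
    assume P0: "P = 0"
    have "AE \<zeta> in circle_measure. False"
      using eq2 nz
    proof eventually_elim
      case (elim \<zeta>)
      then have \<zeta>: "\<zeta> \<in> \<TT>" by blast
      have "(cmod (poly q \<zeta>))\<^sup>2 - (cmod (poly p \<zeta>))\<^sup>2 = 0"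
        using P_circle[OF \<zeta>] P0 by (metis mult_zero_left of_real_eq_0_iff poly_0)
      moreover have "(cmod (poly q \<zeta>))\<^sup>2 \<noteq> 0" using q[of \<zeta>] \<zeta> by simp
      ultimately have "(cmod (poly p \<zeta> / poly q \<zeta>))\<^sup>2 = 1" by (simp add: norm_divide power_divide)
      then show False using elim \<zeta> by simp
    qed
    then show False using circle.AE_const by simp
  qed
  ultimately obtain A0 where A0: "\<And>z. z \<in> \<DD> \<Longrightarrow> poly A0 z \<noteq> 0"
    and A0': "\<And>\<zeta>. \<zeta> \<in> \<TT> \<Longrightarrow> poly P \<zeta> * cnj \<zeta> ^ n = of_real ((cmod (poly A0 \<zeta>))\<^sup>2)"
    using fejer_riesz[of P n] P_nonneg by blast
  have A0_sq: "(cmod (poly q \<zeta>))\<^sup>2 = (cmod (poly p \<zeta>))\<^sup>2 + (cmod (poly A0 \<zeta>))\<^sup>2" if "\<zeta> \<in> \<TT>" for \<zeta>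
  proof -
    have "(cmod (poly q \<zeta>))\<^sup>2 - (cmod (poly p \<zeta>))\<^sup>2 = (cmod (poly A0 \<zeta>))\<^sup>2"
      using P_circle[OF that] A0'[OF that] by (metis of_real_eq_iff)
    then show ?thesis by simp
  qed
  have "AE \<zeta> in circle_measure. cmod (nt_extension a \<zeta>) = cmod (poly A0 \<zeta> / poly q \<zeta>)"
    using eq2
  proof eventually_elim
    case (elim \<zeta>)
    then have \<zeta>: "\<zeta> \<in> \<TT>" by blast
    have "(cmod (poly q \<zeta>))\<^sup>2 \<noteq> 0" using q[of \<zeta>] \<zeta> by simp
    then have "(cmod (poly p \<zeta> / poly q \<zeta>))\<^sup>2 + (cmod (poly A0 \<zeta> / poly q \<zeta>))\<^sup>2 = 1"
      unfolding norm_divide power_divide add_divide_distrib[symmetric] A0_sq[OF \<zeta>, symmetric] by simp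
    then have "(cmod (nt_extension a \<zeta>))\<^sup>2 = (cmod (poly A0 \<zeta> / poly q \<zeta>))\<^sup>2" using elim by linarith
    then show ?case by (rule power2_eq_imp_eq) auto
  qed
  then obtain c where c: "cmod c = 1" "\<And>z. z \<in> \<DD> \<Longrightarrow> a z = c * (poly A0 z / poly q z)"
    using outer_function_rational[OF out A0 q] by blast
  show thesis
  proof (rule that[of q "smult c A0" p])
    show "poly (smult c A0) z \<noteq> 0" if "z \<in> \<DD>" for z using A0[OF that] c(1) by auto
    show "(cmod (poly q \<zeta>))\<^sup>2 = (cmod (poly p \<zeta>))\<^sup>2 + (cmod (poly (smult c A0) \<zeta>))\<^sup>2" if "\<zeta> \<in> \<TT>" for \<zeta>
      using A0_sq[OF that] c(1) by (simp add: norm_mult)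
  qed (use q b c in auto)
qed

theorem theorem1p9:
  fixes a b :: "complex \<Rightarrow> complex" and \<mu> :: "complex measure"
    and Hb :: "(complex \<Rightarrow> complex) set"
    and ip :: "(complex \<Rightarrow> complex) \<Rightarrow> (complex \<Rightarrow> complex) \<Rightarrow> complex"
  assumes "rational_on_disk b" and "nonextreme b"
    and "pythagorean_mate b a"
    and "is_dBR_space b Hb ip"
    and "\<mu> \<in> Mplus"
  shows "Carleson_measure \<mu> Hb (ip_norm ip) \<longleftrightarrow>
    Carleson_measure (density \<mu> (\<lambda>z. ennreal ((cmod (nt_extension a z))\<^sup>2))) Hardy2 Hardy2_norm"
proof (rule ex_rational_mate[OF assms(1-3)])
  fix q A p :: "complex poly"
  assume pqA:
    "\<And>z. z \<in> cball 0 1 \<Longrightarrow> poly q z \<noteq> 0" "\<And>z. z \<in> \<DD> \<Longrightarrow> poly A z \<noteq> 0"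
    "\<And>z. z \<in> \<DD> \<Longrightarrow> b z = poly p z / poly q z" "\<And>z. z \<in> \<DD> \<Longrightarrow> a z = poly A z / poly q z"
    "\<And>\<zeta>. \<zeta> \<in> \<TT> \<Longrightarrow> (cmod (poly q \<zeta>))\<^sup>2 = (cmod (poly p \<zeta>))\<^sup>2 + (cmod (poly A \<zeta>))\<^sup>2"
  interpret rkhs "\<DD>" "dBR_kernel b" Hb ip using assms(4) by (simp add: is_dBR_space_def)
  interpret rational_dBR b Hb ip a p q A by unfold_locales (fact pqA)+
  have "nrm = ip_norm ip" by (rule ext) (simp add: nrm_def)
  moreover have "Carleson_measure \<mu> Hb nrm \<longleftrightarrow>
      Carleson_measure (density \<mu> (\<lambda>z. ennreal ((cmod (nt_extension a z))\<^sup>2))) Hardy2 Hardy2_norm"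
  proof (rule Carleson_iff)
    show "sets \<mu> = sets (restrict_space borel (cball 0 1))" "finite_measure \<mu>"
      using assms(5) by (auto simp: Mplus_def)
    show "f holomorphic_on \<DD>" if "f \<in> Hb" for f
      using assms(4) that by (simp add: is_dBR_space_def)
  qed (fact pqA(2))
  ultimately show ?thesis by simp
qed

end
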